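(* Let $A$ be a finite local commutative ring that is not a field. Then the line graph $L(EG(A))$ of the essential graph of $A$ is planar if and only if $A$ is isomorphic to one of the following 13 rings: $\mathbb{Z}_4$, $\mathbb{Z}_8$, $\mathbb{Z}_9$, $\mathbb{Z}_{25}$, $\frac{\mathbb{Z}_2[x]}{\langle x^2\rangle}$, $\frac{\mathbb{Z}_3[x]}{\langle x^2\rangle}$, $\frac{\mathbb{Z}_2[x]}{\langle x^3\rangle}$, $\frac{\mathbb{Z}_5[x]}{\langle x^2\rangle}$, $\frac{\mathbb{Z}_4[x]}{\langle x^3, x^2-2\rangle}$, $\frac{\mathbb{F}_4[x]}{\langle x^2\rangle}$, $\frac{\mathbb{Z}_4[x]}{\langle 2x, x^2\rangle}$, $\frac{\mathbb{Z}_2[x,y]}{\langle x^2, xy, y^2\rangle}$, $\frac{\mathbb{Z}_4[x]}{\langle x^2+x+1\rangle}$.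
   Context: All rings have unity $1\neq 0$. $\mathbb{Z}_n$ is the ring of integers modulo $n$ and $\mathbb{F}_n$ the finite field with $n$ elements. A ring is local if it has exactly one maximal ideal. An ideal $I$ of a commutative ring $A$ is essential if $I\cap J\neq 0$ for every non-zero ideal $J$ of $A$ (so $A$ itself is essential). For $s\in A$, $\mathrm{ann}_A(s)=\{r\in A : sr=0\}$. The essential graph $EG(A)$ is the simple undirected graph whose vertices are the non-zero zero-divisors of $A$, two distinct vertices $u,v$ being adjacent if and only if $\mathrm{ann}_A(uv)$ is an essential ideal of $A$. The line graph $L(G)$ of a graph $G$ has the edges of $G$ as vertices, two distinct ones being adjacent exactly when the corresponding edges share an endpoint in $G$. A graph is planar if it can be drawn in the plane without edge crossings; the line graph of a graph with no edges is the empty graph, regarded as planar. *)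

theory Defs
  imports "HOL-Analysis.Analysis" "HOL-Number_Theory.Number_Theory" "HOL-Algebra.Algebra"
begin

section \<open>Simple undirected graphs, line graphs and planarity\<close>

record 'a ugraph =
  verts :: "'a set"
  edges :: "'a set set"

definition line_graph :: "'a ugraph \<Rightarrow> 'a set ugraph" where
  "line_graph G =
     \<lparr>verts = edges G,
      edges = {{e, f} | e f. e \<in> edges G \<and> f \<in> edges G \<and> e \<noteq> f \<and> e \<inter> f \<noteq> {}}\<rparr>"

text \<open>
  A drawing sends the vertices injectively to points of the plane \<open>\<real>\<^sup>2\<close>, modelled by the type
  \<^typ>\<open>complex\<close>, and every edge to an arc joining its two end points. An arc meets the vertex
  points only in its own end points, and two different arcs meet only in the points of the vertices
  that the two edges share.
\<close>

definition plane_drawing ::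
  "'a ugraph \<Rightarrow> ('a \<Rightarrow> complex) \<Rightarrow> ('a set \<Rightarrow> real \<Rightarrow> complex) \<Rightarrow> bool" where
  "plane_drawing G p \<gamma> \<longleftrightarrow>
     inj_on p (verts G) \<and>
     (\<forall>e\<in>edges G. arc (\<gamma> e) \<and> {pathstart (\<gamma> e), pathfinish (\<gamma> e)} = p ` e \<and>
                  path_image (\<gamma> e) \<inter> p ` verts G = p ` e) \<and>
     (\<forall>e\<in>edges G. \<forall>f\<in>edges G. e \<noteq> f \<longrightarrow>
                  path_image (\<gamma> e) \<inter> path_image (\<gamma> f) = p ` (e \<inter> f))"

definition planar :: "'a ugraph \<Rightarrow> bool" where
  "planar G \<longleftrightarrow> (\<exists>p \<gamma>. plane_drawing G p \<gamma>)"


section \<open>The essential graph of a commutative ring\<close>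

definition local_ring :: "('a, 'm) ring_scheme \<Rightarrow> bool" where
  "local_ring R \<longleftrightarrow> (\<exists>!M. maximalideal M R)"

definition essential_ideal :: "'a set \<Rightarrow> ('a, 'm) ring_scheme \<Rightarrow> bool" where
  "essential_ideal I R \<longleftrightarrow>
     ideal I R \<and> (\<forall>J. ideal J R \<and> J \<noteq> {\<zero>\<^bsub>R\<^esub>} \<longrightarrow> I \<inter> J \<noteq> {\<zero>\<^bsub>R\<^esub>})"

definition ann :: "('a, 'm) ring_scheme \<Rightarrow> 'a \<Rightarrow> 'a set" where
  "ann R s = {r \<in> carrier R. s \<otimes>\<^bsub>R\<^esub> r = \<zero>\<^bsub>R\<^esub>}"

definition nonzero_zero_divisors :: "('a, 'm) ring_scheme \<Rightarrow> 'a set" where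
  "nonzero_zero_divisors R =
     {x \<in> carrier R. x \<noteq> \<zero>\<^bsub>R\<^esub> \<and> (\<exists>y\<in>carrier R. y \<noteq> \<zero>\<^bsub>R\<^esub> \<and> x \<otimes>\<^bsub>R\<^esub> y = \<zero>\<^bsub>R\<^esub>)}"

definition essential_graph :: "('a, 'm) ring_scheme \<Rightarrow> 'a ugraph" where
  "essential_graph R =
     \<lparr>verts = nonzero_zero_divisors R,
      edges = {{u, v} | u v. u \<in> nonzero_zero_divisors R \<and> v \<in> nonzero_zero_divisors R \<and>
                             u \<noteq> v \<and> essential_ideal (ann R (u \<otimes>\<^bsub>R\<^esub> v)) R}\<rparr>"


section \<open>Quotients of polynomial rings\<close>

definition pvar :: "('a, 'm) ring_scheme \<Rightarrow> nat \<Rightarrow> 'a" where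
  "pvar R = up_ring.monom (UP R) \<one>\<^bsub>R\<^esub> 1"

definition pconst :: "('a, 'm) ring_scheme \<Rightarrow> 'a \<Rightarrow> nat \<Rightarrow> 'a" where
  "pconst R c = up_ring.monom (UP R) c 0"

text \<open>\<open>R[x] / \<langle>S\<rangle>\<close>\<close>

definition poly_quot :: "('a, 'm) ring_scheme \<Rightarrow> (nat \<Rightarrow> 'a) set \<Rightarrow> (nat \<Rightarrow> 'a) set ring" where
  "poly_quot R S = UP R Quot (Idl\<^bsub>UP R\<^esub> S)"

text \<open>\<open>R[x] / \<langle>x\<^sup>k\<rangle>\<close>\<close>

definition poly_mod_power :: "('a, 'm) ring_scheme \<Rightarrow> nat \<Rightarrow> (nat \<Rightarrow> 'a) set ring" where
  "poly_mod_power R k = poly_quot R {pvar R [^]\<^bsub>UP R\<^esub> k}"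

text \<open>The field with four elements, as \<open>\<int>\<^sub>2[t] / \<langle>t\<^sup>2 + t + 1\<rangle>\<close>\<close>

definition F4 :: "(nat \<Rightarrow> int) set ring" where
  "F4 = (let R = residue_ring 2; t = pvar R in
     poly_quot R {t [^]\<^bsub>UP R\<^esub> (2::nat) \<oplus>\<^bsub>UP R\<^esub> t \<oplus>\<^bsub>UP R\<^esub> \<one>\<^bsub>UP R\<^esub>})"

text \<open>\<open>\<int>\<^sub>4[x] / \<langle>x\<^sup>3, x\<^sup>2 - 2\<rangle>\<close>\<close>

definition Z4_x3_x2m2 :: "(nat \<Rightarrow> int) set ring" where
  "Z4_x3_x2m2 = (let R = residue_ring 4; x = pvar R in
     poly_quot R {x [^]\<^bsub>UP R\<^esub> (3::nat), x [^]\<^bsub>UP R\<^esub> (2::nat) \<ominus>\<^bsub>UP R\<^esub> pconst R 2})"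

text \<open>\<open>\<int>\<^sub>4[x] / \<langle>2x, x\<^sup>2\<rangle>\<close>\<close>

definition Z4_2x_x2 :: "(nat \<Rightarrow> int) set ring" where
  "Z4_2x_x2 = (let R = residue_ring 4; x = pvar R in
     poly_quot R {pconst R 2 \<otimes>\<^bsub>UP R\<^esub> x, x [^]\<^bsub>UP R\<^esub> (2::nat)})"

text \<open>\<open>\<int>\<^sub>4[x] / \<langle>x\<^sup>2 + x + 1\<rangle>\<close>\<close>

definition Z4_x2_x_1 :: "(nat \<Rightarrow> int) set ring" where
  "Z4_x2_x_1 = (let R = residue_ring 4; x = pvar R in
     poly_quot R {x [^]\<^bsub>UP R\<^esub> (2::nat) \<oplus>\<^bsub>UP R\<^esub> x \<oplus>\<^bsub>UP R\<^esub> \<one>\<^bsub>UP R\<^esub>})"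

text \<open>\<open>\<int>\<^sub>2[x,y] / \<langle>x\<^sup>2, xy, y\<^sup>2\<rangle>\<close>, with \<open>\<int>\<^sub>2[x,y]\<close> realised as \<open>\<int>\<^sub>2[x][y]\<close>\<close>

definition Z2_xy_x2_xy_y2 :: "(nat \<Rightarrow> nat \<Rightarrow> int) set ring" where
  "Z2_xy_x2_xy_y2 = (let R = residue_ring 2; P = UP R; x = pconst P (pvar R); y = pvar P in
     poly_quot P {x [^]\<^bsub>UP P\<^esub> (2::nat), x \<otimes>\<^bsub>UP P\<^esub> y, y [^]\<^bsub>UP P\<^esub> (2::nat)})"

end

theory Submission
  imports Defs
begin

text \<open>
  In a finite local ring \<open>A\<close> with maximal ideal \<open>M \<noteq> 0\<close> every non-zero ideal contains a non-zero element
  killed by \<open>M\<close> (\<open>ideal_meets_socle\<close>). Hence the zero divisors are exactly the elements of \<open>M\<close>, and the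
  annihilator of any element of \<open>M\<close> is essential. Products of vertices lie in \<open>M\<close>, so the essential
  graph is the complete graph on \<open>M - {0}\<close>, and the theorem splits into a topological and an algebraic
  question.

  The line graph of a complete graph on \<open>n\<close> vertices is planar iff \<open>n \<le> 4\<close>. For \<open>n = 4\<close> it is the
  octahedron, which has a straight line drawing. For \<open>n \<ge> 5\<close> it contains a subdivision of the complete
  bipartite graph on 3 + 3 vertices. That this graph cannot be drawn follows from the Jordan curve
  theorem and Janiszewski's theorem (\<open>theta_curve_no_tripod\<close>). So planarity means \<open>|M| \<le> 5\<close>.

  Let \<open>q\<close> be the order of the residue field, so \<open>|A| = q |M|\<close>. A non-zero \<open>s\<close> with \<open>M s = 0\<close> generates an ideal
  with \<open>q\<close> elements inside \<open>M\<close>, so \<open>q\<close> divides \<open>|M|\<close> (\<open>socle_generator\<close>). With \<open>|M| \<le> 5\<close> this leaves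
  \<open>q = |M| \<in> {2, 3, 4, 5}\<close>, and \<open>q = 2\<close> with \<open>|M| = 4\<close>. If \<open>q = |M|\<close>, then \<open>M\<close> is a line over the residue field
  with square zero. For a prime \<open>q\<close> the ring is \<open>\<int>\<^sub>q[x]/(x\<^sup>2)\<close> or \<open>\<int>/q\<^sup>2\<close>, according to whether \<open>q\<close> vanishes
  in \<open>A\<close>. For \<open>q = 4\<close> a primitive third root of unity lifts from the residue field to \<open>A\<close>, and again the
  vanishing of 2 separates the two rings. If \<open>q = 2\<close> and \<open>|M| = 4\<close>, then \<open>|A| = 8\<close> and the five
  remaining rings are told apart by whether 4 and 2 vanish and whether \<open>M\<close> contains an element with
  non-zero square.

  Each isomorphism is obtained by counting: the presentation gives a surjective homomorphism onto \<open>A\<close>, and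
  the relations bound the order of the presented ring by that of \<open>A\<close> (\<open>ring_iso_if_surj\<close>). The same bounds
  give the converse. An order of at most 9 forces \<open>|M| \<le> 4\<close>. For the orders 25 and 16, the relation 25 = 0 forces
  \<open>q \<ge> 5\<close> and a root of \<open>t\<^sup>2 + t + 1\<close> forces \<open>q \<ge> 3\<close>, so that again \<open>|M| \<le> 5\<close>.
\<close>

section \<open>Non-planarity\<close>

text \<open>
  The complete bipartite graph on the triples \<open>a, b, x\<close> and \<open>u, v, w\<close> has no plane drawing for the
  following reason. Since \<open>W\<close> avoids the Jordan curve \<open>\<alpha> \<union> \<beta>\<close>, the open arc \<open>\<gamma>\<close> lies on the same side of it as \<open>x\<close>. Take
  \<open>y\<close> on the other side, \<open>Y\<close>. All of \<open>\<alpha> \<union> \<beta>\<close> bounds \<open>Y\<close>, so \<open>y\<close> can be joined to \<open>x\<close> through \<open>v\<close> and \<open>V\<close> without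
  meeting \<open>\<alpha> \<union> \<gamma>\<close>, and through \<open>u\<close> and \<open>U\<close> without meeting \<open>\<beta> \<union> \<gamma>\<close>. These two sets intersect in the
  connected set \<open>\<gamma>\<close>, so by Janiszewski's theorem their union does not separate \<open>x\<close> from \<open>y\<close> either,
  although \<open>\<alpha> \<union> \<beta>\<close> does.
\<close>

lemma theta_curve_no_tripod:
  fixes \<alpha> \<beta> \<gamma> :: "real \<Rightarrow> complex"
  assumes arcs: "arc \<alpha>" "arc \<beta>" "arc \<gamma>"
    and ends: "pathstart \<alpha> = a" "pathfinish \<alpha> = b" "pathstart \<beta> = a" "pathfinish \<beta> = b"
              "pathstart \<gamma> = a" "pathfinish \<gamma> = b"
    and disj: "path_image \<alpha> \<inter> path_image \<beta> = {a, b}" "path_image \<alpha> \<inter> path_image \<gamma> = {a, b}"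
              "path_image \<beta> \<inter> path_image \<gamma> = {a, b}"
    and conn: "connected U" "connected V" "connected W" and x: "x \<in> U" "x \<in> V" "x \<in> W"
    and u: "u \<in> U" "u \<in> path_image \<alpha>" and v: "v \<in> V" "v \<in> path_image \<beta>"
    and w: "w \<in> W" "w \<in> path_image \<gamma>"
    and U: "U \<inter> (path_image \<beta> \<union> path_image \<gamma>) = {}"
    and V: "V \<inter> (path_image \<alpha> \<union> path_image \<gamma>) = {}"
    and W: "W \<inter> (path_image \<alpha> \<union> path_image \<beta>) = {}"
  shows False
proof -
  have ab: "a \<noteq> b"
    using arc_distinct_ends[OF arcs(1)] ends by auto
  define c where "c = \<alpha> +++ reversepath \<beta>"
  have c: "simple_path c" "pathfinish c = pathstart c"
    unfolding c_def using arcs ends disj by (auto intro!: simple_path_join_loop simp: arc_reversepath)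
  have ci: "path_image c = path_image \<alpha> \<union> path_image \<beta>"
    unfolding c_def using ends by (subst path_image_join) auto
  obtain I J where IJ: "I \<noteq> {}" "connected I" "J \<noteq> {}" "connected J" "open I" "open J" "I \<inter> J = {}"
      "I \<union> J = - path_image c" "frontier I = path_image c" "frontier J = path_image c"
    using Jordan_curve[OF c] by metis
  \<comment> \<open>the open arc \<open>\<gamma>\<close> lies on the side of \<open>x\<close>\<close>
  define \<Gamma> where "\<Gamma> = path_image \<gamma> - {a, b}"
  have "connected \<Gamma>"
    unfolding \<Gamma>_def using connected_simple_path_endless[OF arc_imp_simple_path[OF arcs(3)]] ends by simp
  moreover have "w \<in> \<Gamma>"
    unfolding \<Gamma>_def using w W disj by auto
  ultimately have conn_WG: "connected (W \<union> \<Gamma>)"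
    using conn(3) w by (intro connected_Un) auto
  have WG: "W \<union> \<Gamma> \<subseteq> I \<union> J"
    unfolding IJ ci \<Gamma>_def using W disj by auto
  obtain Y where Y: "Y \<noteq> {}" "connected Y" "open Y" "Y \<inter> (W \<union> \<Gamma>) = {}"
      "frontier Y = path_image c" "Y \<inter> path_image c = {}"
      "\<And>z. z \<in> Y \<Longrightarrow> \<not> connected_component (- path_image c) x z"
  proof -
    have side: "D \<subseteq> I \<or> D \<subseteq> J" if "connected D" "D \<subseteq> I \<union> J" for D
      using connectedD[OF that(1) IJ(5,6)] that(2) IJ(7) by blast
    have sep: "\<not> connected_component (- path_image c) p q" if "p \<in> I" "q \<in> J" for p q
    proof
      assume "connected_component (- path_image c) p q"
      then obtain D where "connected D" "D \<subseteq> I \<union> J" "p \<in> D" "q \<in> D"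
        unfolding connected_component_def IJ by blast
      then show False
        using side[of D] that IJ(7) by blast
    qed
    then have sep': "\<not> connected_component (- path_image c) q p" if "p \<in> I" "q \<in> J" for p q
      using that connected_component_sym by metis
    show thesis
    proof (cases "W \<union> \<Gamma> \<subseteq> I")
      case True
      then show ?thesis
        using sep[of x] x(3) IJ by (intro that[of J]) auto
    next
      case False
      then have "W \<union> \<Gamma> \<subseteq> J"
        using side[OF conn_WG WG] by auto
      then show ?thesis
        using sep' x(3) IJ by (intro that[of I]) auto
    qed
  qed
  obtain y where y: "y \<in> Y"
    using Y by auto
  have cl: "z \<in> closure Y" if "z \<in> path_image c" for z
    using that Y(5) unfolding frontier_def by auto
  have Ydisj: "Y \<inter> path_image \<gamma> = {}"
    using Y(4,6) ends ci pathstart_in_path_image[of \<alpha>] pathfinish_in_path_image[of \<alpha>]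
    unfolding \<Gamma>_def by auto
  have reach: "connected_component (- (S \<union> path_image \<gamma>)) x y"
    if "connected Z" "x \<in> Z" "z \<in> Z" "Z \<inter> (S \<union> path_image \<gamma>) = {}" "z \<in> path_image c"
      "S \<subseteq> path_image c" for Z z S
  proof -
    have "connected (insert z Y)"
      by (rule connected_intermediate_closure[OF Y(2)]) (use cl[OF that(5)] closure_subset in auto)
    then have "connected (Z \<union> insert z Y)"
      using that by (intro connected_Un) auto
    moreover have "Z \<union> insert z Y \<subseteq> - (S \<union> path_image \<gamma>)"
      using that Y(6) Ydisj by blast
    ultimately show ?thesis
      unfolding connected_component_def using that(2) y by (intro exI[of _ "Z \<union> insert z Y"]) auto
  qed
  have "connected_component (- ((path_image \<alpha> \<union> path_image \<gamma>) \<union> (path_image \<beta> \<union> path_image \<gamma>))) x y"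
  proof (rule Janiszewski)
    have "(path_image \<alpha> \<union> path_image \<gamma>) \<inter> (path_image \<beta> \<union> path_image \<gamma>) = path_image \<gamma>"
      using disj ends pathstart_in_path_image[of \<gamma>] pathfinish_in_path_image[of \<gamma>] by auto
    then show "connected ((path_image \<alpha> \<union> path_image \<gamma>) \<inter> (path_image \<beta> \<union> path_image \<gamma>))"
      using arcs by (simp add: connected_arc_image)
    show "compact (path_image \<alpha> \<union> path_image \<gamma>)" "closed (path_image \<beta> \<union> path_image \<gamma>)"
      using arcs by (auto intro!: compact_Un closed_Un simp: compact_arc_image closed_arc_image)
    show "connected_component (- (path_image \<alpha> \<union> path_image \<gamma>)) x y"
      by (rule reach[of V v]) (use conn x v V ci in auto)
    show "connected_component (- (path_image \<beta> \<union> path_image \<gamma>)) x y"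
      by (rule reach[of U u]) (use conn x u U ci in auto)
  qed
  then have "connected_component (- path_image c) x y"
    by (rule connected_component_of_subset) (auto simp: ci)
  then show False
    using Y(7)[OF y] by simp
qed

text \<open>
  A drawing does not prescribe the direction of the arc of an edge, so the arc is reversed if necessary.
\<close>

lemma plane_drawing_edge:
  assumes "plane_drawing G p \<gamma>" "{u, v} \<in> edges G" "u \<noteq> v" "u \<in> verts G" "v \<in> verts G"
  obtains g where "arc g" "pathstart g = p u" "pathfinish g = p v" "path_image g = path_image (\<gamma> {u, v})"
proof -
  have e: "arc (\<gamma> {u, v})" "{pathstart (\<gamma> {u, v}), pathfinish (\<gamma> {u, v})} = {p u, p v}"
    using assms(1,2) unfolding plane_drawing_def by auto
  show thesis
  proof (cases "pathstart (\<gamma> {u, v}) = p u")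
    case True
    then have "pathfinish (\<gamma> {u, v}) = p v"
      using e by (auto simp: doubleton_eq_iff)
    with True e show ?thesis by (intro that[of "\<gamma> {u, v}"]) auto
  next
    case False
    then have "pathstart (\<gamma> {u, v}) = p v" "pathfinish (\<gamma> {u, v}) = p u"
      using e by (auto simp: doubleton_eq_iff)
    with e show ?thesis by (intro that[of "reversepath (\<gamma> {u, v})"]) (auto simp: arc_reversepath)
  qed
qed

text \<open>
  The triples are \<open>a, b, x\<close> and \<open>m, n, k\<close>, and \<open>y\<close> subdivides the edge between \<open>x\<close> and \<open>k\<close>. The paths from \<open>a\<close>
  to \<open>b\<close> through \<open>m\<close>, \<open>n\<close> and \<open>k\<close> form the theta curve.
\<close>

lemma planar_no_subdivided_K33:
  assumes "planar G"
    and V: "{a, b, m, n, k, x, y} \<subseteq> verts G" and d: "distinct [a, b, m, n, k, x, y]"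
    and E: "{a, m} \<in> edges G" "{m, b} \<in> edges G" "{a, n} \<in> edges G" "{n, b} \<in> edges G"
      "{a, k} \<in> edges G" "{k, b} \<in> edges G" "{x, m} \<in> edges G" "{x, n} \<in> edges G"
      "{x, y} \<in> edges G" "{y, k} \<in> edges G"
  shows False
proof -
  obtain p \<gamma> where dr: "plane_drawing G p \<gamma>"
    using assms(1) unfolding planar_def by auto
  have meet: "path_image (\<gamma> e) \<inter> path_image (\<gamma> f) = p ` (e \<inter> f)"
    if "e \<in> edges G" "f \<in> edges G" "e \<noteq> f" for e f
    using dr that unfolding plane_drawing_def by blast
  have sides: "\<exists>g. arc g \<and> pathstart g = p a \<and> pathfinish g = p b \<and>
      path_image g = path_image (\<gamma> {a, z}) \<union> path_image (\<gamma> {z, b})"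
    if z: "z \<in> {m, n, k}" for z
  proof -
    have zE: "{a, z} \<in> edges G" "{z, b} \<in> edges G" and zd: "a \<noteq> z" "z \<noteq> b" "a \<noteq> b" "z \<in> verts G"
      using z E d V by auto
    obtain g where g: "arc g" "pathstart g = p a" "pathfinish g = p z" "path_image g = path_image (\<gamma> {a, z})"
      using plane_drawing_edge[OF dr zE(1)] zd V by auto
    obtain h where h: "arc h" "pathstart h = p z" "pathfinish h = p b" "path_image h = path_image (\<gamma> {z, b})"
      using plane_drawing_edge[OF dr zE(2)] zd V by auto
    have "{a, z} \<noteq> {z, b}" "{a, z} \<inter> {z, b} = {z}"
      using zd by auto
    then have "path_image g \<inter> path_image h = {p z}"
      using meet[OF zE] g h by auto
    then show ?thesis
      using g h by (intro exI[of _ "g +++ h"]) (simp add: arc_join path_image_join)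
  qed
  obtain \<alpha> where \<alpha>: "arc \<alpha>" "pathstart \<alpha> = p a" "pathfinish \<alpha> = p b"
      "path_image \<alpha> = path_image (\<gamma> {a, m}) \<union> path_image (\<gamma> {m, b})"
    using sides[of m] by auto
  obtain \<beta> where \<beta>: "arc \<beta>" "pathstart \<beta> = p a" "pathfinish \<beta> = p b"
      "path_image \<beta> = path_image (\<gamma> {a, n}) \<union> path_image (\<gamma> {n, b})"
    using sides[of n] by auto
  obtain \<delta> where \<delta>: "arc \<delta>" "pathstart \<delta> = p a" "pathfinish \<delta> = p b"
      "path_image \<delta> = path_image (\<gamma> {a, k}) \<union> path_image (\<gamma> {k, b})"
    using sides[of k] by auto
  have conn: "connected (path_image (\<gamma> e))" if "e \<in> edges G" for e
    using dr that unfolding plane_drawing_def by (simp add: connected_arc_image)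
  have ends: "p v \<in> path_image (\<gamma> e)" if "e \<in> edges G" "v \<in> e" for e v
    using dr that unfolding plane_drawing_def by blast
  have meet0: "path_image (\<gamma> e) \<inter> path_image (\<gamma> f) = {}"
    if "e \<in> edges G" "f \<in> edges G" "e \<inter> f = {}" "e \<noteq> {}" for e f
    using meet[of e f] that by auto
  have meet1: "path_image (\<gamma> e) \<inter> path_image (\<gamma> f) = {p v}"
    if "e \<in> edges G" "f \<in> edges G" "e \<inter> f = {v}" "e \<noteq> f" for e f v
    using meet[of e f] that by simp
  have two: "(path_image (\<gamma> {a, u}) \<union> path_image (\<gamma> {u, b})) \<inter> (path_image (\<gamma> {a, v}) \<union> path_image (\<gamma> {v, b})) = {p a, p b}"
    if "u \<in> {m, n, k}" "v \<in> {m, n, k}" "u \<noteq> v" for u v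
  proof -
    have ne: "a \<noteq> b" "a \<noteq> u" "a \<noteq> v" "b \<noteq> u" "b \<noteq> v"
      using that d by auto
    have "{a, u} \<in> edges G" "{u, b} \<in> edges G" "{a, v} \<in> edges G" "{v, b} \<in> edges G"
      using that E by auto
    moreover have "{a, u} \<inter> {a, v} = {a}" "{u, b} \<inter> {v, b} = {b}" "{a, u} \<inter> {v, b} = {}" "{u, b} \<inter> {a, v} = {}"
      "{a, u} \<noteq> {a, v}" "{u, b} \<noteq> {v, b}"
      using ne that(3) by (auto simp: doubleton_eq_iff)
    ultimately show ?thesis
      using meet1[of "{a, u}" "{a, v}" a] meet1[of "{u, b}" "{v, b}" b]
        meet0[of "{a, u}" "{v, b}"] meet0[of "{u, b}" "{a, v}"]
      by (simp add: Int_Un_distrib Int_Un_distrib2 insert_commute)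
  qed
  have d': "distinct [y, x, k, n, m, b, a]"
    using d by auto
  show False
  proof (rule theta_curve_no_tripod[OF \<alpha>(1) \<beta>(1) \<delta>(1) \<alpha>(2,3) \<beta>(2,3) \<delta>(2,3)])
    show "path_image \<alpha> \<inter> path_image \<beta> = {p a, p b}" "path_image \<alpha> \<inter> path_image \<delta> = {p a, p b}"
      "path_image \<beta> \<inter> path_image \<delta> = {p a, p b}"
      unfolding \<alpha>(4) \<beta>(4) \<delta>(4) by (rule two; use d in simp)+
    show "connected (path_image (\<gamma> {x, m}))" "connected (path_image (\<gamma> {x, n}))"
      using conn E by auto
    show "connected (path_image (\<gamma> {x, y}) \<union> path_image (\<gamma> {y, k}))"
      using conn E ends[of "{x, y}" y] ends[of "{y, k}" y] by (intro connected_Un) auto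
    show "p x \<in> path_image (\<gamma> {x, m})" "p x \<in> path_image (\<gamma> {x, n})"
      "p x \<in> path_image (\<gamma> {x, y}) \<union> path_image (\<gamma> {y, k})"
      using E ends by auto
    show "p m \<in> path_image (\<gamma> {x, m})" "p m \<in> path_image \<alpha>"
      "p n \<in> path_image (\<gamma> {x, n})" "p n \<in> path_image \<beta>"
      "p k \<in> path_image (\<gamma> {x, y}) \<union> path_image (\<gamma> {y, k})" "p k \<in> path_image \<delta>"
      unfolding \<alpha>(4) \<beta>(4) \<delta>(4) using E ends by auto
    show "path_image (\<gamma> {x, m}) \<inter> (path_image \<beta> \<union> path_image \<delta>) = {}"
      unfolding \<alpha>(4) \<beta>(4) \<delta>(4) Int_Un_distrib Int_Un_distrib2
      using d d' E meet0[of "{x, m}"] by simp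
    show "path_image (\<gamma> {x, n}) \<inter> (path_image \<alpha> \<union> path_image \<delta>) = {}"
      unfolding \<alpha>(4) \<beta>(4) \<delta>(4) Int_Un_distrib Int_Un_distrib2
      using d d' E meet0[of "{x, n}"] by simp
    show "(path_image (\<gamma> {x, y}) \<union> path_image (\<gamma> {y, k})) \<inter> (path_image \<alpha> \<union> path_image \<beta>) = {}"
      unfolding \<alpha>(4) \<beta>(4) \<delta>(4) Int_Un_distrib Int_Un_distrib2
      using d d' E meet0[of "{x, y}"] meet0[of "{y, k}"] by simp
  qed
qed

definition complete_graph :: "'a set \<Rightarrow> 'a ugraph" where
  "complete_graph V = \<lparr>verts = V, edges = {{u, v} | u v. u \<in> V \<and> v \<in> V \<and> u \<noteq> v}\<rparr>"

text \<open>
  In the line graph of the complete graph on \<open>a, \<dots>, e\<close>, the vertices \<open>ab\<close> and \<open>ac\<close> have the common neighbours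
  \<open>ad\<close>, \<open>ae\<close> and \<open>bc\<close>. The vertex \<open>de\<close> is adjacent to \<open>ad\<close> and \<open>ae\<close>, and it reaches \<open>bc\<close> through \<open>bd\<close>.
\<close>

lemma nonplanar_line_graph_complete:
  assumes "finite V" "card V \<ge> 5"
  shows "\<not> planar (line_graph (complete_graph V))"
proof
  assume pl: "planar (line_graph (complete_graph V))"
  obtain S where "S \<subseteq> V" "card S = 5" "finite S"
    using obtain_subset_with_card_n[OF assms(2)] assms(1) by (metis finite_subset)
  then obtain xs where "distinct xs" "length xs = 5" "set xs \<subseteq> V"
    by (metis finite_distinct_list distinct_card)
  then obtain a b c d e where v: "distinct [a, b, c, d, e]" "{a, b, c, d, e} \<subseteq> V"
    by (auto simp: numeral_eq_Suc length_Suc_conv)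
  define E where "E = edges (complete_graph V)"
  have E: "{u, w} \<in> E" if "u \<in> {a, b, c, d, e}" "w \<in> {a, b, c, d, e}" "u \<noteq> w" for u w
    using that v unfolding E_def complete_graph_def by auto
  have L: "{{u, w}, {u', w'}} \<in> edges (line_graph (complete_graph V))"
    if "{u, w} \<in> E" "{u', w'} \<in> E" "{u, w} \<noteq> {u', w'}" "{u, w} \<inter> {u', w'} \<noteq> {}" for u w u' w'
    using that unfolding line_graph_def E_def by auto
  show False
  proof (rule planar_no_subdivided_K33[OF pl, of "{a, b}" "{a, c}" "{a, d}" "{a, e}" "{b, c}" "{d, e}" "{b, d}"])
    show "{{a, b}, {a, c}, {a, d}, {a, e}, {b, c}, {d, e}, {b, d}} \<subseteq> verts (line_graph (complete_graph V))"
      using E v(1) by (simp add: line_graph_def flip: E_def)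
    show "distinct [{a, b}, {a, c}, {a, d}, {a, e}, {b, c}, {d, e}, {b, d}]"
      using v(1) by (auto simp: doubleton_eq_iff)
  qed (rule L; (rule E)?; use v(1) in \<open>auto simp: doubleton_eq_iff\<close>)+
qed

section \<open>A straight line drawing of the octahedron\<close>

lemma planar_pullback:
  assumes "planar H" and inj: "inj_on f (verts G)" and V: "f ` verts G \<subseteq> verts H"
    and E: "\<And>e. e \<in> edges G \<Longrightarrow> e \<subseteq> verts G \<and> f ` e \<in> edges H"
  shows "planar G"
proof -
  obtain p \<gamma> where dr: "plane_drawing H p \<gamma>"
    using assms(1) unfolding planar_def by auto
  note D = dr[unfolded plane_drawing_def]
  note p = D[THEN conjunct1]
    and edge = D[THEN conjunct2, THEN conjunct1, rule_format]
    and meet = D[THEN conjunct2, THEN conjunct2, rule_format]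
  have pf: "inj_on (p \<circ> f) (verts G)"
    using comp_inj_on[OF inj inj_on_subset[OF p V]] .
  have "plane_drawing G (p \<circ> f) (\<lambda>e. \<gamma> (f ` e))"
    unfolding plane_drawing_def image_comp[symmetric]
  proof (intro conjI ballI impI)
    fix e assume e: "e \<in> edges G"
    note fe = edge[of "f ` e"]
    show "arc (\<gamma> (f ` e))" "{pathstart (\<gamma> (f ` e)), pathfinish (\<gamma> (f ` e))} = p ` f ` e"
      using fe E[OF e] by simp_all
    have "path_image (\<gamma> (f ` e)) \<inter> p ` verts H = p ` f ` e"
      using fe E[OF e] by simp
    moreover have "p ` f ` e \<subseteq> p ` f ` verts G" "p ` f ` verts G \<subseteq> p ` verts H"
      using E[OF e] V by (simp_all add: image_mono)
    moreover have "D \<inter> B = C" if "D \<inter> A = C" "C \<subseteq> B" "B \<subseteq> A" for A B C D :: "complex set"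
      using that by blast
    ultimately show "path_image (\<gamma> (f ` e)) \<inter> p ` f ` verts G = p ` f ` e"
      by metis
    fix d assume d: "d \<in> edges G" "e \<noteq> d"
    have "f ` e \<noteq> f ` d" "f ` (e \<inter> d) = f ` e \<inter> f ` d"
      using d E[OF e] E[OF d(1)] inj_on_image_eq_iff[OF inj, of e d] inj_on_image_Int[OF inj, of e d]
      by simp_all
    then show "path_image (\<gamma> (f ` e)) \<inter> path_image (\<gamma> (f ` d)) = p ` f ` (e \<inter> d)"
      using meet[of "f ` e" "f ` d"] E[OF e] E[OF d(1)] by simp
  qed (rule pf)
  then show ?thesis
    unfolding planar_def by (intro exI)
qed

text \<open>
  Twice the signed area of the triangle \<open>u v z\<close>: its sign tells on which side of the line \<open>u v\<close> the point \<open>z\<close> lies.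
\<close>

definition orient :: "complex \<Rightarrow> complex \<Rightarrow> complex \<Rightarrow> real" where
  "orient u v z = (Re v - Re u) * (Im z - Im u) - (Im v - Im u) * (Re z - Re u)"

lemma orient_linepath:
  "orient u v ((1 - t) *\<^sub>R w + t *\<^sub>R z) = (1 - t) * orient u v w + t * orient u v z"
  unfolding orient_def by (simp add: algebra_simps)

lemma orient_segment_zero:
  "z \<in> closed_segment u v \<Longrightarrow> orient u v z = 0"
  unfolding closed_segment_def by (auto simp: orient_linepath) (simp_all add: orient_def)

lemma segment_disjoint:
  assumes "orient u v w * orient u v z > 0"
  shows "closed_segment u v \<inter> closed_segment w z = {}"
proof -
  have False if y: "y \<in> closed_segment u v" "y \<in> closed_segment w z" for y
  proof -
    obtain t where t: "0 \<le> t" "t \<le> 1" "y = (1 - t) *\<^sub>R w + t *\<^sub>R z"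
      using y(2) unfolding closed_segment_def by auto
    have "(1 - t) * orient u v w + t * orient u v z = 0"
      using orient_segment_zero[OF y(1)] unfolding t(3) orient_linepath .
    moreover consider "orient u v w > 0" "orient u v z > 0" | "orient u v w < 0" "orient u v z < 0"
      using assms by (auto simp: zero_less_mult_iff)
    ultimately show False
      using t convex_bound_lt[of "orient u v w" 0 "orient u v z" "1 - t" t]
        convex_bound_lt[of "- orient u v w" 0 "- orient u v z" "1 - t" t]
      by cases auto
  qed
  then show ?thesis by auto
qed

lemma segment_meet_at_end:
  assumes "orient u v z \<noteq> 0"
  shows "closed_segment u v \<inter> closed_segment u z = {u}"
proof -
  have "y = u" if y: "y \<in> closed_segment u v" "y \<in> closed_segment u z" for y
  proof -
    obtain t where t: "0 \<le> t" "t \<le> 1" "y = (1 - t) *\<^sub>R u + t *\<^sub>R z"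
      using y(2) unfolding closed_segment_def by auto
    have "(1 - t) * orient u v u + t * orient u v z = 0"
      using orient_segment_zero[OF y(1)] unfolding t(3) orient_linepath .
    then have "t = 0"
      using assms by (auto simp: orient_def)
    then show ?thesis using t by simp
  qed
  then show ?thesis by auto
qed

text \<open>
  Two disjoint segments in general position always satisfy one of the two sign conditions: if the two
  lines through the segments each meet the other segment, then the segments cross. Planarity of a straight line
  drawing is thereby reduced to finitely many sign computations.
\<close>

lemma planar_straight_line:
  assumes inj: "inj_on p (verts G)"
    and E: "\<And>e. e \<in> edges G \<Longrightarrow> \<exists>u v. e = {u, v} \<and> u \<in> verts G \<and> v \<in> verts G \<and> u \<noteq> v"
    and gen: "\<And>u v w. u \<in> verts G \<Longrightarrow> v \<in> verts G \<Longrightarrow> w \<in> verts G \<Longrightarrow> distinct [u, v, w] \<Longrightarrow>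
      orient (p u) (p v) (p w) \<noteq> 0"
    and sep: "\<And>u v w z. {u, v} \<in> edges G \<Longrightarrow> {w, z} \<in> edges G \<Longrightarrow> distinct [u, v, w, z] \<Longrightarrow>
      orient (p u) (p v) (p w) * orient (p u) (p v) (p z) > 0 \<or>
      orient (p w) (p z) (p u) * orient (p w) (p z) (p v) > 0"
  shows "planar G"
proof -
  obtain s t where st: "\<And>e. e \<in> edges G \<Longrightarrow> e = {s e, t e} \<and> s e \<in> verts G \<and> t e \<in> verts G \<and> s e \<noteq> t e"
    using E by metis
  define \<gamma> where "\<gamma> e = linepath (p (s e)) (p (t e))" for e
  have \<gamma>: thesis
    if "e \<in> edges G"
      "\<And>u v. e = {u, v} \<Longrightarrow> u \<in> verts G \<Longrightarrow> v \<in> verts G \<Longrightarrow> u \<noteq> v \<Longrightarrow> \<gamma> e = linepath (p u) (p v) \<Longrightarrow> thesis"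
    for e thesis
    using st[OF that(1)] by (intro that(2)[of "s e" "t e"]) (simp_all add: \<gamma>_def)
  have "plane_drawing G p \<gamma>"
    unfolding plane_drawing_def
  proof (intro conjI ballI impI)
    fix e assume eE: "e \<in> edges G"
    obtain u v where e: "e = {u, v}" "u \<in> verts G" "v \<in> verts G" "u \<noteq> v" "\<gamma> e = linepath (p u) (p v)"
      by (rule \<gamma>[OF eE])
    have "p u \<noteq> p v"
      using e inj by (auto simp: inj_on_def)
    then show "arc (\<gamma> e)"
      using e by auto
    show "{pathstart (\<gamma> e), pathfinish (\<gamma> e)} = p ` e"
      using e by auto
    have "p w \<notin> closed_segment (p u) (p v)" if "w \<in> verts G" "w \<noteq> u" "w \<noteq> v" for w
      using orient_segment_zero[of "p w" "p u" "p v"] gen[of u v w] e that by auto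
    then show "path_image (\<gamma> e) \<inter> p ` verts G = p ` e"
      using e by auto
    fix d assume d: "d \<in> edges G" "e \<noteq> d"
    obtain w z where d': "d = {w, z}" "w \<in> verts G" "z \<in> verts G" "w \<noteq> z" "\<gamma> d = linepath (p w) (p z)"
      by (rule \<gamma>[OF d(1)])
    have share: "closed_segment (p a) (p b) \<inter> closed_segment (p a) (p c) = {p a}"
      if "a \<in> verts G" "b \<in> verts G" "c \<in> verts G" "distinct [a, b, c]" for a b c
      using segment_meet_at_end gen[OF that] by blast
    show "path_image (\<gamma> e) \<inter> path_image (\<gamma> d) = p ` (e \<inter> d)"
    proof (cases "e \<inter> d = {}")
      case True
      then have "closed_segment (p u) (p v) \<inter> closed_segment (p w) (p z) = {}"
        using sep[of u v w z] eE d(1) e(1,4) d'(1,4)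
          segment_disjoint[of "p u" "p v" "p w" "p z"] segment_disjoint[of "p w" "p z" "p u" "p v"]
        by auto
      with True e d' show ?thesis by simp
    next
      case False
      then obtain a b c where abc: "{u, v} = {a, b}" "{w, z} = {a, c}" "distinct [a, b, c]"
        using e d d' by auto
      have seg: "closed_segment (p u) (p v) = closed_segment (p a) (p b)"
        "closed_segment (p w) (p z) = closed_segment (p a) (p c)"
        using abc by (auto simp: doubleton_eq_iff closed_segment_commute)
      have "e \<inter> d = {a}" "a \<in> verts G" "b \<in> verts G" "c \<in> verts G"
        using abc e d' by (auto simp: doubleton_eq_iff)
      then show ?thesis
        using share[of a b c] abc(3) unfolding e(5) d'(5) by (simp add: seg)
    qed
  qed (rule inj)
  then show ?thesis
    unfolding planar_def by blast
qed

text \<open>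
  Antipodal vertices are \<open>i\<close> and \<open>7 - i\<close>.
\<close>

definition octahedron :: "nat ugraph" where
  "octahedron = \<lparr>verts = {1..6}, edges = {{i, j} | i j. i \<in> {1..6} \<and> j \<in> {1..6} \<and> i \<noteq> j \<and> i + j \<noteq> 7}\<rparr>"

text \<open>
  The vertices 1, 2, 3 form an outer triangle, and the antipode of each lies inside it, near the opposite side.
\<close>

definition octahedron_x :: "nat \<Rightarrow> int" where
  "octahedron_x i = [0, -6, 6, -2, 2, 0] ! (i - 1)"

definition octahedron_y :: "nat \<Rightarrow> int" where
  "octahedron_y i = [6, -4, -4, 1, 1, -2] ! (i - 1)"

definition octahedron_orient :: "nat \<Rightarrow> nat \<Rightarrow> nat \<Rightarrow> int" where
  "octahedron_orient i j k =
    (octahedron_x j - octahedron_x i) * (octahedron_y k - octahedron_y i) -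
    (octahedron_y j - octahedron_y i) * (octahedron_x k - octahedron_x i)"

lemma octahedron_coordinates:
  "octahedron_x 1 = 0" "octahedron_x 2 = -6" "octahedron_x 3 = 6"
  "octahedron_x 4 = -2" "octahedron_x 5 = 2" "octahedron_x 6 = 0"
  "octahedron_y 1 = 6" "octahedron_y 2 = -4" "octahedron_y 3 = -4"
  "octahedron_y 4 = 1" "octahedron_y 5 = 1" "octahedron_y 6 = -2"
  by (simp_all add: octahedron_x_def octahedron_y_def)

lemma octahedron_verts: "{1..6::nat} = {1, 2, 3, 4, 5, 6}"
  by auto

lemma octahedron_general_position:
  "\<forall>i \<in> {1..6}. \<forall>j \<in> {1..6} - {i}. \<forall>k \<in> {1..6} - {i, j}. octahedron_orient i j k \<noteq> 0"
  unfolding octahedron_verts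
  by (simp add: octahedron_orient_def octahedron_coordinates insert_Diff_if del: One_nat_def)

lemma octahedron_edges_separated:
  "\<forall>i \<in> {1..6}. \<forall>j \<in> {1..6} - {i, 7 - i}. \<forall>k \<in> {1..6} - {i, j}. \<forall>l \<in> {1..6} - {i, j, k, 7 - k}.
      0 < octahedron_orient i j k * octahedron_orient i j l \<or>
      0 < octahedron_orient k l i * octahedron_orient k l j"
  unfolding octahedron_verts
  by (simp add: octahedron_orient_def octahedron_coordinates insert_Diff_if del: One_nat_def)

lemma planar_octahedron: "planar octahedron"
proof -
  define p where "p i = Complex (of_int (octahedron_x i)) (of_int (octahedron_y i))" for i
  have orient: "orient (p i) (p j) (p k) = of_int (octahedron_orient i j k)" for i j k
    by (simp add: orient_def octahedron_orient_def p_def)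
  have gen: "orient (p i) (p j) (p k) \<noteq> 0"
    if "i \<in> {1..6}" "j \<in> {1..6}" "k \<in> {1..6}" "distinct [i, j, k]" for i j k
    using octahedron_general_position[rule_format, of i j k] that unfolding orient by simp
  show ?thesis
  proof (rule planar_straight_line)
    show "inj_on p (verts octahedron)"
    proof (rule inj_onI)
      fix i j assume ij: "i \<in> verts octahedron" "j \<in> verts octahedron" "p i = p j"
      have "\<exists>k::nat. 1 \<le> k \<and> k \<le> 6 \<and> k \<noteq> i \<and> k \<noteq> j"
        by presburger
      then obtain k where k: "k \<in> {1..6}" "k \<noteq> i" "k \<noteq> j"
        by auto
      show "i = j"
        using gen[of i k j] k ij by (auto simp: octahedron_def orient_def)
    qed
    fix i j k l
    assume ij: "{i, j} \<in> edges octahedron" and kl: "{k, l} \<in> edges octahedron" and d: "distinct [i, j, k, l]"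
    have V: "i \<in> {1..6}" "j \<in> {1..6}" "k \<in> {1..6}" "l \<in> {1..6}" and ne: "i + j \<noteq> 7" "k + l \<noteq> 7"
      using ij kl unfolding octahedron_def by (auto simp: doubleton_eq_iff)
    have "j \<noteq> 7 - i" "l \<noteq> 7 - k" "j \<noteq> i" "k \<noteq> i" "k \<noteq> j" "l \<noteq> i" "l \<noteq> j" "l \<noteq> k"
      using V ne d by auto
    with V have "i \<in> {1..6}" "j \<in> {1..6} - {i, 7 - i}" "k \<in> {1..6} - {i, j}" "l \<in> {1..6} - {i, j, k, 7 - k}"
      by blast+
    then have "0 < octahedron_orient i j k * octahedron_orient i j l \<or>
        0 < octahedron_orient k l i * octahedron_orient k l j"
      by (rule octahedron_edges_separated[rule_format])
    then show "orient (p i) (p j) (p k) * orient (p i) (p j) (p l) > 0 \<or>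
        orient (p k) (p l) (p i) * orient (p k) (p l) (p j) > 0"
      unfolding orient of_int_mult[symmetric] of_int_0_less_iff .
  qed (use gen in \<open>auto simp: octahedron_def\<close>)
qed

lemma line_graph_verts [simp]: "verts (line_graph G) = edges G"
  by (simp add: line_graph_def)

lemma line_graph_edge_iff:
  "{e, f} \<in> edges (line_graph G) \<longleftrightarrow> e \<in> edges G \<and> f \<in> edges G \<and> e \<noteq> f \<and> e \<inter> f \<noteq> {}"
  by (auto simp: line_graph_def doubleton_eq_iff)

lemma line_graph_edgeE:
  assumes "d \<in> edges (line_graph G)"
  obtains e f where "d = {e, f}" "e \<in> edges G" "f \<in> edges G" "e \<noteq> f" "e \<inter> f \<noteq> {}"
  using assms by (auto simp: line_graph_def)

lemma complete_graph_edge_iff: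
  "{u, v} \<in> edges (complete_graph V) \<longleftrightarrow> u \<in> V \<and> v \<in> V \<and> u \<noteq> v"
  by (auto simp: complete_graph_def doubleton_eq_iff)

lemma complete_graph_edgeE:
  assumes "e \<in> edges (complete_graph V)"
  obtains u v where "e = {u, v}" "u \<in> V" "v \<in> V" "u \<noteq> v"
  using assms by (auto simp: complete_graph_def)

text \<open>
  With the weights 0, 1, 2, 4 for the four vertices, the six edges have the weights 1 to 6, and two edges
  are disjoint iff their weights sum to 7. So the weight is an isomorphism from the line graph to the octahedron.
\<close>

lemma planar_line_graph_K4: "planar (line_graph (complete_graph {..<4::nat}))"
proof (rule planar_pullback[OF planar_octahedron])
  let ?G = "line_graph (complete_graph {..<4::nat})"
  let ?S = "{{0, 1}, {0, 2}, {1, 2}, {0, 3}, {1, 3}, {2, 3}} :: nat set set"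
  define f :: "nat set \<Rightarrow> nat" where "f e = (\<Sum>i\<in>e. if i = 3 then 4 else i)" for e
  have f: "f {0, 1} = 1" "f {0, 2} = 2" "f {1, 2} = 3" "f {0, 3} = 4" "f {1, 3} = 5" "f {2, 3} = 6"
    by (simp_all add: f_def)
  have V: "e \<in> ?S" if e: "e \<in> edges (complete_graph {..<4::nat})" for e
  proof -
    obtain u v where uv: "e = {u, v}" "u \<in> {..<4}" "v \<in> {..<4}" "u \<noteq> v"
      using e by (rule complete_graph_edgeE)
    have four: "{..<4} = {0, 1, 2, 3::nat}"
      by auto
    show ?thesis
      using uv(2-) unfolding four uv(1) by (elim insertE emptyE) (simp_all add: insert_commute)
  qed
  have pairs: "f u \<in> {1..6} \<and> (u \<noteq> v \<longrightarrow> f u \<noteq> f v) \<and> (u \<inter> v \<noteq> {} \<longrightarrow> f u + f v \<noteq> 7)"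
    if "u \<in> ?S" "v \<in> ?S" for u v
    using that by (elim insertE emptyE) (simp_all add: f del: One_nat_def)
  show "inj_on f (verts ?G)"
    using pairs[OF V V] unfolding inj_on_def line_graph_verts by blast
  show "f ` verts ?G \<subseteq> verts octahedron"
    using pairs[OF V V] by (intro image_subsetI) (simp add: octahedron_def)
  fix d assume "d \<in> edges ?G"
  then obtain u v where uv: "d = {u, v}" "u \<in> edges (complete_graph {..<4})"
      "v \<in> edges (complete_graph {..<4})" "u \<noteq> v" "u \<inter> v \<noteq> {}"
    by (rule line_graph_edgeE)
  have "{f u, f v} \<in> edges octahedron"
    using pairs[OF V V, OF uv(2,3)] pairs[OF V V, OF uv(3,2)] uv(4,5)
    unfolding octahedron_def by auto
  then show "d \<subseteq> verts ?G \<and> f ` d \<in> edges octahedron"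
    using uv(1-3) by simp
qed

lemma planar_line_graph_complete:
  assumes "finite V" "card V \<le> 4"
  shows "planar (line_graph (complete_graph V))"
proof -
  obtain f where f: "inj_on f V" "f ` V \<subseteq> {..<4::nat}"
    using assms inj_on_iff_card_le[of V "{..<4::nat}"] by auto
  have sub: "e \<subseteq> V" if "e \<in> edges (complete_graph V)" for e
    using that by (rule complete_graph_edgeE) simp
  have edge: "f ` e \<in> edges (complete_graph {..<4})" if e: "e \<in> edges (complete_graph V)" for e
  proof -
    obtain u v where "e = {u, v}" "u \<in> V" "v \<in> V" "u \<noteq> v"
      using e by (rule complete_graph_edgeE)
    then show ?thesis
      using f by (auto simp: complete_graph_edge_iff inj_on_eq_iff)
  qed
  show ?thesis
  proof (rule planar_pullback[OF planar_line_graph_K4, where f = "\<lambda>e. f ` e"])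
    show "inj_on ((`) f) (verts (line_graph (complete_graph V)))"
      using sub by (auto intro!: inj_onI simp: inj_on_image_eq_iff[OF f(1)])
    show "(`) f ` verts (line_graph (complete_graph V)) \<subseteq> verts (line_graph (complete_graph {..<4}))"
      using edge by auto
    fix d assume "d \<in> edges (line_graph (complete_graph V))"
    then obtain e e' where d: "d = {e, e'}" "e \<in> edges (complete_graph V)" "e' \<in> edges (complete_graph V)"
        "e \<noteq> e'" "e \<inter> e' \<noteq> {}"
      by (rule line_graph_edgeE)
    have "f ` e \<noteq> f ` e'"
      using inj_on_image_eq_iff[OF f(1) sub sub, OF d(2,3)] d(4) by simp
    moreover have "f ` e \<inter> f ` e' \<noteq> {}"
      using d(5) by blast
    ultimately show "d \<subseteq> verts (line_graph (complete_graph V)) \<and>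
        (`) f ` d \<in> edges (line_graph (complete_graph {..<4}))"
      using d(1-3) edge by (simp add: line_graph_edge_iff)
  qed
qed

section \<open>Finite local rings\<close>

text \<open>
  The ideal \<open>M\<close> is the unique maximal ideal, given here as an ideal that contains all non-units. That it is
  non-zero excludes fields.
\<close>

locale finite_local_ring = cring R + ideal M R for R (structure) and M +
  assumes finite_carrier: "finite (carrier R)"
    and one_notin_M: "\<one> \<notin> M"
    and unit_or_M: "x \<in> carrier R \<Longrightarrow> x \<in> M \<or> x \<in> Units R"
    and M_nontrivial: "M \<noteq> {\<zero>}"
begin

lemma M_subset: "M \<subseteq> carrier R"
  by (rule a_subset)

lemma M_closed [simp]: "x \<in> M \<Longrightarrow> x \<in> carrier R"
  using M_subset by auto

lemma M_add: "x \<in> M \<Longrightarrow> y \<in> M \<Longrightarrow> x \<oplus> y \<in> M"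
  and M_uminus: "x \<in> M \<Longrightarrow> \<ominus> x \<in> M"
  and M_zero: "\<zero> \<in> M"
  by (auto intro: additive_subgroup.a_closed[OF is_additive_subgroup] a_inv_closed simp: additive_subgroup.zero_closed[OF is_additive_subgroup])

lemma M_minus: "x \<in> M \<Longrightarrow> y \<in> M \<Longrightarrow> x \<ominus> y \<in> M"
  by (simp add: a_minus_def M_add M_uminus)

lemma finite_M: "finite M"
  using finite_carrier M_subset by (rule finite_subset[rotated])

lemma unit_notin_M:
  assumes "x \<in> Units R" shows "x \<notin> M"
proof
  assume "x \<in> M"
  then have "inv x \<otimes> x \<in> M"
    using assms by (intro I_l_closed) auto
  then show False
    using assms one_notin_M by simp
qed

lemma unit_iff: "x \<in> carrier R \<Longrightarrow> x \<in> Units R \<longleftrightarrow> x \<notin> M"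
  using unit_or_M unit_notin_M by blast

lemma unit_cancel_zero:
  assumes "x \<in> carrier R" "x \<notin> M" "y \<in> carrier R" "x \<otimes> y = \<zero>"
  shows "y = \<zero>"
proof -
  have x: "x \<in> Units R"
    using assms unit_iff by simp
  then have "y = inv x \<otimes> (x \<otimes> y)"
    using assms(3) by (simp add: m_assoc[symmetric] Units_closed)
  also have "\<dots> = \<zero>"
    using x by (simp add: assms(4))
  finally show ?thesis .
qed

lemma M_prime:
  assumes "x \<in> carrier R" "y \<in> carrier R" "x \<otimes> y \<in> M"
  shows "x \<in> M \<or> y \<in> M"
  using assms unit_iff[of x] unit_iff[of y] unit_notin_M Units_m_closed by blast

text \<open>
  This is Nakayama's lemma for a principal ideal: \<open>1 - m\<close> is a unit.
\<close>

lemma M_fixes_only_zero: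
  assumes "m \<in> M" "x \<in> carrier R" "m \<otimes> x = x"
  shows "x = \<zero>"
proof (rule unit_cancel_zero)
  show "\<one> \<ominus> m \<notin> M"
  proof
    assume "\<one> \<ominus> m \<in> M"
    then have "(\<one> \<ominus> m) \<oplus> m \<in> M"
      using assms by (intro M_add)
    moreover have "(\<one> \<ominus> m) \<oplus> m = \<one>"
      using assms M_closed[OF assms(1)] by algebra
    ultimately show False using one_notin_M by simp
  qed
  show "(\<one> \<ominus> m) \<otimes> x = \<zero>"
    using assms(2,3) M_closed[OF assms(1)] by algebra
qed (use assms in auto)

text \<open>
  Choose \<open>s \<noteq> 0\<close> in \<open>J\<close> such that the principal ideal \<open>R s\<close> is as small as possible. If \<open>m s \<noteq> 0\<close> for some
  \<open>m\<close> in \<open>M\<close>, then \<open>R m s = R s\<close> by minimality, so \<open>s = a m s\<close> for some \<open>a\<close>, which forces \<open>s = 0\<close>.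
\<close>

lemma ideal_meets_socle:
  assumes "ideal J R" "J \<noteq> {\<zero>}"
  obtains s where "s \<in> J" "s \<noteq> \<zero>" "\<And>m. m \<in> M \<Longrightarrow> m \<otimes> s = \<zero>"
proof -
  interpret J: ideal J R by fact
  define W where "W j = (\<lambda>a. a \<otimes> j) ` carrier R" for j
  have "J - {\<zero>} \<noteq> {}"
    using assms(2) additive_subgroup.zero_closed[OF J.is_additive_subgroup] by auto
  moreover have "finite (J - {\<zero>})"
    using finite_subset[OF J.a_subset finite_carrier] by simp
  ultimately obtain s where "s \<in> J - {\<zero>}" and min: "\<And>j. j \<in> J - {\<zero>} \<Longrightarrow> card (W s) \<le> card (W j)"
    using arg_min_if_finite(1)[of "J - {\<zero>}" "\<lambda>j. card (W j)"]
      arg_min_least[of "J - {\<zero>}" _ "\<lambda>j. card (W j)"] by blast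
  then have s: "s \<in> J" "s \<noteq> \<zero>"
    by auto
  have sc: "s \<in> carrier R"
    using s J.a_subset by auto
  have "m \<otimes> s = \<zero>" if m: "m \<in> M" for m
  proof (rule ccontr)
    assume ne: "m \<otimes> s \<noteq> \<zero>"
    have mc: "m \<in> carrier R" using m by simp
    have "W (m \<otimes> s) \<subseteq> W s"
    proof
      fix z assume "z \<in> W (m \<otimes> s)"
      then obtain a where "a \<in> carrier R" "z = (a \<otimes> m) \<otimes> s"
        using mc sc by (auto simp: W_def m_assoc)
      then show "z \<in> W s"
        using mc by (auto simp: W_def)
    qed
    moreover have "card (W s) \<le> card (W (m \<otimes> s))"
      using ne s mc by (intro min) (auto intro: J.I_l_closed)
    ultimately have "W (m \<otimes> s) = W s"
      using finite_carrier by (intro card_seteq) (auto simp: W_def)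
    moreover have "s \<in> W s"
      using sc unfolding W_def by (intro image_eqI[of _ _ \<one>]) auto
    ultimately obtain a where a: "a \<in> carrier R" "s = a \<otimes> (m \<otimes> s)"
      by (auto simp: W_def)
    then have "(a \<otimes> m) \<otimes> s = s"
      using mc sc by (simp add: m_assoc)
    then show False
      using M_fixes_only_zero[of "a \<otimes> m" s] a m sc s I_l_closed by auto
  qed
  with s show thesis by (rule that)
qed

lemma nonzero_zero_divisors_eq: "nonzero_zero_divisors R = M - {\<zero>}"
proof -
  obtain s where s: "s \<in> M" "s \<noteq> \<zero>" "\<And>m. m \<in> M \<Longrightarrow> m \<otimes> s = \<zero>"
    using ideal_meets_socle[OF is_ideal M_nontrivial] by blast
  show ?thesis
    unfolding nonzero_zero_divisors_def using s unit_cancel_zero by auto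
qed

lemma essential_ann:
  assumes "x \<in> M" shows "essential_ideal (ann R x) R"
proof -
  have xc: "x \<in> carrier R" using assms by simp
  have "ideal (ann R x) R"
  proof (rule idealI)
    show "subgroup (ann R x) (add_monoid R)"
      by (rule add.subgroupI) (use xc in \<open>auto simp: ann_def r_distr r_minus intro: exI[of _ \<zero>]\<close>)
    fix a y assume "a \<in> ann R x" "y \<in> carrier R"
    then have a: "a \<in> carrier R" "x \<otimes> a = \<zero>" and y: "y \<in> carrier R"
      by (auto simp: ann_def)
    have "x \<otimes> (y \<otimes> a) = y \<otimes> (x \<otimes> a)"
      using a(1) y xc by (simp add: m_lcomm)
    with a y show "y \<otimes> a \<in> ann R x" "a \<otimes> y \<in> ann R x"
      by (auto simp: ann_def m_comm)
  qed (rule ring_axioms)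
  moreover have "ann R x \<inter> J \<noteq> {\<zero>}" if J: "ideal J R" "J \<noteq> {\<zero>}" for J
  proof -
    obtain s where s: "s \<in> J" "s \<noteq> \<zero>" "\<And>m. m \<in> M \<Longrightarrow> m \<otimes> s = \<zero>"
      using ideal_meets_socle[OF J] by blast
    then have "s \<in> ann R x \<inter> J"
      using assms ideal.Icarr[OF J(1)] by (auto simp: ann_def)
    with s show ?thesis by auto
  qed
  ultimately show ?thesis
    unfolding essential_ideal_def by blast
qed

text \<open>
  Elements of \<open>C\<close> represent distinct residue classes modulo \<open>M\<close>, so addition is injective on \<open>C \<times> M\<close>. If the
  cardinalities permit, it is bijective, and \<open>C\<close> represents every residue class.
\<close>

lemma transversal_card_le:
  assumes "C \<subseteq> carrier R" "\<And>c d. c \<in> C \<Longrightarrow> d \<in> C \<Longrightarrow> c \<ominus> d \<in> M \<Longrightarrow> c = d"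
  shows "card C * card M \<le> card (carrier R)"
    and "card (carrier R) \<le> card C * card M \<Longrightarrow> a \<in> carrier R \<Longrightarrow> \<exists>c\<in>C. \<exists>m\<in>M. a = c \<oplus> m"
proof -
  let ?f = "\<lambda>(c, m). c \<oplus> m"
  have "c = c' \<and> m = m'" if "c \<in> C" "c' \<in> C" and m: "m \<in> M" "m' \<in> M" and eq: "c \<oplus> m = c' \<oplus> m'" for c m c' m'
  proof -
    have cc: "c \<in> carrier R" "c' \<in> carrier R" "m \<in> carrier R" "m' \<in> carrier R"
      using that assms(1) by auto
    have "c \<ominus> c' = (c \<oplus> m) \<ominus> (c' \<oplus> m)"
      using cc by algebra
    also have "\<dots> = m' \<ominus> m"
      unfolding eq using cc by algebra
    finally have "c = c'"
      using that assms(2) M_minus by auto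
    then show ?thesis
      using eq cc by simp
  qed
  then have inj: "inj_on ?f (C \<times> M)"
    by (auto simp: inj_on_def)
  have sub: "?f ` (C \<times> M) \<subseteq> carrier R"
    using assms(1) by auto
  show "card C * card M \<le> card (carrier R)"
    using card_inj_on_le[OF inj sub finite_carrier] by (simp add: card_cartesian_product)
  assume "card (carrier R) \<le> card C * card M"
  then have "?f ` (C \<times> M) = carrier R"
    using sub finite_carrier card_image[OF inj] by (intro card_seteq) (auto simp: card_cartesian_product)
  then show "\<exists>c\<in>C. \<exists>m\<in>M. a = c \<oplus> m" if "a \<in> carrier R"
    using that by fastforce
qed

end

text \<open>
  A non-unit generates a proper ideal, and a proper ideal of largest cardinality above it is maximal.
\<close>

lemma finite_local_ringI:
  fixes A :: "('a, 'm) ring_scheme"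
  assumes "cring A" "\<one>\<^bsub>A\<^esub> \<noteq> \<zero>\<^bsub>A\<^esub>" "finite (carrier A)" "local_ring A" "\<not> field A"
  obtains M where "finite_local_ring A M"
proof -
  interpret cring A by fact
  obtain M where M: "maximalideal M A" and unique: "\<And>N. maximalideal N A \<Longrightarrow> N = M"
    using assms(4) unfolding local_ring_def by auto
  interpret M: maximalideal M A by fact
  have "x \<in> M" if x: "x \<in> carrier A" "x \<notin> Units A" for x
  proof -
    define \<I> where "\<I> = {I. ideal I A \<and> x \<in> I \<and> \<one>\<^bsub>A\<^esub> \<notin> I}"
    have fin: "finite \<I>"
      by (rule finite_subset[of _ "Pow (carrier A)"]) (auto simp: \<I>_def assms(3) ideal.Icarr)
    have "\<one>\<^bsub>A\<^esub> \<notin> PIdl\<^bsub>A\<^esub> x"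
    proof
      assume "\<one>\<^bsub>A\<^esub> \<in> PIdl\<^bsub>A\<^esub> x"
      then obtain y where "y \<in> carrier A" "\<one>\<^bsub>A\<^esub> = y \<otimes>\<^bsub>A\<^esub> x"
        by (auto simp: cgenideal_def)
      then show False
        using x unfolding Units_def by (auto simp: m_comm)
    qed
    then have "PIdl\<^bsub>A\<^esub> x \<in> \<I>"
      using x cgenideal_ideal cgenideal_self by (auto simp: \<I>_def)
    then have "Max (card ` \<I>) \<in> card ` \<I>"
      using fin by (intro Max_in) auto
    then obtain N where N: "N \<in> \<I>" and "card N = Max (card ` \<I>)"
      by auto
    then have max: "card J \<le> card N" if "J \<in> \<I>" for J
      using fin that by auto
    have "maximalideal N A"
    proof (rule maximalidealI)
      show "ideal N A" "carrier A \<noteq> N"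
        using N by (auto simp: \<I>_def)
      fix J assume J: "ideal J A" "N \<subseteq> J" "J \<subseteq> carrier A"
      show "J = N \<or> J = carrier A"
      proof (cases "\<one>\<^bsub>A\<^esub> \<in> J")
        case True
        then show ?thesis
          using ideal.one_imp_carrier[OF J(1)] by auto
      next
        case False
        then have "J \<in> \<I>"
          using J N by (auto simp: \<I>_def)
        then have "N = J"
          using max J finite_subset[OF J(3) assms(3)] by (intro card_seteq) auto
        then show ?thesis by simp
      qed
    qed
    then show ?thesis
      using unique N by (auto simp: \<I>_def)
  qed
  moreover have "M \<noteq> {\<zero>\<^bsub>A\<^esub>}"
    using zeromaximalideal_fieldI M assms(5) by auto
  moreover have "\<one>\<^bsub>A\<^esub> \<notin> M"
    using M.one_imp_carrier M.I_notcarr by auto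
  ultimately have "finite_local_ring A M"
    using assms(3) by unfold_locales auto
  then show thesis by (rule that)
qed

section \<open>Integers and the residue field\<close>

context group
begin

lemma subgroup_card_dvd:
  assumes "subgroup H G" "subgroup K G" "H \<subseteq> K" "finite K"
  shows "card H dvd card K"
proof -
  interpret K: group "G\<lparr>carrier := K\<rparr>"
    using assms(2) subgroup_imp_group by blast
  have "card (rcosets\<^bsub>G\<lparr>carrier := K\<rparr>\<^esub> H) * card H = order (G\<lparr>carrier := K\<rparr>)"
    using subgroup_incl[OF assms(1,2,3)] by (rule K.lagrange)
  then have "card K = card (rcosets\<^bsub>G\<lparr>carrier := K\<rparr>\<^esub> H) * card H"
    by (simp add: order_def)
  then show ?thesis
    by (metis dvd_triv_right)
qed

lemma subgroup_pow_card:
  assumes "subgroup H G" "finite H" "x \<in> H"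
  shows "x [^] card H = \<one>"
proof -
  interpret H: group "G\<lparr>carrier := H\<rparr>"
    using assms(1) subgroup_imp_group by blast
  have "x [^]\<^bsub>G\<lparr>carrier := H\<rparr>\<^esub> order (G\<lparr>carrier := H\<rparr>) = \<one>"
    using H.pow_order_eq_1[of x] assms by simp
  then show ?thesis
    unfolding order_def using nat_pow_consistent[of x "card H" H] by simp
qed

end

context cring
begin

text \<open>
  The image of an integer under the unique ring homomorphism from the integers.
\<close>

definition int_elem :: "int \<Rightarrow> 'a" (\<open>\<iota>\<close>) where
  "\<iota> k = [k] \<cdot> \<one>"

lemma int_elem_closed [simp]: "\<iota> k \<in> carrier R"
  by (simp add: int_elem_def)

lemma int_elem_add: "\<iota> (a + b) = \<iota> a \<oplus> \<iota> b"
  unfolding int_elem_def by (rule add.int_pow_mult) simp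

lemma int_elem_mult: "\<iota> (a * b) = \<iota> a \<otimes> \<iota> b"
  unfolding int_elem_def
  using add_pow_ldistr_int[of \<one> "[b] \<cdot> \<one>" a] add.int_pow_pow[of \<one> a b] by (simp add: mult.commute)

lemma int_elem_minus: "\<iota> (- a) = \<ominus> \<iota> a"
  unfolding int_elem_def by (rule add.int_pow_neg) simp

lemma int_elem_diff: "\<iota> (a - b) = \<iota> a \<ominus> \<iota> b"
  using int_elem_add[of a "- b"] by (simp add: int_elem_minus a_minus_def)

lemma int_elem_0 [simp]: "\<iota> 0 = \<zero>"
  using int_elem_diff[of 0 0] by (simp add: a_minus_def r_neg)

lemma int_elem_1 [simp]: "\<iota> 1 = \<one>"
  unfolding int_elem_def by (rule add.int_pow_1) simp

lemma int_elem_multiple: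
  assumes "\<iota> n = \<zero>" "n dvd k"
  shows "\<iota> k = \<zero>"
  using assms by (auto simp: int_elem_mult elim!: dvdE)

lemma int_elem_mod:
  assumes "\<iota> n = \<zero>"
  shows "\<iota> (k mod n) = \<iota> k"
proof -
  have "\<iota> k = \<iota> (n * (k div n) + k mod n)"
    by simp
  also have "\<dots> = \<iota> (k mod n)"
    unfolding int_elem_add int_elem_mult assms by simp
  finally show ?thesis by simp
qed

lemma residue_ring_hom:
  assumes "\<iota> n = \<zero>"
  shows "(\<lambda>k. \<iota> k) \<in> ring_hom (residue_ring n) R"
  by (rule ring_hom_memI) (simp_all add: residue_ring_def int_elem_mod[OF assms] int_elem_add int_elem_mult)

end

context finite_local_ring
begin

text \<open>
  By Bezout, 1 would lie in \<open>M\<close>.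
\<close>

lemma int_elem_coprime:
  assumes "\<iota> a \<in> M" "\<iota> b \<in> M"
  shows "\<not> coprime a b"
proof
  assume "coprime a b"
  then obtain u v where "u * a + v * b = 1"
    using bezout_int[of a b] by auto
  then have "\<iota> u \<otimes> \<iota> a \<oplus> \<iota> v \<otimes> \<iota> b = \<one>"
    unfolding int_elem_mult[symmetric] int_elem_add[symmetric] by simp
  moreover have "\<iota> u \<otimes> \<iota> a \<oplus> \<iota> v \<otimes> \<iota> b \<in> M"
    using assms by (intro M_add I_l_closed) auto
  ultimately show False
    using one_notin_M by simp
qed

lemma M_subgroup: "subgroup M (add_monoid R)"
  by (rule a_subgroup)

text \<open>
  The number \<open>q\<close> is the order of the residue field. Multiplication by \<open>s\<close> has kernel \<open>M\<close>, so \<open>W = R s\<close> has \<open>q\<close>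
  elements, one for each residue class. As a subgroup of \<open>M\<close> it has an order dividing \<open>|M|\<close>, and it is all
  of \<open>M\<close> if the orders agree. By Lagrange \<open>q s = 0\<close>, so \<open>q\<close> lies in the annihilator \<open>M\<close> of \<open>s\<close>.
\<close>

lemma socle_generator:
  obtains s q where "s \<in> M" "s \<noteq> \<zero>" "\<And>m. m \<in> M \<Longrightarrow> m \<otimes> s = \<zero>"
    "card (carrier R) = q * card M" "q dvd card M" "2 \<le> q" "\<iota> (int q) \<in> M"
    "\<And>m. q = card M \<Longrightarrow> m \<in> M \<Longrightarrow> \<exists>a\<in>carrier R. m = a \<otimes> s"
proof -
  obtain s where s: "s \<in> M" "s \<noteq> \<zero>" "\<And>m. m \<in> M \<Longrightarrow> m \<otimes> s = \<zero>"
    using ideal_meets_socle[OF is_ideal M_nontrivial] by blast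
  have sc: "s \<in> carrier R" using s by simp
  define W where "W = (\<lambda>a. a \<otimes> s) ` carrier R"
  have WM: "W \<subseteq> M"
    using s by (auto simp: W_def I_l_closed)
  have finW: "finite W"
    using finite_carrier by (simp add: W_def)
  have W: "subgroup W (add_monoid R)"
  proof (rule add.subgroupI)
    show "W \<subseteq> carrier R" "W \<noteq> {}"
      using sc by (auto simp: W_def)
    show "\<ominus> x \<in> W" if x: "x \<in> W" for x
    proof -
      obtain a where "a \<in> carrier R" "x = a \<otimes> s" using x by (auto simp: W_def)
      then show ?thesis
        unfolding W_def using sc by (intro image_eqI[of _ _ "\<ominus> a"]) (simp_all add: l_minus)
    qed
    show "x \<oplus> y \<in> W" if xy: "x \<in> W" "y \<in> W" for x y
    proof -
      obtain a b where "a \<in> carrier R" "x = a \<otimes> s" "b \<in> carrier R" "y = b \<otimes> s"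
        using xy by (auto simp: W_def)
      then show ?thesis
        unfolding W_def using sc by (intro image_eqI[of _ _ "a \<oplus> b"]) (simp_all add: l_distr)
    qed
  qed
  have sW: "s \<in> W"
    unfolding W_def using sc by (intro image_eqI[of _ _ \<one>]) auto
  have ann_s: "a \<in> M" if "a \<in> carrier R" "a \<otimes> s = \<zero>" for a
    using unit_cancel_zero[OF that(1) _ sc that(2)] s(2) by blast
  \<comment> \<open>\<open>r\<close> chooses one preimage of each element of \<open>W\<close>, that is, one element of each residue class\<close>
  define r where "r = inv_into (carrier R) (\<lambda>a. a \<otimes> s)"
  have r: "r w \<in> carrier R" "r w \<otimes> s = w" if "w \<in> W" for w
    using that inv_into_into[of w "\<lambda>a. a \<otimes> s" "carrier R"] f_inv_into_f[of w "\<lambda>a. a \<otimes> s" "carrier R"]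
    unfolding W_def r_def by auto
  have inj: "inj_on r W"
    using r(2) by (metis inj_onI)
  have trans: "c = d" if cd: "c \<in> r ` W" "d \<in> r ` W" "c \<ominus> d \<in> M" for c d
  proof -
    obtain w z where wz: "w \<in> W" "z \<in> W" "c = r w" "d = r z"
      using cd by auto
    have "(r w \<ominus> r z) \<otimes> s = w \<ominus> z"
      using r wz sc by (simp add: a_minus_def l_distr l_minus)
    then have "w \<ominus> z = \<zero>"
      using s(3) cd wz by simp
    then have "w = z"
      using wz WM by (simp add: r_right_minus_eq subset_iff)
    then show ?thesis using wz by simp
  qed
  have rW: "r ` W \<subseteq> carrier R"
    using r by auto
  have le: "card W * card M \<le> card (carrier R)"
    using transversal_card_le(1)[OF rW trans] card_image[OF inj] by simp
  have "carrier R \<subseteq> (\<lambda>(c, m). c \<oplus> m) ` (r ` W \<times> M)"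
  proof
    fix a assume a: "a \<in> carrier R"
    let ?c = "r (a \<otimes> s)"
    have w: "a \<otimes> s \<in> W" using a by (simp add: W_def)
    have "(a \<ominus> ?c) \<otimes> s = a \<otimes> s \<ominus> ?c \<otimes> s"
      using a r(1)[OF w] sc by (simp add: a_minus_def l_distr l_minus)
    also have "\<dots> = \<zero>"
      using r(2)[OF w] a sc by (simp add: r_right_minus_eq)
    finally have "a \<ominus> ?c \<in> M"
      using a r(1)[OF w] by (intro ann_s) auto
    moreover have "a = ?c \<oplus> (a \<ominus> ?c)"
      using a r(1)[OF w] by algebra
    ultimately show "a \<in> (\<lambda>(c, m). c \<oplus> m) ` (r ` W \<times> M)"
      using w by (intro image_eqI[of _ _ "(?c, a \<ominus> ?c)"]) auto
  qed
  then have "card (carrier R) \<le> card (r ` W \<times> M)"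
    using finW finite_M by (meson card_image_le card_mono finite_SigmaI finite_imageI le_trans)
  then have card: "card (carrier R) = card W * card M"
    using le card_image[OF inj] by (simp add: card_cartesian_product)
  have dvd: "card W dvd card M"
    using add.subgroup_card_dvd[OF W M_subgroup WM finite_M] .
  have "{\<zero>, s} \<subseteq> W"
    using sW subgroup.one_closed[OF W] by simp
  then have two: "2 \<le> card W"
    using card_mono[OF finW, of "{\<zero>, s}"] s(2) by simp
  have char: "\<iota> (int (card W)) \<in> M"
  proof (rule ann_s)
    have "\<iota> (int (card W)) \<otimes> s = [card W] \<cdot> s"
      using sc by (simp add: int_elem_def add_pow_ldistr add_pow_int_ge)
    also have "\<dots> = \<zero>"
      using add.subgroup_pow_card[OF W finW sW] by simp
    finally show "\<iota> (int (card W)) \<otimes> s = \<zero>" .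
  qed simp
  have gen: "\<exists>a\<in>carrier R. m = a \<otimes> s" if "card W = card M" "m \<in> M" for m
    using card_subset_eq[OF finite_M WM that(1)] that(2) unfolding W_def by blast
  show thesis
    by (rule that[OF s card dvd two char gen])
qed

text \<open>
  The integers \<open>0, \<dots>, q - 1\<close> are pairwise incongruent modulo \<open>M\<close>, since their differences are coprime to
  \<open>q\<close>. There are \<open>q\<close> of them, so they represent all residue classes.
\<close>

lemma prime_residue_class:
  assumes "Factorial_Ring.prime q" "card (carrier R) = q * card M" "\<iota> (int q) \<in> M" "a \<in> carrier R"
  obtains k m where "k \<in> {0..<int q}" "m \<in> M" "a = \<iota> k \<oplus> m"
proof -
  have sep: "k = l" if "k \<in> {0..<int q}" "l \<in> {0..<int q}" "\<iota> k \<ominus> \<iota> l \<in> M" for k l :: int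
  proof (rule ccontr)
    assume "k \<noteq> l"
    have "Factorial_Ring.prime (int q)"
      using assms(1) by simp
    moreover have "\<not> int q dvd k - l"
      using that(1,2) \<open>k \<noteq> l\<close> dvd_imp_le_int[of "k - l" "int q"] by auto
    ultimately have "coprime (int q) (k - l)"
      by (simp add: prime_imp_coprime)
    then show False
      using int_elem_coprime[OF assms(3)] that(3) by (simp add: int_elem_diff)
  qed
  let ?C = "\<iota> ` {0..<int q}"
  have trans: "c = d" if "c \<in> ?C" "d \<in> ?C" "c \<ominus> d \<in> M" for c d
    using that sep by blast
  have "inj_on \<iota> {0..<int q}"
  proof (rule inj_onI)
    fix k l assume kl: "k \<in> {0..<int q}" "l \<in> {0..<int q}" "\<iota> k = \<iota> l"
    have "\<iota> k \<ominus> \<iota> l \<in> M"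
      unfolding kl(3) using M_zero by (simp add: a_minus_def r_neg)
    then show "k = l"
      by (rule sep[OF kl(1,2)])
  qed
  then have "card ?C = q"
    by (simp add: card_image)
  then have "card (carrier R) \<le> card ?C * card M"
    using assms(2) by simp
  moreover have "?C \<subseteq> carrier R"
    by auto
  ultimately have "\<exists>c\<in>?C. \<exists>m\<in>M. a = c \<oplus> m"
    using transversal_card_le(2)[OF _ trans _ assms(4)] by blast
  then obtain c m where "c \<in> ?C" and m: "m \<in> M" "a = c \<oplus> m"
    by (elim bexE)
  then obtain k where "k \<in> {0..<int q}" "c = \<iota> k"
    by blast
  with m show thesis
    by (intro that[of k m]) simp_all
qed

end

section \<open>Quotients of polynomial rings\<close>

lemma
  assumes "cring R"
  shows pvar_closed: "pvar R \<in> carrier (UP R)"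
    and pconst_closed: "c \<in> carrier R \<Longrightarrow> pconst R c \<in> carrier (UP R)"
proof -
  interpret UP_cring R "UP R"
    using assms by (rule UP_cring.intro)
  show "pvar R \<in> carrier (UP R)" "c \<in> carrier R \<Longrightarrow> pconst R c \<in> carrier (UP R)"
    by (simp_all add: pvar_def pconst_def)
qed

text \<open>
  Every polynomial arises from constants by addition and multiplication by the variable.
\<close>

lemma UP_induct:
  assumes "cring R" and p: "p \<in> carrier (UP R)"
    and const: "\<And>c. c \<in> carrier R \<Longrightarrow> Q (pconst R c)"
    and add: "\<And>p q. p \<in> carrier (UP R) \<Longrightarrow> q \<in> carrier (UP R) \<Longrightarrow> Q p \<Longrightarrow> Q q \<Longrightarrow> Q (p \<oplus>\<^bsub>UP R\<^esub> q)"
    and shift: "\<And>p. p \<in> carrier (UP R) \<Longrightarrow> Q p \<Longrightarrow> Q (pvar R \<otimes>\<^bsub>UP R\<^esub> p)"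
  shows "Q p"
proof -
  interpret UP_cring R "UP R"
    using assms(1) by (rule UP_cring.intro)
  have monom: "Q (up_ring.monom (UP R) c n)" if c: "c \<in> carrier R" for c n
  proof (induction n)
    case 0
    show ?case using const[OF c] by (simp add: pconst_def)
  next
    case (Suc n)
    have "up_ring.monom (UP R) c (Suc n) = pvar R \<otimes>\<^bsub>UP R\<^esub> up_ring.monom (UP R) c n"
      using monom_mult[of "\<one>\<^bsub>R\<^esub>" c 1 n] c by (simp add: pvar_def)
    then show ?case using shift[OF _ Suc] c by simp
  qed
  have sumQ: "Q (\<Oplus>\<^bsub>UP R\<^esub>i \<in> {..n}. up_ring.monom (UP R) (up_ring.coeff (UP R) p i) i)" for n
  proof (induction n)
    case 0
    show ?case using monom p by simp
  next
    case (Suc n)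
    have "(\<Oplus>\<^bsub>UP R\<^esub>i \<in> {..Suc n}. up_ring.monom (UP R) (up_ring.coeff (UP R) p i) i) =
        up_ring.monom (UP R) (up_ring.coeff (UP R) p (Suc n)) (Suc n) \<oplus>\<^bsub>UP R\<^esub> (\<Oplus>\<^bsub>UP R\<^esub>i \<in> {..n}. up_ring.monom (UP R) (up_ring.coeff (UP R) p i) i)"
      using p unfolding atMost_Suc by (subst P.finsum_insert) auto
    then show ?case
      using add monom p Suc by simp
  qed
  show ?thesis
    by (subst up_repr[OF p, symmetric]) (rule sumQ)
qed

lemma UP_eval:
  assumes "cring R" "cring T" "h \<in> ring_hom R T" "a \<in> carrier T"
  obtains e where "e \<in> ring_hom (UP R) T" "\<And>c. c \<in> carrier R \<Longrightarrow> e (pconst R c) = h c" "e (pvar R) = a"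
proof -
  interpret UP_pre_univ_prop R T h "UP R"
    using assms(1-3) by (rule UP_pre_univ_propI)
  show thesis
    using assms(4) eval_ring_hom eval_const eval_monom1
    by (intro that[of "UnivPoly.eval R T h a"]) (auto simp: pconst_def pvar_def)
qed

definition quot_proj :: "('a, 'm) ring_scheme \<Rightarrow> (nat \<Rightarrow> 'a) set \<Rightarrow> (nat \<Rightarrow> 'a) \<Rightarrow> (nat \<Rightarrow> 'a) set" where
  "quot_proj R S p = Idl\<^bsub>UP R\<^esub> S +>\<^bsub>UP R\<^esub> p"

lemma
  assumes "cring R" "S \<subseteq> carrier (UP R)"
  shows poly_quot_cring: "cring (poly_quot R S)"
    and quot_proj_hom: "quot_proj R S \<in> ring_hom (UP R) (poly_quot R S)"
    and quot_proj_surj: "quot_proj R S ` carrier (UP R) = carrier (poly_quot R S)"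
    and quot_proj_zero: "s \<in> S \<Longrightarrow> quot_proj R S s = \<zero>\<^bsub>poly_quot R S\<^esub>"
    and poly_quot_lift: "ring T \<Longrightarrow> e \<in> ring_hom (UP R) T \<Longrightarrow> (\<And>s. s \<in> S \<Longrightarrow> e s = \<zero>\<^bsub>T\<^esub>) \<Longrightarrow>
      \<exists>f\<in>ring_hom (poly_quot R S) T. \<forall>p\<in>carrier (UP R). f (quot_proj R S p) = e p"
proof -
  interpret UP_cring R "UP R"
    using assms(1) by (rule UP_cring.intro)
  interpret I: ideal "Idl\<^bsub>UP R\<^esub> S" "UP R"
    using assms(2) by (rule P.genideal_ideal)
  show "cring (poly_quot R S)"
    unfolding poly_quot_def by (rule I.quotient_is_cring[OF P.is_cring])
  show hom: "quot_proj R S \<in> ring_hom (UP R) (poly_quot R S)"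
    using I.rcos_ring_hom unfolding poly_quot_def quot_proj_def[abs_def] .
  show surj: "quot_proj R S ` carrier (UP R) = carrier (poly_quot R S)"
    unfolding poly_quot_def quot_proj_def[abs_def] FactRing_simps by auto
  show "quot_proj R S s = \<zero>\<^bsub>poly_quot R S\<^esub>" if "s \<in> S"
    unfolding poly_quot_def quot_proj_def
    by (simp add: FactRing_def I.a_rcos_const[OF subsetD[OF P.genideal_self[OF assms(2)] that]])
  assume T: "ring T" and e: "e \<in> ring_hom (UP R) T" and zero: "\<And>s. s \<in> S \<Longrightarrow> e s = \<zero>\<^bsub>T\<^esub>"
  have e': "ring_hom_ring (UP R) T e"
    by (rule ring_hom_ringI2[OF P.ring_axioms T e])
  have ker: "Idl\<^bsub>UP R\<^esub> S \<subseteq> a_kernel (UP R) T e"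
  proof (rule P.genideal_minimal[OF ring_hom_ring.kernel_is_ideal[OF e']], rule subsetI)
    show "s \<in> a_kernel (UP R) T e" if "s \<in> S" for s
      using zero[OF that] subsetD[OF assms(2) that] by (simp add: a_kernel_def')
  qed
  have well: "e p = e q" if pq: "p \<in> carrier (UP R)" "q \<in> carrier (UP R)" "quot_proj R S p = quot_proj R S q" for p q
  proof -
    have "p \<in> quot_proj R S q"
      using pq I.a_rcos_self[of p] by (simp add: quot_proj_def)
    then obtain i where i: "i \<in> Idl\<^bsub>UP R\<^esub> S" "p = i \<oplus>\<^bsub>UP R\<^esub> q"
      unfolding quot_proj_def a_r_coset_def' by auto
    then have "e i = \<zero>\<^bsub>T\<^esub>" "i \<in> carrier (UP R)"
      using ker by (auto simp: a_kernel_def')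
    moreover have "e q \<in> carrier T"
      using ring_hom_closed[OF e pq(2)] .
    ultimately show ?thesis
      using ring_hom_add[OF e _ pq(2), of i] ring.ring_simprules(8)[OF T] by (simp add: i(2))
  qed
  define f where "f D = e (inv_into (carrier (UP R)) (quot_proj R S) D)" for D
  have f: "f (quot_proj R S p) = e p" if p: "p \<in> carrier (UP R)" for p
  proof -
    have im: "quot_proj R S p \<in> quot_proj R S ` carrier (UP R)"
      using p by (rule imageI)
    show ?thesis
      unfolding f_def by (rule well[OF inv_into_into[OF im] p f_inv_into_f[OF im]])
  qed
  have "f \<in> ring_hom (poly_quot R S) T"
  proof (rule ring_hom_memI)
    fix u v assume "u \<in> carrier (poly_quot R S)" "v \<in> carrier (poly_quot R S)"
    then obtain p q where pq: "p \<in> carrier (UP R)" "q \<in> carrier (UP R)" "u = quot_proj R S p" "v = quot_proj R S q"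
      unfolding surj[symmetric] by auto
    show "f u \<in> carrier T"
      using pq f ring_hom_closed[OF e] by simp
    show "f (u \<otimes>\<^bsub>poly_quot R S\<^esub> v) = f u \<otimes>\<^bsub>T\<^esub> f v"
      unfolding pq(3,4) ring_hom_mult[OF hom pq(1,2), symmetric] using pq ring_hom_mult[OF e pq(1,2)] by (simp add: f)
    show "f (u \<oplus>\<^bsub>poly_quot R S\<^esub> v) = f u \<oplus>\<^bsub>T\<^esub> f v"
      unfolding pq(3,4) ring_hom_add[OF hom pq(1,2), symmetric] using pq ring_hom_add[OF e pq(1,2)] by (simp add: f)
  next
    show "f \<one>\<^bsub>poly_quot R S\<^esub> = \<one>\<^bsub>T\<^esub>"
      using f[of "\<one>\<^bsub>UP R\<^esub>"] ring_hom_one[OF hom] ring_hom_one[OF e] by simp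
  qed
  then show "\<exists>f\<in>ring_hom (poly_quot R S) T. \<forall>p\<in>carrier (UP R). f (quot_proj R S p) = e p"
    using f by (intro bexI[of _ f]) simp_all
qed

lemma poly_quot_induct:
  assumes R: "cring R" and S: "S \<subseteq> carrier (UP R)" and z: "z \<in> carrier (poly_quot R S)"
    and const: "\<And>c. c \<in> carrier R \<Longrightarrow> quot_proj R S (pconst R c) \<in> B"
    and add: "\<And>u v. u \<in> B \<Longrightarrow> v \<in> B \<Longrightarrow> u \<oplus>\<^bsub>poly_quot R S\<^esub> v \<in> B"
    and shift: "\<And>u. u \<in> B \<Longrightarrow> quot_proj R S (pvar R) \<otimes>\<^bsub>poly_quot R S\<^esub> u \<in> B"
  shows "z \<in> B"
proof -
  note hom = quot_proj_hom[OF R S]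
  obtain p where p: "p \<in> carrier (UP R)" "z = quot_proj R S p"
    using z unfolding quot_proj_surj[OF R S, symmetric] by auto
  have "quot_proj R S p \<in> B"
  proof (rule UP_induct[OF R p(1), where Q = "\<lambda>p. quot_proj R S p \<in> B"])
    show "quot_proj R S (p \<oplus>\<^bsub>UP R\<^esub> q) \<in> B"
      if "p \<in> carrier (UP R)" "q \<in> carrier (UP R)" "quot_proj R S p \<in> B" "quot_proj R S q \<in> B" for p q
      using ring_hom_add[OF hom that(1,2)] add that by simp
    show "quot_proj R S (pvar R \<otimes>\<^bsub>UP R\<^esub> p) \<in> B"
      if "p \<in> carrier (UP R)" "quot_proj R S p \<in> B" for p
      using ring_hom_mult[OF hom pvar_closed[OF R] that(1)] shift that by simp
  qed (rule const)
  with p show ?thesis by simp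
qed

text \<open>
  The order of a presented ring is only ever bounded from above, and this is what makes such bounds sufficient.
\<close>

lemma ring_iso_if_surj:
  assumes "ring Q" "f \<in> ring_hom Q T" "f ` carrier Q = carrier T"
    and "finite (carrier Q)" "card (carrier Q) \<le> card (carrier T)"
  shows "T \<simeq> Q"
proof -
  have "card (f ` carrier Q) = card (carrier Q)"
    using assms card_image_le[OF assms(4), of f] by auto
  then have "inj_on f (carrier Q)"
    using assms(4) by (rule eq_card_imp_inj_on[rotated])
  then have "f \<in> ring_iso Q T"
    using assms unfolding ring_iso_def bij_betw_def by simp
  then show ?thesis
    using ring_iso_set_sym[OF assms(1)] unfolding is_ring_iso_def by blast
qed

text \<open>
  Closure under negation is implied for the finite rings considered here, where \<open>-1\<close> is a sum of ones.
\<close>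

definition ring_generated :: "('a, 'm) ring_scheme \<Rightarrow> 'a set \<Rightarrow> bool" where
  "ring_generated R G \<longleftrightarrow> (\<forall>B. \<zero>\<^bsub>R\<^esub> \<in> B \<longrightarrow> \<one>\<^bsub>R\<^esub> \<in> B \<longrightarrow> G \<subseteq> B \<longrightarrow>
    (\<forall>x\<in>B. \<forall>y\<in>B. x \<oplus>\<^bsub>R\<^esub> y \<in> B \<and> x \<otimes>\<^bsub>R\<^esub> y \<in> B) \<longrightarrow> carrier R \<subseteq> B)"

lemma ring_generatedD:
  assumes "ring_generated R G" "\<zero>\<^bsub>R\<^esub> \<in> B" "\<one>\<^bsub>R\<^esub> \<in> B" "G \<subseteq> B"
    and "\<And>x y. x \<in> B \<Longrightarrow> y \<in> B \<Longrightarrow> x \<oplus>\<^bsub>R\<^esub> y \<in> B" "\<And>x y. x \<in> B \<Longrightarrow> y \<in> B \<Longrightarrow> x \<otimes>\<^bsub>R\<^esub> y \<in> B"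
  shows "carrier R \<subseteq> B"
  using assms(1)[unfolded ring_generated_def, THEN spec, of B] assms(2-) by simp

text \<open>
  The generators of \<open>T\<close> make the homomorphism induced by evaluation at \<open>a\<close> surjective; the bound on the
  cardinality makes it injective, so no description of its kernel is needed.
\<close>

lemma ring_iso_poly_quotI:
  assumes R: "cring R" and S: "S \<subseteq> carrier (UP R)" and T: "cring T"
    and h: "h \<in> ring_hom R T" and a: "a \<in> carrier T"
    and rel: "\<And>e s. e \<in> ring_hom (UP R) T \<Longrightarrow> (\<And>c. c \<in> carrier R \<Longrightarrow> e (pconst R c) = h c) \<Longrightarrow>
      e (pvar R) = a \<Longrightarrow> s \<in> S \<Longrightarrow> e s = \<zero>\<^bsub>T\<^esub>"
    and gen: "ring_generated T G" "G \<subseteq> insert a (h ` carrier R)"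
    and fin: "finite (carrier (poly_quot R S))" "card (carrier (poly_quot R S)) \<le> card (carrier T)"
  shows "T \<simeq> poly_quot R S"
proof -
  interpret Q: cring "poly_quot R S"
    by (rule poly_quot_cring[OF R S])
  interpret T: cring T by fact
  obtain e where e: "e \<in> ring_hom (UP R) T" "\<And>c. c \<in> carrier R \<Longrightarrow> e (pconst R c) = h c" "e (pvar R) = a"
    by (rule UP_eval[OF R T h a]) (rule that)
  have "\<exists>f\<in>ring_hom (poly_quot R S) T. \<forall>p\<in>carrier (UP R). f (quot_proj R S p) = e p"
    by (rule poly_quot_lift[OF R S T.ring_axioms e(1) rel[OF e]])
  then obtain f where f: "f \<in> ring_hom (poly_quot R S) T" "\<And>p. p \<in> carrier (UP R) \<Longrightarrow> f (quot_proj R S p) = e p"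
    by (elim bexE) (erule that, erule bspec, assumption)
  have proj: "quot_proj R S p \<in> carrier (poly_quot R S)" if "p \<in> carrier (UP R)" for p
    using quot_proj_surj[OF R S] that by blast
  have hf: "h c \<in> f ` carrier (poly_quot R S)" if "c \<in> carrier R" for c
    using imageI[of _ _ f, OF proj[OF pconst_closed[OF R that]]] f(2)[OF pconst_closed[OF R that]] e(2)[OF that] by simp
  have af: "a \<in> f ` carrier (poly_quot R S)"
    using imageI[of _ _ f, OF proj[OF pvar_closed[OF R]]] f(2)[OF pvar_closed[OF R]] e(3) by simp
  have "carrier T \<subseteq> f ` carrier (poly_quot R S)"
  proof (rule ring_generatedD[OF gen(1)])
    show "\<zero>\<^bsub>T\<^esub> \<in> f ` carrier (poly_quot R S)" "\<one>\<^bsub>T\<^esub> \<in> f ` carrier (poly_quot R S)"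
      using imageI[OF Q.zero_closed, of f] imageI[OF Q.one_closed, of f]
        ring_hom_zero[OF f(1) Q.ring_axioms T.ring_axioms] ring_hom_one[OF f(1)] by simp_all
    show "G \<subseteq> f ` carrier (poly_quot R S)"
      using gen(2) hf af by blast
    fix x y assume "x \<in> f ` carrier (poly_quot R S)" "y \<in> f ` carrier (poly_quot R S)"
    then obtain u v where uv: "u \<in> carrier (poly_quot R S)" "v \<in> carrier (poly_quot R S)" "x = f u" "y = f v"
      by auto
    show "x \<oplus>\<^bsub>T\<^esub> y \<in> f ` carrier (poly_quot R S)"
      unfolding uv(3,4) ring_hom_add[OF f(1) uv(1,2), symmetric] using uv by simp
    show "x \<otimes>\<^bsub>T\<^esub> y \<in> f ` carrier (poly_quot R S)"
      unfolding uv(3,4) ring_hom_mult[OF f(1) uv(1,2), symmetric] using uv by simp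
  qed
  then have "f ` carrier (poly_quot R S) = carrier T"
    using ring_hom_closed[OF f(1)] by auto
  then show ?thesis
    using ring_iso_if_surj[OF Q.ring_axioms f(1)] fin by simp
qed

lemma ring_hom_nat_pow:
  assumes "ring R" "ring T" "e \<in> ring_hom R T" "x \<in> carrier R"
  shows "e (x [^]\<^bsub>R\<^esub> (n::nat)) = e x [^]\<^bsub>T\<^esub> n"
proof -
  interpret R: ring R by fact
  interpret T: ring T by fact
  show ?thesis
    using assms(3,4) by (induction n) (simp_all add: ring_hom_one ring_hom_mult)
qed

lemma ring_hom_minus:
  assumes "ring R" "ring T" "e \<in> ring_hom R T" "x \<in> carrier R" "y \<in> carrier R"
  shows "e (x \<ominus>\<^bsub>R\<^esub> y) = e x \<ominus>\<^bsub>T\<^esub> e y"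
proof -
  interpret ring_hom_ring R T e
    using assms(1-3) by (rule ring_hom_ringI2)
  show ?thesis
    using assms(4,5) by (simp add: a_minus_def)
qed

lemma UP_ring_structure: "cring R \<Longrightarrow> cring (UP R)"
  by (rule UP_cring.UP_cring) (rule UP_cring.intro)

lemma pconst_hom:
  assumes "cring R" shows "pconst R \<in> ring_hom R (UP R)"
proof -
  interpret UP_cring R "UP R"
    using assms by (rule UP_cring.intro)
  show ?thesis
    using const_ring_hom unfolding pconst_def[abs_def] .
qed

definition quot_const :: "('a, 'm) ring_scheme \<Rightarrow> (nat \<Rightarrow> 'a) set \<Rightarrow> 'a \<Rightarrow> (nat \<Rightarrow> 'a) set" where
  "quot_const R S c = quot_proj R S (pconst R c)"

definition quot_var :: "('a, 'm) ring_scheme \<Rightarrow> (nat \<Rightarrow> 'a) set \<Rightarrow> (nat \<Rightarrow> 'a) set" where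
  "quot_var R S = quot_proj R S (pvar R)"

lemma quot_const_hom:
  assumes "cring R" "S \<subseteq> carrier (UP R)"
  shows "quot_const R S \<in> ring_hom R (poly_quot R S)"
  using ring_hom_trans[OF pconst_hom[OF assms(1)] quot_proj_hom[OF assms]]
  unfolding quot_const_def[abs_def] comp_def .

lemma quot_var_closed:
  assumes "cring R" "S \<subseteq> carrier (UP R)"
  shows "quot_var R S \<in> carrier (poly_quot R S)"
  unfolding quot_var_def using ring_hom_closed[OF quot_proj_hom[OF assms] pvar_closed[OF assms(1)]] .

text \<open>
  A relation that expresses the square of the variable by lower powers reduces every polynomial to a
  linear one, since the linear expressions are closed under addition and multiplication by the variable.
\<close>

lemma poly_quot_quadratic:
  assumes R: "cring R" and S: "S \<subseteq> carrier (UP R)" and ab: "\<alpha> \<in> carrier R" "\<beta> \<in> carrier R"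
    and rel: "quot_var R S \<otimes>\<^bsub>poly_quot R S\<^esub> quot_var R S =
      quot_const R S \<alpha> \<oplus>\<^bsub>poly_quot R S\<^esub> quot_const R S \<beta> \<otimes>\<^bsub>poly_quot R S\<^esub> quot_var R S"
  shows "carrier (poly_quot R S) \<subseteq> (\<lambda>(c, d). quot_const R S c \<oplus>\<^bsub>poly_quot R S\<^esub>
    quot_const R S d \<otimes>\<^bsub>poly_quot R S\<^esub> quot_var R S) ` (carrier R \<times> carrier R)"
proof
  interpret R: cring R by fact
  interpret Q: cring "poly_quot R S"
    by (rule poly_quot_cring[OF R S])
  let ?k = "quot_const R S" and ?v = "quot_var R S"
  let ?g = "\<lambda>c d. ?k c \<oplus>\<^bsub>poly_quot R S\<^esub> ?k d \<otimes>\<^bsub>poly_quot R S\<^esub> ?v"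
  let ?B = "(\<lambda>(c, d). ?g c d) ` (carrier R \<times> carrier R)"
  note k = quot_const_hom[OF R S]
  have kc: "?k c \<in> carrier (poly_quot R S)" if "c \<in> carrier R" for c
    using ring_hom_closed[OF k that] .
  have vc: "?v \<in> carrier (poly_quot R S)"
    by (rule quot_var_closed[OF R S])
  have k0: "?k \<zero>\<^bsub>R\<^esub> = \<zero>\<^bsub>poly_quot R S\<^esub>"
    using ring_hom_zero[OF k R.ring_axioms Q.ring_axioms] .
  have B: "?g c d \<in> ?B" if "c \<in> carrier R" "d \<in> carrier R" for c d
    using that by auto
  fix z assume "z \<in> carrier (poly_quot R S)"
  then show "z \<in> ?B"
  proof (rule poly_quot_induct[OF R S])
    show "quot_proj R S (pconst R c) \<in> ?B" if "c \<in> carrier R" for c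
      using B[OF that R.zero_closed] kc[OF that] vc by (simp add: k0 quot_const_def[symmetric])
    fix u assume "u \<in> ?B"
    then obtain c d where u: "u = ?g c d" and cd: "c \<in> carrier R" "d \<in> carrier R"
      by auto
    have "?v \<otimes>\<^bsub>poly_quot R S\<^esub> u = ?k c \<otimes>\<^bsub>poly_quot R S\<^esub> ?v \<oplus>\<^bsub>poly_quot R S\<^esub> ?k d \<otimes>\<^bsub>poly_quot R S\<^esub> (?v \<otimes>\<^bsub>poly_quot R S\<^esub> ?v)"
      unfolding u using kc[OF cd(1)] kc[OF cd(2)] vc by algebra
    also have "\<dots> = ?k d \<otimes>\<^bsub>poly_quot R S\<^esub> ?k \<alpha> \<oplus>\<^bsub>poly_quot R S\<^esub> (?k c \<oplus>\<^bsub>poly_quot R S\<^esub> ?k d \<otimes>\<^bsub>poly_quot R S\<^esub> ?k \<beta>) \<otimes>\<^bsub>poly_quot R S\<^esub> ?v"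
      unfolding rel using kc[OF cd(1)] kc[OF cd(2)] kc[OF ab(1)] kc[OF ab(2)] vc by algebra
    also have "\<dots> = ?g (d \<otimes>\<^bsub>R\<^esub> \<alpha>) (c \<oplus>\<^bsub>R\<^esub> d \<otimes>\<^bsub>R\<^esub> \<beta>)"
      using cd ab by (simp add: ring_hom_add[OF k] ring_hom_mult[OF k])
    finally show "quot_proj R S (pvar R) \<otimes>\<^bsub>poly_quot R S\<^esub> u \<in> ?B"
      unfolding quot_var_def[symmetric] using B cd ab by simp
    fix w assume "w \<in> ?B"
    then obtain c' d' where w: "w = ?g c' d'" and cd': "c' \<in> carrier R" "d' \<in> carrier R"
      by auto
    have "u \<oplus>\<^bsub>poly_quot R S\<^esub> w = (?k c \<oplus>\<^bsub>poly_quot R S\<^esub> ?k c') \<oplus>\<^bsub>poly_quot R S\<^esub> (?k d \<oplus>\<^bsub>poly_quot R S\<^esub> ?k d') \<otimes>\<^bsub>poly_quot R S\<^esub> ?v"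
      unfolding u w using kc[OF cd(1)] kc[OF cd(2)] kc[OF cd'(1)] kc[OF cd'(2)] vc by algebra
    also have "\<dots> = ?g (c \<oplus>\<^bsub>R\<^esub> c') (d \<oplus>\<^bsub>R\<^esub> d')"
      using cd cd' by (simp add: ring_hom_add[OF k])
    finally show "u \<oplus>\<^bsub>poly_quot R S\<^esub> w \<in> ?B"
      using B cd cd' by simp
  qed
qed

lemma poly_quot_quadratic_card:
  assumes "cring R" "S \<subseteq> carrier (UP R)" "\<alpha> \<in> carrier R" "\<beta> \<in> carrier R" "finite (carrier R)"
    and "quot_var R S \<otimes>\<^bsub>poly_quot R S\<^esub> quot_var R S =
      quot_const R S \<alpha> \<oplus>\<^bsub>poly_quot R S\<^esub> quot_const R S \<beta> \<otimes>\<^bsub>poly_quot R S\<^esub> quot_var R S"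
  shows "finite (carrier (poly_quot R S))" "card (carrier (poly_quot R S)) \<le> card (carrier R) * card (carrier R)"
proof -
  note sub = poly_quot_quadratic[OF assms(1-4,6)]
  show "finite (carrier (poly_quot R S))"
    by (rule finite_subset[OF sub]) (simp add: assms(5))
  show "card (carrier (poly_quot R S)) \<le> card (carrier R) * card (carrier R)"
    using surj_card_le[OF _ sub] assms(5) by (simp add: card_cartesian_product)
qed

section \<open>Orders and presentations of the listed rings\<close>

text \<open>
  A homomorphism from \<open>\<int>/n\<close> agrees with \<open>int_elem\<close> on \<open>0, \<dots>, n - 1\<close>. Adding 1 once more gives 0 in \<open>\<int>/n\<close>.
\<close>

lemma ring_hom_residue_ring_char:
  assumes T: "cring T" and h: "h \<in> ring_hom (residue_ring n) T" and n: "n > 1"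
  shows "cring.int_elem T n = \<zero>\<^bsub>T\<^esub>"
proof -
  interpret T: cring T by fact
  interpret Z: residues n "residue_ring n"
    using n by (rule residues.intro) 
  have zero: "h 0 = \<zero>\<^bsub>T\<^esub>"
    using ring_hom_zero[OF h Z.ring_axioms T.ring_axioms] by (simp add: Z.res_zero_eq)
  have one: "h 1 = \<one>\<^bsub>T\<^esub>"
    using ring_hom_one[OF h] by (simp add: Z.res_one_eq)
  have add: "h ((a + b) mod n) = h a \<oplus>\<^bsub>T\<^esub> h b" if "a \<in> {0..n - 1}" "b \<in> {0..n - 1}" for a b
    using ring_hom_add[OF h, of a b] that by (simp add: Z.res_carrier_eq Z.res_add_eq)
  have nat: "h (int k) = T.int_elem (int k)" if "int k < n" for k
    using that
  proof (induction k)
    case (Suc k)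
    have sk: "int (Suc k) = int k + 1"
      by simp
    have "(int k + 1) mod n = int k + 1"
      using Suc.prems by simp
    then have "h (int k + 1) = h (int k) \<oplus>\<^bsub>T\<^esub> h 1"
      using add[of "int k" 1] Suc.prems n by simp
    then show ?case
      unfolding sk T.int_elem_add using Suc one by simp
  qed (simp add: zero)
  have "h 0 = h ((n - 1 + 1) mod n)"
    using n by simp
  also have "\<dots> = h (n - 1) \<oplus>\<^bsub>T\<^esub> h 1"
    using n by (intro add) auto
  also have "\<dots> = T.int_elem (n - 1) \<oplus>\<^bsub>T\<^esub> T.int_elem 1"
    using n one nat[of "nat (n - 1)"] by simp
  also have "\<dots> = T.int_elem n"
    using T.int_elem_add[of "n - 1" 1] by simp
  finally show ?thesis using zero by simp
qed

lemma residue_ring_cring: "n > 1 \<Longrightarrow> cring (residue_ring n)"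
  by (rule residues.cring) (rule residues.intro)

lemma residue_ring_card:
  "finite (carrier (residue_ring n))" "card (carrier (residue_ring n)) = nat n"
  by (simp_all add: residue_ring_def)

lemma residue_ring_isoI:
  assumes T: "cring T" and n: "n > 1" and char: "cring.int_elem T n = \<zero>\<^bsub>T\<^esub>"
    and gen: "ring_generated T {}" and card: "nat n \<le> card (carrier T)"
  shows "T \<simeq> residue_ring n"
proof -
  interpret T: cring T by fact
  interpret Z: cring "residue_ring n"
    using n by (rule residue_ring_cring)
  have hom: "T.int_elem \<in> ring_hom (residue_ring n) T"
    using T.residue_ring_hom[OF char] by simp
  let ?B = "T.int_elem ` carrier (residue_ring n)"
  have "\<zero>\<^bsub>T\<^esub> \<in> ?B" "\<one>\<^bsub>T\<^esub> \<in> ?B"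
    using imageI[OF Z.zero_closed, of T.int_elem] imageI[OF Z.one_closed, of T.int_elem]
    by (simp_all add: residue_ring_def)
  moreover have cl: "x \<oplus>\<^bsub>T\<^esub> y \<in> ?B \<and> x \<otimes>\<^bsub>T\<^esub> y \<in> ?B" if xy: "x \<in> ?B" "y \<in> ?B" for x y
  proof -
    obtain k l where kl: "k \<in> carrier (residue_ring n)" "l \<in> carrier (residue_ring n)"
        "x = T.int_elem k" "y = T.int_elem l"
      using xy by blast
    show ?thesis
      unfolding kl(3,4) ring_hom_add[OF hom kl(1,2), symmetric] ring_hom_mult[OF hom kl(1,2), symmetric]
      using kl(1,2) by simp
  qed
  ultimately have "carrier T \<subseteq> ?B"
    using ring_generatedD[OF gen, of ?B] cl by simp
  then have "?B = carrier T"
    using ring_hom_closed[OF hom] by blast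
  then show ?thesis
    using ring_iso_if_surj[OF Z.ring_axioms hom] card by (simp add: residue_ring_card)
qed

lemma UP_pow_closed: "cring R \<Longrightarrow> pvar R [^]\<^bsub>UP R\<^esub> (n::nat) \<in> carrier (UP R)"
  using monoid.nat_pow_closed[OF ring.is_monoid[OF cring.axioms(1)[OF UP_ring_structure]] pvar_closed] .

lemma quot_var_pow:
  assumes R: "cring R" and S: "S \<subseteq> carrier (UP R)"
  shows "quot_proj R S (pvar R [^]\<^bsub>UP R\<^esub> (n::nat)) = quot_var R S [^]\<^bsub>poly_quot R S\<^esub> n"
  unfolding quot_var_def
  by (rule ring_hom_nat_pow[OF cring.axioms(1)[OF UP_ring_structure[OF R]] cring.axioms(1)[OF poly_quot_cring[OF R S]]
     quot_proj_hom[OF R S] pvar_closed[OF R]])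

lemma square_eq: "monoid T \<Longrightarrow> x \<in> carrier T \<Longrightarrow> x [^]\<^bsub>T\<^esub> (2::nat) = x \<otimes>\<^bsub>T\<^esub> x"
  by (simp add: numeral_2_eq_2 monoid.nat_pow_Suc monoid.nat_pow_0 monoid.l_one)

lemma cube_eq: "monoid T \<Longrightarrow> x \<in> carrier T \<Longrightarrow> x [^]\<^bsub>T\<^esub> (3::nat) = x \<otimes>\<^bsub>T\<^esub> x \<otimes>\<^bsub>T\<^esub> x"
  by (simp add: numeral_3_eq_3 monoid.nat_pow_Suc monoid.nat_pow_0 monoid.l_one)

lemma monoid_cring: "cring T \<Longrightarrow> monoid T"
  by (rule ring.is_monoid) (rule cring.axioms(1))

lemma dual_numbers_card:
  assumes R: "cring R" and fin: "finite (carrier R)"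
  shows "finite (carrier (poly_mod_power R 2))"
    and "card (carrier (poly_mod_power R 2)) \<le> card (carrier R) * card (carrier R)"
proof -
  let ?S = "{pvar R [^]\<^bsub>UP R\<^esub> (2::nat)}"
  have S: "?S \<subseteq> carrier (UP R)"
    using UP_pow_closed[OF R] by simp
  interpret R: cring R by fact
  interpret Q: cring "poly_quot R ?S"
    by (rule poly_quot_cring[OF R S])
  have v: "quot_var R ?S \<in> carrier (poly_quot R ?S)"
    by (rule quot_var_closed[OF R S])
  have "quot_var R ?S [^]\<^bsub>poly_quot R ?S\<^esub> (2::nat) = \<zero>\<^bsub>poly_quot R ?S\<^esub>"
    unfolding quot_var_pow[OF R S, symmetric] by (rule quot_proj_zero[OF R S]) simp
  then have rel: "quot_var R ?S \<otimes>\<^bsub>poly_quot R ?S\<^esub> quot_var R ?S = quot_const R ?S \<zero>\<^bsub>R\<^esub> \<oplus>\<^bsub>poly_quot R ?S\<^esub>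
      quot_const R ?S \<zero>\<^bsub>R\<^esub> \<otimes>\<^bsub>poly_quot R ?S\<^esub> quot_var R ?S"
    using v by (simp add: square_eq[OF Q.monoid_axioms v] ring_hom_zero[OF quot_const_hom[OF R S] R.ring_axioms Q.ring_axioms])
  show "finite (carrier (poly_mod_power R 2))"
    "card (carrier (poly_mod_power R 2)) \<le> card (carrier R) * card (carrier R)"
    unfolding poly_mod_power_def
    using poly_quot_quadratic_card[OF R S R.zero_closed R.zero_closed fin rel] .
qed

lemma dual_numbers_isoI:
  assumes R: "cring R" and fin: "finite (carrier R)" and T: "cring T"
    and h: "h \<in> ring_hom R T" and a: "a \<in> carrier T" "a \<otimes>\<^bsub>T\<^esub> a = \<zero>\<^bsub>T\<^esub>"
    and gen: "ring_generated T G" "G \<subseteq> insert a (h ` carrier R)"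
    and card: "card (carrier R) * card (carrier R) \<le> card (carrier T)"
  shows "T \<simeq> poly_mod_power R 2"
  unfolding poly_mod_power_def
proof (rule ring_iso_poly_quotI[OF R _ T h a(1) _ gen])
  fix e s assume e: "e \<in> ring_hom (UP R) T" "e (pvar R) = a" and s: "s \<in> {pvar R [^]\<^bsub>UP R\<^esub> (2::nat)}"
  have "e s = a [^]\<^bsub>T\<^esub> (2::nat)"
    using ring_hom_nat_pow[OF cring.axioms(1)[OF UP_ring_structure[OF R]] cring.axioms(1)[OF T] e(1) pvar_closed[OF R]]
      s e(2) by simp
  then show "e s = \<zero>\<^bsub>T\<^esub>"
    using a square_eq[OF monoid_cring[OF T] a(1)] by simp
qed (use dual_numbers_card[OF R fin] card UP_pow_closed[OF R] in \<open>auto simp: poly_mod_power_def\<close>)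

text \<open>
  The polynomial \<open>x\<^sup>2 + x + 1\<close>, whose roots are the primitive third roots of unity.
\<close>

definition omega_rel :: "('a, 'm) ring_scheme \<Rightarrow> nat \<Rightarrow> 'a" where
  "omega_rel R = pvar R [^]\<^bsub>UP R\<^esub> (2::nat) \<oplus>\<^bsub>UP R\<^esub> pvar R \<oplus>\<^bsub>UP R\<^esub> \<one>\<^bsub>UP R\<^esub>"

lemma F4_eq: "F4 = poly_quot (residue_ring 2) {omega_rel (residue_ring 2)}"
  and Z4_x2_x_1_eq: "Z4_x2_x_1 = poly_quot (residue_ring 4) {omega_rel (residue_ring 4)}"
  by (simp_all add: F4_def Z4_x2_x_1_def omega_rel_def Let_def)

lemma omega_rel_closed:
  assumes R: "cring R" shows "omega_rel R \<in> carrier (UP R)"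
proof -
  interpret P: cring "UP R" by (rule UP_ring_structure[OF R])
  show ?thesis
    unfolding omega_rel_def using pvar_closed[OF R] by simp
qed

lemma hom_omega_rel:
  assumes R: "cring R" and T: "cring T" and e: "e \<in> ring_hom (UP R) T"
  shows "e (omega_rel R) = e (pvar R) \<otimes>\<^bsub>T\<^esub> e (pvar R) \<oplus>\<^bsub>T\<^esub> e (pvar R) \<oplus>\<^bsub>T\<^esub> \<one>\<^bsub>T\<^esub>"
proof -
  interpret P: cring "UP R" by (rule UP_ring_structure[OF R])
  interpret T: cring T by fact
  have v: "pvar R \<in> carrier (UP R)" by (rule pvar_closed[OF R])
  have v2: "pvar R [^]\<^bsub>UP R\<^esub> (2::nat) = pvar R \<otimes>\<^bsub>UP R\<^esub> pvar R"
    by (rule square_eq[OF P.monoid_axioms v])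
  show ?thesis
    unfolding omega_rel_def v2 using v by (simp add: ring_hom_add[OF e] ring_hom_mult[OF e] ring_hom_one[OF e])
qed

lemma omega_quot:
  fixes R :: "('a, 'm) ring_scheme"
  assumes R: "cring R" and fin: "finite (carrier R)"
  defines "Q \<equiv> poly_quot R {omega_rel R}" and "v \<equiv> quot_var R {omega_rel R}"
  shows "cring Q" "v \<in> carrier Q" "v \<otimes>\<^bsub>Q\<^esub> v \<oplus>\<^bsub>Q\<^esub> v \<oplus>\<^bsub>Q\<^esub> \<one>\<^bsub>Q\<^esub> = \<zero>\<^bsub>Q\<^esub>"
    "finite (carrier Q)" "card (carrier Q) \<le> card (carrier R) * card (carrier R)"
proof -
  have S: "{omega_rel R} \<subseteq> carrier (UP R)"
    using omega_rel_closed[OF R] by simp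
  interpret R: cring R by fact
  interpret Q: cring Q
    unfolding Q_def by (rule poly_quot_cring[OF R S])
  show "cring Q" by (rule Q.is_cring)
  show v: "v \<in> carrier Q"
    unfolding Q_def v_def by (rule quot_var_closed[OF R S])
  note pr = quot_proj_hom[OF R S, folded Q_def]
  show zero: "v \<otimes>\<^bsub>Q\<^esub> v \<oplus>\<^bsub>Q\<^esub> v \<oplus>\<^bsub>Q\<^esub> \<one>\<^bsub>Q\<^esub> = \<zero>\<^bsub>Q\<^esub>"
    using hom_omega_rel[OF R Q.is_cring pr] quot_proj_zero[OF R S, of "omega_rel R"]
    unfolding v_def quot_var_def Q_def by simp
  note k = quot_const_hom[OF R S, folded Q_def]
  have m1: "quot_const R {omega_rel R} (\<ominus>\<^bsub>R\<^esub> \<one>\<^bsub>R\<^esub>) = \<ominus>\<^bsub>Q\<^esub> \<one>\<^bsub>Q\<^esub>"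
    using ring_hom_minus[OF R.ring_axioms Q.ring_axioms k R.zero_closed R.one_closed]
      ring_hom_zero[OF k R.ring_axioms Q.ring_axioms] ring_hom_one[OF k] by (simp add: a_minus_def)
  have "v \<otimes>\<^bsub>Q\<^esub> v = (v \<otimes>\<^bsub>Q\<^esub> v \<oplus>\<^bsub>Q\<^esub> v \<oplus>\<^bsub>Q\<^esub> \<one>\<^bsub>Q\<^esub>) \<oplus>\<^bsub>Q\<^esub> (\<ominus>\<^bsub>Q\<^esub> \<one>\<^bsub>Q\<^esub> \<oplus>\<^bsub>Q\<^esub> \<ominus>\<^bsub>Q\<^esub> \<one>\<^bsub>Q\<^esub> \<otimes>\<^bsub>Q\<^esub> v)"
    using v by algebra
  then have rel: "v \<otimes>\<^bsub>Q\<^esub> v = quot_const R {omega_rel R} (\<ominus>\<^bsub>R\<^esub> \<one>\<^bsub>R\<^esub>) \<oplus>\<^bsub>Q\<^esub> quot_const R {omega_rel R} (\<ominus>\<^bsub>R\<^esub> \<one>\<^bsub>R\<^esub>) \<otimes>\<^bsub>Q\<^esub> v"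
    using v unfolding zero m1 by simp
  show "finite (carrier Q)" "card (carrier Q) \<le> card (carrier R) * card (carrier R)"
    using poly_quot_quadratic_card[OF R S _ _ fin rel[unfolded Q_def v_def]] by (simp_all add: Q_def)
qed

lemma omega_isoI:
  assumes R: "cring R" and fin: "finite (carrier R)" and T: "cring T"
    and h: "h \<in> ring_hom R T" and a: "a \<in> carrier T" "a \<otimes>\<^bsub>T\<^esub> a \<oplus>\<^bsub>T\<^esub> a \<oplus>\<^bsub>T\<^esub> \<one>\<^bsub>T\<^esub> = \<zero>\<^bsub>T\<^esub>"
    and gen: "ring_generated T {a}"
    and card: "card (carrier R) * card (carrier R) \<le> card (carrier T)"
  shows "T \<simeq> poly_quot R {omega_rel R}"
proof (rule ring_iso_poly_quotI[OF R _ T h a(1) _ gen])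
  fix e s assume "e \<in> ring_hom (UP R) T" "e (pvar R) = a" "s \<in> {omega_rel R}"
  then show "e s = \<zero>\<^bsub>T\<^esub>"
    using hom_omega_rel[OF R T] a(2) by auto
qed (use omega_rel_closed[OF R] omega_quot[OF R fin] card in auto)

text \<open>
  The coefficient ring is itself a quotient, so evaluation is done twice: at \<open>w\<close> over \<open>\<int>/2\<close>, to map the field
  with four elements into \<open>T\<close>, and then at \<open>a\<close>.
\<close>

lemma F4_dual_isoI:
  assumes T: "cring T" and char: "cring.int_elem T 2 = \<zero>\<^bsub>T\<^esub>"
    and w: "w \<in> carrier T" "w \<otimes>\<^bsub>T\<^esub> w \<oplus>\<^bsub>T\<^esub> w \<oplus>\<^bsub>T\<^esub> \<one>\<^bsub>T\<^esub> = \<zero>\<^bsub>T\<^esub>"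
    and a: "a \<in> carrier T" "a \<otimes>\<^bsub>T\<^esub> a = \<zero>\<^bsub>T\<^esub>"
    and gen: "ring_generated T {a, w}" and card: "16 \<le> card (carrier T)"
  shows "T \<simeq> poly_mod_power F4 2"
proof -
  interpret T: cring T by fact
  let ?R = "residue_ring 2"
  have R: "cring ?R" by (rule residue_ring_cring) simp
  note om = omega_quot[OF R residue_ring_card(1), folded F4_eq]
  have S: "{omega_rel ?R} \<subseteq> carrier (UP ?R)"
    using omega_rel_closed[OF R] by simp
  obtain e where e: "e \<in> ring_hom (UP ?R) T" "\<And>c. c \<in> carrier ?R \<Longrightarrow> e (pconst ?R c) = T.int_elem c" "e (pvar ?R) = w"
    by (rule UP_eval[OF R T T.residue_ring_hom[OF char] w(1)]) (rule that)
  have "e s = \<zero>\<^bsub>T\<^esub>" if "s \<in> {omega_rel ?R}" for s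
    using that hom_omega_rel[OF R T e(1)] e(3) w(2) by simp
  then have "\<exists>f\<in>ring_hom F4 T. \<forall>p\<in>carrier (UP ?R). f (quot_proj ?R {omega_rel ?R} p) = e p"
    unfolding F4_eq by (rule poly_quot_lift[OF R S T.ring_axioms e(1)])
  then obtain f where f: "f \<in> ring_hom F4 T" "\<forall>p\<in>carrier (UP ?R). f (quot_proj ?R {omega_rel ?R} p) = e p"
    by (elim bexE)
  have "f (quot_var ?R {omega_rel ?R}) = w"
    using f(2) pvar_closed[OF R] e(3) by (simp add: quot_var_def)
  then have wf: "w \<in> f ` carrier F4"
    using om(2) by blast
  have F4c: "card (carrier F4) \<le> 4"
    using om(5) by (simp add: residue_ring_card)
  show ?thesis
  proof (rule dual_numbers_isoI[OF om(1,4) T f(1) a gen])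
    show "{a, w} \<subseteq> insert a (f ` carrier F4)"
      using wf by simp
    show "card (carrier F4) * card (carrier F4) \<le> card (carrier T)"
      using mult_le_mono[OF F4c F4c] card by simp
  qed
qed

text \<open>
  Since 2 kills the variable, its coefficient matters only modulo 2. This leaves \<open>4 \<cdot> 2\<close> elements.
\<close>

lemma Z4_quot_card:
  fixes S :: "(nat \<Rightarrow> int) set"
  defines "R \<equiv> residue_ring 4" and "Q \<equiv> poly_quot (residue_ring 4) S" and "v \<equiv> quot_var (residue_ring 4) S" and "k \<equiv> quot_const (residue_ring 4) S"
  assumes S: "S \<subseteq> carrier (UP R)" and ab: "\<alpha> \<in> carrier R"
    and rel: "v \<otimes>\<^bsub>Q\<^esub> v = k \<alpha>" and two: "k 2 \<otimes>\<^bsub>Q\<^esub> v = \<zero>\<^bsub>Q\<^esub>"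
  shows "finite (carrier Q)" "card (carrier Q) \<le> 8"
proof -
  have R: "cring R" unfolding R_def by (rule residue_ring_cring) simp
  interpret R: cring R by fact
  interpret Q: cring Q
    using poly_quot_cring[OF R S] unfolding Q_def R_def .
  have kh: "k \<in> ring_hom R Q"
    using quot_const_hom[OF R S] unfolding k_def Q_def R_def .
  have v: "v \<in> carrier Q"
    using quot_var_closed[OF R S] unfolding v_def Q_def R_def .
  have R_simps: "carrier R = {0, 1, 2, 3}" "\<zero>\<^bsub>R\<^esub> = 0" "\<one>\<^bsub>R\<^esub> = 1" "2 \<oplus>\<^bsub>R\<^esub> 1 = 3"
    unfolding R_def residue_ring_def by auto
  have k0: "k 0 = \<zero>\<^bsub>Q\<^esub>"
    using ring_hom_zero[OF kh R.ring_axioms Q.ring_axioms] by (simp add: R_simps)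
  have k1: "k 1 = \<one>\<^bsub>Q\<^esub>"
    using ring_hom_one[OF kh] by (simp add: R_simps)
  have k2: "k 2 \<in> carrier Q"
    using ring_hom_closed[OF kh] by (simp add: R_simps)
  have k3: "k 3 = k 2 \<oplus>\<^bsub>Q\<^esub> \<one>\<^bsub>Q\<^esub>"
    using ring_hom_add[OF kh, of 2 1] by (simp add: R_simps k1)
  have dv: "k d \<otimes>\<^bsub>Q\<^esub> v = k (d mod 2) \<otimes>\<^bsub>Q\<^esub> v" if "d \<in> carrier R" for d
  proof -
    have "k 3 \<otimes>\<^bsub>Q\<^esub> v = v"
      unfolding k3 using v k2 two by (simp add: Q.l_distr)
    moreover have "d = 0 \<or> d = 1 \<or> d = 2 \<or> d = 3"
      using that unfolding R_simps by simp
    ultimately show ?thesis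
      using v two k0 k1 by (elim disjE) simp_all
  qed
  have rel': "v \<otimes>\<^bsub>Q\<^esub> v = k \<alpha> \<oplus>\<^bsub>Q\<^esub> k 0 \<otimes>\<^bsub>Q\<^esub> v"
    using rel v ring_hom_closed[OF kh ab] by (simp add: k0)
  have "carrier Q \<subseteq> (\<lambda>(c, d). k c \<oplus>\<^bsub>Q\<^esub> k d \<otimes>\<^bsub>Q\<^esub> v) ` (carrier R \<times> carrier R)"
    using poly_quot_quadratic[OF R S ab, of 0] rel' unfolding R_def Q_def v_def k_def R_simps
    by (simp add: residue_ring_def)
  also have "\<dots> \<subseteq> (\<lambda>(c, d). k c \<oplus>\<^bsub>Q\<^esub> k d \<otimes>\<^bsub>Q\<^esub> v) ` (carrier R \<times> {0, 1})"
  proof (rule image_subsetI)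
    fix x assume "x \<in> carrier R \<times> carrier R"
    then obtain c d where x: "x = (c, d)" "c \<in> carrier R" "d \<in> carrier R"
      by auto
    have "d mod 2 \<in> {0, 1}"
      by auto
    then show "(\<lambda>(c, d). k c \<oplus>\<^bsub>Q\<^esub> k d \<otimes>\<^bsub>Q\<^esub> v) x \<in> (\<lambda>(c, d). k c \<oplus>\<^bsub>Q\<^esub> k d \<otimes>\<^bsub>Q\<^esub> v) ` (carrier R \<times> {0, 1})"
      using x dv[OF x(3)] by (intro image_eqI[of _ _ "(c, d mod 2)"]) simp_all
  qed
  finally have sub: "carrier Q \<subseteq> (\<lambda>(c, d). k c \<oplus>\<^bsub>Q\<^esub> k d \<otimes>\<^bsub>Q\<^esub> v) ` (carrier R \<times> {0, 1})" .
  have fin: "finite (carrier R \<times> {0, 1::int})" and eight: "card (carrier R \<times> {0, 1::int}) = 8"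
    unfolding R_simps by (simp_all add: card_cartesian_product)
  show "finite (carrier Q)"
    using finite_subset[OF sub] fin by blast
  show "card (carrier Q) \<le> 8"
    using surj_card_le[OF fin sub] eight by simp
qed

lemma Z4_x3_x2m2_eq: "Z4_x3_x2m2 = poly_quot (residue_ring 4) {pvar (residue_ring 4) [^]\<^bsub>UP (residue_ring 4)\<^esub> (3::nat),
    pvar (residue_ring 4) [^]\<^bsub>UP (residue_ring 4)\<^esub> (2::nat) \<ominus>\<^bsub>UP (residue_ring 4)\<^esub> pconst (residue_ring 4) 2}"
  by (simp add: Z4_x3_x2m2_def Let_def)

lemma Z4_2x_x2_eq: "Z4_2x_x2 = poly_quot (residue_ring 4) {pconst (residue_ring 4) 2 \<otimes>\<^bsub>UP (residue_ring 4)\<^esub> pvar (residue_ring 4),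
    pvar (residue_ring 4) [^]\<^bsub>UP (residue_ring 4)\<^esub> (2::nat)}"
  by (simp add: Z4_2x_x2_def Let_def)

lemma Z4_x3_x2m2_card: "finite (carrier Z4_x3_x2m2)" "card (carrier Z4_x3_x2m2) \<le> 8"
  and Z4_x3_x2m2_isoI: "\<And>T :: ('b, 'n) ring_scheme. cring T \<Longrightarrow> cring.int_elem T 4 = \<zero>\<^bsub>T\<^esub> \<Longrightarrow> a \<in> carrier T \<Longrightarrow>
      a \<otimes>\<^bsub>T\<^esub> a = cring.int_elem T 2 \<Longrightarrow> a \<otimes>\<^bsub>T\<^esub> a \<otimes>\<^bsub>T\<^esub> a = \<zero>\<^bsub>T\<^esub> \<Longrightarrow>
      ring_generated T {a} \<Longrightarrow> 8 \<le> card (carrier T) \<Longrightarrow> T \<simeq> Z4_x3_x2m2"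
proof -
  let ?R = "residue_ring 4"
  let ?S = "{pvar ?R [^]\<^bsub>UP ?R\<^esub> (3::nat), pvar ?R [^]\<^bsub>UP ?R\<^esub> (2::nat) \<ominus>\<^bsub>UP ?R\<^esub> pconst ?R 2}"
  have R: "cring ?R" by (rule residue_ring_cring) simp
  have two: "2 \<in> carrier ?R" by (simp add: residue_ring_def)
  interpret P: cring "UP ?R" by (rule UP_ring_structure[OF R])
  note pc = pvar_closed[OF R] pconst_closed[OF R two]
  have S: "?S \<subseteq> carrier (UP ?R)"
    using pc by simp
  have ev: "e (pvar ?R [^]\<^bsub>UP ?R\<^esub> (3::nat)) = e (pvar ?R) \<otimes>\<^bsub>T\<^esub> e (pvar ?R) \<otimes>\<^bsub>T\<^esub> e (pvar ?R)"
      "e (pvar ?R [^]\<^bsub>UP ?R\<^esub> (2::nat) \<ominus>\<^bsub>UP ?R\<^esub> pconst ?R 2) = e (pvar ?R) \<otimes>\<^bsub>T\<^esub> e (pvar ?R) \<ominus>\<^bsub>T\<^esub> e (pconst ?R 2)"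
    if T: "cring T" and e: "e \<in> ring_hom (UP ?R) T" for T :: "('c, 'o) ring_scheme" and e
    unfolding square_eq[OF P.monoid_axioms pc(1)] cube_eq[OF P.monoid_axioms pc(1)]
    using pc by (simp_all add: ring_hom_minus[OF P.ring_axioms cring.axioms(1)[OF T] e] ring_hom_mult[OF e])
  interpret Q: cring "poly_quot ?R ?S"
    by (rule poly_quot_cring[OF R S])
  note evQ = ev[OF Q.is_cring quot_proj_hom[OF R S]]
  have v: "quot_var ?R ?S \<in> carrier (poly_quot ?R ?S)"
    by (rule quot_var_closed[OF R S])
  have k2: "quot_const ?R ?S 2 \<in> carrier (poly_quot ?R ?S)"
    by (rule ring_hom_closed[OF quot_const_hom[OF R S] two])
  have "quot_var ?R ?S \<otimes>\<^bsub>poly_quot ?R ?S\<^esub> quot_var ?R ?S \<ominus>\<^bsub>poly_quot ?R ?S\<^esub> quot_const ?R ?S 2 = \<zero>\<^bsub>poly_quot ?R ?S\<^esub>"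
    unfolding quot_var_def quot_const_def evQ(2)[symmetric] by (rule quot_proj_zero[OF R S]) simp
  then have rel: "quot_var ?R ?S \<otimes>\<^bsub>poly_quot ?R ?S\<^esub> quot_var ?R ?S = quot_const ?R ?S 2"
    using v k2 by (simp add: Q.r_right_minus_eq)
  have "quot_const ?R ?S 2 \<otimes>\<^bsub>poly_quot ?R ?S\<^esub> quot_var ?R ?S = \<zero>\<^bsub>poly_quot ?R ?S\<^esub>"
    unfolding rel[symmetric] unfolding quot_var_def evQ(1)[symmetric] by (rule quot_proj_zero[OF R S]) simp
  note card = Z4_quot_card[OF S two rel this]
  then show "finite (carrier Z4_x3_x2m2)" "card (carrier Z4_x3_x2m2) \<le> 8"
    by (simp_all add: Z4_x3_x2m2_eq)
  fix T :: "('b, 'n) ring_scheme"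
  assume T: "cring T" and char: "cring.int_elem T 4 = \<zero>\<^bsub>T\<^esub>" and a: "a \<in> carrier T"
    "a \<otimes>\<^bsub>T\<^esub> a = cring.int_elem T 2" "a \<otimes>\<^bsub>T\<^esub> a \<otimes>\<^bsub>T\<^esub> a = \<zero>\<^bsub>T\<^esub>"
    and gen: "ring_generated T {a}" and big: "8 \<le> card (carrier T)"
  interpret T: cring T by fact
  show "T \<simeq> Z4_x3_x2m2"
    unfolding Z4_x3_x2m2_eq
  proof (rule ring_iso_poly_quotI[OF R S T T.residue_ring_hom[OF char] a(1) _ gen _ card(1)])
    fix e s assume e: "e \<in> ring_hom (UP ?R) T" and ec: "\<And>c. c \<in> carrier ?R \<Longrightarrow> e (pconst ?R c) = T.int_elem c"
      and ea: "e (pvar ?R) = a" and s: "s \<in> ?S"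
    show "e s = \<zero>\<^bsub>T\<^esub>"
      using s ev[OF T e] ec[OF two] ea a by (auto simp: T.r_right_minus_eq)
  qed (use card big in auto)
qed

lemma Z4_2x_x2_card: "finite (carrier Z4_2x_x2)" "card (carrier Z4_2x_x2) \<le> 8"
  and Z4_2x_x2_isoI: "\<And>T :: ('b, 'n) ring_scheme. cring T \<Longrightarrow> cring.int_elem T 4 = \<zero>\<^bsub>T\<^esub> \<Longrightarrow> a \<in> carrier T \<Longrightarrow>
      cring.int_elem T 2 \<otimes>\<^bsub>T\<^esub> a = \<zero>\<^bsub>T\<^esub> \<Longrightarrow> a \<otimes>\<^bsub>T\<^esub> a = \<zero>\<^bsub>T\<^esub> \<Longrightarrow>
      ring_generated T {a} \<Longrightarrow> 8 \<le> card (carrier T) \<Longrightarrow> T \<simeq> Z4_2x_x2"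
proof -
  let ?R = "residue_ring 4"
  let ?S = "{pconst ?R 2 \<otimes>\<^bsub>UP ?R\<^esub> pvar ?R, pvar ?R [^]\<^bsub>UP ?R\<^esub> (2::nat)}"
  have R: "cring ?R" by (rule residue_ring_cring) simp
  have two: "2 \<in> carrier ?R" and zero: "0 \<in> carrier ?R" by (simp_all add: residue_ring_def)
  interpret R: cring ?R by fact
  interpret P: cring "UP ?R" by (rule UP_ring_structure[OF R])
  note pc = pvar_closed[OF R] pconst_closed[OF R two]
  have S: "?S \<subseteq> carrier (UP ?R)"
    using pc by simp
  have ev: "e (pconst ?R 2 \<otimes>\<^bsub>UP ?R\<^esub> pvar ?R) = e (pconst ?R 2) \<otimes>\<^bsub>T\<^esub> e (pvar ?R)"
      "e (pvar ?R [^]\<^bsub>UP ?R\<^esub> (2::nat)) = e (pvar ?R) \<otimes>\<^bsub>T\<^esub> e (pvar ?R)"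
    if T: "cring T" and e: "e \<in> ring_hom (UP ?R) T" for T :: "('c, 'o) ring_scheme" and e
    unfolding square_eq[OF P.monoid_axioms pc(1)] using pc by (simp_all add: ring_hom_mult[OF e])
  interpret Q: cring "poly_quot ?R ?S"
    by (rule poly_quot_cring[OF R S])
  note evQ = ev[OF Q.is_cring quot_proj_hom[OF R S]]
  have "quot_const ?R ?S 0 = \<zero>\<^bsub>poly_quot ?R ?S\<^esub>"
    using ring_hom_zero[OF quot_const_hom[OF R S] R.ring_axioms Q.ring_axioms] by (simp add: residue_ring_def)
  moreover have "quot_var ?R ?S \<otimes>\<^bsub>poly_quot ?R ?S\<^esub> quot_var ?R ?S = \<zero>\<^bsub>poly_quot ?R ?S\<^esub>"
    unfolding quot_var_def evQ(2)[symmetric] by (rule quot_proj_zero[OF R S]) simp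
  ultimately have rel: "quot_var ?R ?S \<otimes>\<^bsub>poly_quot ?R ?S\<^esub> quot_var ?R ?S = quot_const ?R ?S 0"
    by simp
  have "quot_const ?R ?S 2 \<otimes>\<^bsub>poly_quot ?R ?S\<^esub> quot_var ?R ?S = \<zero>\<^bsub>poly_quot ?R ?S\<^esub>"
    unfolding quot_var_def quot_const_def evQ(1)[symmetric] by (rule quot_proj_zero[OF R S]) simp
  note card = Z4_quot_card[OF S zero rel this]
  then show "finite (carrier Z4_2x_x2)" "card (carrier Z4_2x_x2) \<le> 8"
    by (simp_all add: Z4_2x_x2_eq)
  fix T :: "('b, 'n) ring_scheme"
  assume T: "cring T" and char: "cring.int_elem T 4 = \<zero>\<^bsub>T\<^esub>" and a: "a \<in> carrier T"
    "cring.int_elem T 2 \<otimes>\<^bsub>T\<^esub> a = \<zero>\<^bsub>T\<^esub>" "a \<otimes>\<^bsub>T\<^esub> a = \<zero>\<^bsub>T\<^esub>"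
    and gen: "ring_generated T {a}" and big: "8 \<le> card (carrier T)"
  interpret T: cring T by fact
  show "T \<simeq> Z4_2x_x2"
    unfolding Z4_2x_x2_eq
  proof (rule ring_iso_poly_quotI[OF R S T T.residue_ring_hom[OF char] a(1) _ gen _ card(1)])
    fix e s assume e: "e \<in> ring_hom (UP ?R) T" and ec: "\<And>c. c \<in> carrier ?R \<Longrightarrow> e (pconst ?R c) = T.int_elem c"
      and ea: "e (pvar ?R) = a" and s: "s \<in> ?S"
    show "e s = \<zero>\<^bsub>T\<^esub>"
      using s ev[OF T e] ec[OF two] ea a by auto
  qed (use card big in auto)
qed

text \<open>
  The \<open>R\<close>-submodule of \<open>Q\<close> spanned by 1, \<open>u\<close> and \<open>w\<close>, where \<open>R\<close> acts through \<open>k\<close>.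
\<close>

definition span3 :: "('a, 'm) ring_scheme \<Rightarrow> ('b, 'n) ring_scheme \<Rightarrow> ('a \<Rightarrow> 'b) \<Rightarrow> 'b \<Rightarrow> 'b \<Rightarrow> 'b set" where
  "span3 R Q k u w = (\<lambda>(c, d, e). k c \<oplus>\<^bsub>Q\<^esub> k d \<otimes>\<^bsub>Q\<^esub> u \<oplus>\<^bsub>Q\<^esub> k e \<otimes>\<^bsub>Q\<^esub> w) ` (carrier R \<times> carrier R \<times> carrier R)"

lemma span3_finite:
  assumes "finite (carrier R)"
  shows "finite (span3 R Q k u w)" "card (span3 R Q k u w) \<le> card (carrier R) ^ 3"
  unfolding span3_def using assms card_image_le[of "carrier R \<times> carrier R \<times> carrier R"]
  by (simp_all add: card_cartesian_product power3_eq_cube mult.assoc)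

context
  fixes R :: "('a, 'm) ring_scheme" and Q :: "('b, 'n) ring_scheme" and k u w
  assumes R: "cring R" and Q: "cring Q" and k: "k \<in> ring_hom R Q"
    and u: "u \<in> carrier Q" and w: "w \<in> carrier Q"
begin

interpretation R: cring R by (rule R)
interpretation Q: cring Q by (rule Q)

lemma span3_mem:
  "c \<in> carrier R \<Longrightarrow> d \<in> carrier R \<Longrightarrow> e \<in> carrier R \<Longrightarrow>
    k c \<oplus>\<^bsub>Q\<^esub> k d \<otimes>\<^bsub>Q\<^esub> u \<oplus>\<^bsub>Q\<^esub> k e \<otimes>\<^bsub>Q\<^esub> w \<in> span3 R Q k u w"
  unfolding span3_def by (intro image_eqI[of _ _ "(c, d, e)"]) simp_all

lemma span3E:
  assumes "x \<in> span3 R Q k u w"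
  obtains c d e where "c \<in> carrier R" "d \<in> carrier R" "e \<in> carrier R"
    "x = k c \<oplus>\<^bsub>Q\<^esub> k d \<otimes>\<^bsub>Q\<^esub> u \<oplus>\<^bsub>Q\<^esub> k e \<otimes>\<^bsub>Q\<^esub> w"
  using assms unfolding span3_def by auto

lemma span3_const: "c \<in> carrier R \<Longrightarrow> k c \<in> span3 R Q k u w"
  and span3_fst: "d \<in> carrier R \<Longrightarrow> k d \<otimes>\<^bsub>Q\<^esub> u \<in> span3 R Q k u w"
  and span3_snd: "e \<in> carrier R \<Longrightarrow> k e \<otimes>\<^bsub>Q\<^esub> w \<in> span3 R Q k u w"
  using span3_mem[of c "\<zero>\<^bsub>R\<^esub>" "\<zero>\<^bsub>R\<^esub>"] span3_mem[of "\<zero>\<^bsub>R\<^esub>" d "\<zero>\<^bsub>R\<^esub>"] span3_mem[of "\<zero>\<^bsub>R\<^esub>" "\<zero>\<^bsub>R\<^esub>" e]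
    ring_hom_zero[OF k R.ring_axioms Q.ring_axioms] ring_hom_closed[OF k] u w by simp_all

lemma span3_add:
  assumes "x \<in> span3 R Q k u w" "y \<in> span3 R Q k u w"
  shows "x \<oplus>\<^bsub>Q\<^esub> y \<in> span3 R Q k u w"
proof -
  obtain c d e where x: "c \<in> carrier R" "d \<in> carrier R" "e \<in> carrier R"
      "x = k c \<oplus>\<^bsub>Q\<^esub> k d \<otimes>\<^bsub>Q\<^esub> u \<oplus>\<^bsub>Q\<^esub> k e \<otimes>\<^bsub>Q\<^esub> w"
    using assms(1) by (rule span3E)
  obtain c' d' e' where y: "c' \<in> carrier R" "d' \<in> carrier R" "e' \<in> carrier R"
      "y = k c' \<oplus>\<^bsub>Q\<^esub> k d' \<otimes>\<^bsub>Q\<^esub> u \<oplus>\<^bsub>Q\<^esub> k e' \<otimes>\<^bsub>Q\<^esub> w"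
    using assms(2) by (rule span3E)
  note kc = ring_hom_closed[OF k]
  have "x \<oplus>\<^bsub>Q\<^esub> y = (k c \<oplus>\<^bsub>Q\<^esub> k c') \<oplus>\<^bsub>Q\<^esub> (k d \<oplus>\<^bsub>Q\<^esub> k d') \<otimes>\<^bsub>Q\<^esub> u \<oplus>\<^bsub>Q\<^esub> (k e \<oplus>\<^bsub>Q\<^esub> k e') \<otimes>\<^bsub>Q\<^esub> w"
    unfolding x(4) y(4) using kc[OF x(1)] kc[OF x(2)] kc[OF x(3)] kc[OF y(1)] kc[OF y(2)] kc[OF y(3)] u w by algebra
  also have "\<dots> \<in> span3 R Q k u w"
    using span3_mem[of "c \<oplus>\<^bsub>R\<^esub> c'" "d \<oplus>\<^bsub>R\<^esub> d'" "e \<oplus>\<^bsub>R\<^esub> e'"] x(1-3) y(1-3) by (simp add: ring_hom_add[OF k])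
  finally show ?thesis .
qed

lemma span3_mult:
  assumes x: "x \<in> span3 R Q k u w" and y: "y \<in> carrier Q"
    and basis: "\<And>c. c \<in> carrier R \<Longrightarrow> k c \<otimes>\<^bsub>Q\<^esub> y \<in> span3 R Q k u w"
      "\<And>d. d \<in> carrier R \<Longrightarrow> k d \<otimes>\<^bsub>Q\<^esub> (y \<otimes>\<^bsub>Q\<^esub> u) \<in> span3 R Q k u w"
      "\<And>e. e \<in> carrier R \<Longrightarrow> k e \<otimes>\<^bsub>Q\<^esub> (y \<otimes>\<^bsub>Q\<^esub> w) \<in> span3 R Q k u w"
  shows "y \<otimes>\<^bsub>Q\<^esub> x \<in> span3 R Q k u w"
proof -
  obtain c d e where x: "c \<in> carrier R" "d \<in> carrier R" "e \<in> carrier R"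
      "x = k c \<oplus>\<^bsub>Q\<^esub> k d \<otimes>\<^bsub>Q\<^esub> u \<oplus>\<^bsub>Q\<^esub> k e \<otimes>\<^bsub>Q\<^esub> w"
    using x by (rule span3E)
  note kc = ring_hom_closed[OF k]
  have "y \<otimes>\<^bsub>Q\<^esub> x = k c \<otimes>\<^bsub>Q\<^esub> y \<oplus>\<^bsub>Q\<^esub> k d \<otimes>\<^bsub>Q\<^esub> (y \<otimes>\<^bsub>Q\<^esub> u) \<oplus>\<^bsub>Q\<^esub> k e \<otimes>\<^bsub>Q\<^esub> (y \<otimes>\<^bsub>Q\<^esub> w)"
    unfolding x(4) using kc[OF x(1)] kc[OF x(2)] kc[OF x(3)] u w y by algebra
  also have "\<dots> \<in> span3 R Q k u w"
    by (intro span3_add basis x)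
  finally show ?thesis .
qed

lemma span3_zero: "\<zero>\<^bsub>Q\<^esub> \<in> span3 R Q k u w"
  using span3_const[OF R.zero_closed] ring_hom_zero[OF k R.ring_axioms Q.ring_axioms] by simp

end

lemma cubic_card:
  assumes R: "cring R" and fin: "finite (carrier R)"
  shows "finite (carrier (poly_mod_power R 3))" "card (carrier (poly_mod_power R 3)) \<le> card (carrier R) ^ 3"
proof -
  let ?S = "{pvar R [^]\<^bsub>UP R\<^esub> (3::nat)}"
  have S: "?S \<subseteq> carrier (UP R)"
    using UP_pow_closed[OF R] by simp
  interpret Q: cring "poly_quot R ?S"
    by (rule poly_quot_cring[OF R S])
  let ?Q = "poly_quot R ?S" and ?v = "quot_var R ?S" and ?k = "quot_const R ?S"
  have v: "?v \<in> carrier ?Q"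
    by (rule quot_var_closed[OF R S])
  note k = quot_const_hom[OF R S]
  note sp = R Q.is_cring k v Q.m_closed[OF v v]
  have "?v [^]\<^bsub>?Q\<^esub> (3::nat) = \<zero>\<^bsub>?Q\<^esub>"
    unfolding quot_var_pow[OF R S, symmetric] by (rule quot_proj_zero[OF R S]) simp
  then have v3: "?v \<otimes>\<^bsub>?Q\<^esub> (?v \<otimes>\<^bsub>?Q\<^esub> ?v) = \<zero>\<^bsub>?Q\<^esub>"
    using v by (simp add: cube_eq[OF Q.monoid_axioms v] Q.m_assoc)
  have sub: "carrier ?Q \<subseteq> span3 R ?Q ?k ?v (?v \<otimes>\<^bsub>?Q\<^esub> ?v)"
  proof
    fix z assume "z \<in> carrier ?Q"
    then show "z \<in> span3 R ?Q ?k ?v (?v \<otimes>\<^bsub>?Q\<^esub> ?v)"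
    proof (rule poly_quot_induct[OF R S])
      show "quot_proj R ?S (pconst R c) \<in> span3 R ?Q ?k ?v (?v \<otimes>\<^bsub>?Q\<^esub> ?v)" if "c \<in> carrier R" for c
        unfolding quot_const_def[symmetric] by (rule span3_const[OF sp that])
      fix x assume x: "x \<in> span3 R ?Q ?k ?v (?v \<otimes>\<^bsub>?Q\<^esub> ?v)"
      show "quot_proj R ?S (pvar R) \<otimes>\<^bsub>?Q\<^esub> x \<in> span3 R ?Q ?k ?v (?v \<otimes>\<^bsub>?Q\<^esub> ?v)"
        unfolding quot_var_def[symmetric]
      proof (rule span3_mult[OF sp x v])
        show "?k e \<otimes>\<^bsub>?Q\<^esub> (?v \<otimes>\<^bsub>?Q\<^esub> (?v \<otimes>\<^bsub>?Q\<^esub> ?v)) \<in> span3 R ?Q ?k ?v (?v \<otimes>\<^bsub>?Q\<^esub> ?v)" if "e \<in> carrier R" for e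
          using span3_zero[OF sp] ring_hom_closed[OF k that] by (simp add: v3)
      qed (rule span3_fst[OF sp] span3_snd[OF sp], assumption)+
      fix y assume "y \<in> span3 R ?Q ?k ?v (?v \<otimes>\<^bsub>?Q\<^esub> ?v)"
      then show "x \<oplus>\<^bsub>?Q\<^esub> y \<in> span3 R ?Q ?k ?v (?v \<otimes>\<^bsub>?Q\<^esub> ?v)"
        by (rule span3_add[OF sp x])
    qed
  qed
  show "finite (carrier (poly_mod_power R 3))" "card (carrier (poly_mod_power R 3)) \<le> card (carrier R) ^ 3"
    unfolding poly_mod_power_def
    using finite_subset[OF sub span3_finite(1)[OF fin]] card_mono[OF span3_finite(1)[OF fin] sub]
      span3_finite(2)[OF fin, of ?Q ?k ?v "?v \<otimes>\<^bsub>?Q\<^esub> ?v"] by simp_all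
qed

lemma cubic_isoI:
  assumes R: "cring R" and fin: "finite (carrier R)" and T: "cring T"
    and h: "h \<in> ring_hom R T" and a: "a \<in> carrier T" "a \<otimes>\<^bsub>T\<^esub> a \<otimes>\<^bsub>T\<^esub> a = \<zero>\<^bsub>T\<^esub>"
    and gen: "ring_generated T {a}"
    and card: "card (carrier R) ^ 3 \<le> card (carrier T)"
  shows "T \<simeq> poly_mod_power R 3"
  unfolding poly_mod_power_def
proof (rule ring_iso_poly_quotI[OF R _ T h a(1) _ gen])
  fix e s assume e: "e \<in> ring_hom (UP R) T" "e (pvar R) = a" and s: "s \<in> {pvar R [^]\<^bsub>UP R\<^esub> (3::nat)}"
  have "e s = a [^]\<^bsub>T\<^esub> (3::nat)"
    using ring_hom_nat_pow[OF cring.axioms(1)[OF UP_ring_structure[OF R]] cring.axioms(1)[OF T] e(1) pvar_closed[OF R]]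
      s e(2) by simp
  then show "e s = \<zero>\<^bsub>T\<^esub>"
    using a cube_eq[OF monoid_cring[OF T] a(1)] by simp
qed (use cubic_card[OF R fin] card UP_pow_closed[OF R] in \<open>auto simp: poly_mod_power_def\<close>)

lemma Z2_xy_eq: "Z2_xy_x2_xy_y2 = (let P = UP (residue_ring 2); x = pconst P (pvar (residue_ring 2)); y = pvar P in
     poly_quot P {x [^]\<^bsub>UP P\<^esub> (2::nat), x \<otimes>\<^bsub>UP P\<^esub> y, y [^]\<^bsub>UP P\<^esub> (2::nat)})"
  by (simp add: Z2_xy_x2_xy_y2_def Let_def)

lemma Z2_xy_card: "finite (carrier Z2_xy_x2_xy_y2)" "card (carrier Z2_xy_x2_xy_y2) \<le> 8"
  and Z2_xy_isoI: "\<And>T :: ('b, 'n) ring_scheme. cring T \<Longrightarrow> cring.int_elem T 2 = \<zero>\<^bsub>T\<^esub> \<Longrightarrow> a \<in> carrier T \<Longrightarrow> b \<in> carrier T \<Longrightarrow>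
      a \<otimes>\<^bsub>T\<^esub> a = \<zero>\<^bsub>T\<^esub> \<Longrightarrow> a \<otimes>\<^bsub>T\<^esub> b = \<zero>\<^bsub>T\<^esub> \<Longrightarrow> b \<otimes>\<^bsub>T\<^esub> b = \<zero>\<^bsub>T\<^esub> \<Longrightarrow>
      ring_generated T {b, a} \<Longrightarrow> 8 \<le> card (carrier T) \<Longrightarrow> T \<simeq> Z2_xy_x2_xy_y2"
proof -
  let ?R = "residue_ring 2"
  have R: "cring ?R" by (rule residue_ring_cring) simp
  define P where "P = UP ?R"
  have P: "cring P" unfolding P_def by (rule UP_ring_structure[OF R])
  define x where "x = pconst P (pvar ?R)"
  define y where "y = pvar P"
  define S where "S = {x [^]\<^bsub>UP P\<^esub> (2::nat), x \<otimes>\<^bsub>UP P\<^esub> y, y [^]\<^bsub>UP P\<^esub> (2::nat)}"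
  define Q where "Q = poly_quot P S"
  have Q_eq: "Z2_xy_x2_xy_y2 = Q"
    by (simp add: Z2_xy_eq Let_def Q_def S_def x_def y_def P_def)
  interpret U: cring "UP P" by (rule UP_ring_structure[OF P])
  have xR: "pvar ?R \<in> carrier P"
    unfolding P_def by (rule pvar_closed[OF R])
  have x: "x \<in> carrier (UP P)" and y: "y \<in> carrier (UP P)"
    unfolding x_def y_def using pconst_closed[OF P xR] pvar_closed[OF P] by simp_all
  have S: "S \<subseteq> carrier (UP P)"
    unfolding S_def using x y by simp
  have ev: "e (x [^]\<^bsub>UP P\<^esub> (2::nat)) = e x \<otimes>\<^bsub>T\<^esub> e x" "e (x \<otimes>\<^bsub>UP P\<^esub> y) = e x \<otimes>\<^bsub>T\<^esub> e y"
    "e (y [^]\<^bsub>UP P\<^esub> (2::nat)) = e y \<otimes>\<^bsub>T\<^esub> e y"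
    if e: "e \<in> ring_hom (UP P) T" for T :: "('c, 'o) ring_scheme" and e
    unfolding square_eq[OF U.monoid_axioms x] square_eq[OF U.monoid_axioms y] using x y by (simp_all add: ring_hom_mult[OF e])
  interpret Q: cring Q
    unfolding Q_def by (rule poly_quot_cring[OF P S])
  note pr = quot_proj_hom[OF P S, folded Q_def]
  define \<xi> where "\<xi> = quot_const P S (pvar ?R)"
  define \<eta> where "\<eta> = quot_var P S"
  define k where "k c = quot_const P S (pconst ?R c)" for c
  have \<xi>: "\<xi> \<in> carrier Q" and \<eta>: "\<eta> \<in> carrier Q"
    unfolding \<xi>_def \<eta>_def Q_def using ring_hom_closed[OF quot_const_hom[OF P S] xR] quot_var_closed[OF P S] by simp_all
  have k: "k \<in> ring_hom ?R Q"
    using ring_hom_trans[OF pconst_hom[OF R, folded P_def] quot_const_hom[OF P S]]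
    unfolding k_def[abs_def] Q_def comp_def .
  have zero: "quot_proj P S s = \<zero>\<^bsub>Q\<^esub>" if "s \<in> S" for s
    unfolding Q_def by (rule quot_proj_zero[OF P S that])
  have XY: "\<xi> \<otimes>\<^bsub>Q\<^esub> \<xi> = \<zero>\<^bsub>Q\<^esub>" "\<xi> \<otimes>\<^bsub>Q\<^esub> \<eta> = \<zero>\<^bsub>Q\<^esub>" "\<eta> \<otimes>\<^bsub>Q\<^esub> \<eta> = \<zero>\<^bsub>Q\<^esub>"
    unfolding \<xi>_def \<eta>_def quot_const_def quot_var_def x_def[symmetric] y_def[symmetric] ev[OF pr, symmetric]
    by (rule zero; simp add: S_def)+
  then have YX: "\<eta> \<otimes>\<^bsub>Q\<^esub> \<xi> = \<zero>\<^bsub>Q\<^esub>"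
    using \<xi> \<eta> Q.m_comm by simp
  note sp = R Q.is_cring k \<xi> \<eta>
  have mX: "\<xi> \<otimes>\<^bsub>Q\<^esub> z \<in> span3 ?R Q k \<xi> \<eta>" and mY: "\<eta> \<otimes>\<^bsub>Q\<^esub> z \<in> span3 ?R Q k \<xi> \<eta>"
    if z: "z \<in> span3 ?R Q k \<xi> \<eta>" for z
    by (rule span3_mult[OF sp z \<xi>] span3_mult[OF sp z \<eta>];
        use span3_zero[OF sp] span3_fst[OF sp] span3_snd[OF sp] ring_hom_closed[OF k] in \<open>simp add: XY YX\<close>)+
  have const: "quot_const P S c \<in> span3 ?R Q k \<xi> \<eta>" if c: "c \<in> carrier (UP ?R)" for c
  proof (rule UP_induct[OF R c, where Q = "\<lambda>c. quot_const P S c \<in> span3 ?R Q k \<xi> \<eta>"])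
    show "quot_const P S (pconst ?R c) \<in> span3 ?R Q k \<xi> \<eta>" if "c \<in> carrier ?R" for c
      using span3_const[OF sp that] by (simp add: k_def)
    note kk = quot_const_hom[OF P S, folded Q_def, unfolded P_def]
    fix p assume p: "p \<in> carrier (UP ?R)" "quot_const P S p \<in> span3 ?R Q k \<xi> \<eta>"
    show "quot_const P S (pvar ?R \<otimes>\<^bsub>UP ?R\<^esub> p) \<in> span3 ?R Q k \<xi> \<eta>"
      using mX[OF p(2)] ring_hom_mult[OF kk pvar_closed[OF R] p(1)] by (simp add: \<xi>_def P_def)
    fix q assume q: "q \<in> carrier (UP ?R)" "quot_const P S q \<in> span3 ?R Q k \<xi> \<eta>"
    show "quot_const P S (p \<oplus>\<^bsub>UP ?R\<^esub> q) \<in> span3 ?R Q k \<xi> \<eta>"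
      using span3_add[OF sp p(2) q(2)] ring_hom_add[OF kk p(1) q(1)] by (simp add: P_def)
  qed
  have sub: "carrier Q \<subseteq> span3 ?R Q k \<xi> \<eta>"
  proof
    fix z assume "z \<in> carrier Q"
    then show "z \<in> span3 ?R Q k \<xi> \<eta>"
      unfolding Q_def
    proof (rule poly_quot_induct[OF P S, where B = "span3 ?R (poly_quot P S) k \<xi> \<eta>"], fold Q_def quot_const_def quot_var_def \<eta>_def)
      show "quot_const P S c \<in> span3 ?R Q k \<xi> \<eta>" if "c \<in> carrier P" for c
        using const that by (simp add: P_def)
      show "u \<oplus>\<^bsub>Q\<^esub> v \<in> span3 ?R Q k \<xi> \<eta>" if "u \<in> span3 ?R Q k \<xi> \<eta>" "v \<in> span3 ?R Q k \<xi> \<eta>" for u v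
        by (rule span3_add[OF sp that])
      show "\<eta> \<otimes>\<^bsub>Q\<^esub> u \<in> span3 ?R Q k \<xi> \<eta>" if "u \<in> span3 ?R Q k \<xi> \<eta>" for u
        by (rule mY[OF that])
    qed
  qed
  have fin: "finite (carrier ?R)" by (rule residue_ring_card(1))
  have card: "finite (carrier Q)" "card (carrier Q) \<le> 8"
    using finite_subset[OF sub span3_finite(1)[OF fin]] card_mono[OF span3_finite(1)[OF fin] sub]
      span3_finite(2)[OF fin, of Q k \<xi> \<eta>] by (simp_all add: residue_ring_card)
  then show "finite (carrier Z2_xy_x2_xy_y2)" "card (carrier Z2_xy_x2_xy_y2) \<le> 8"
    by (simp_all add: Q_eq)
  fix T :: "('b, 'n) ring_scheme"
  assume T: "cring T" and char: "cring.int_elem T 2 = \<zero>\<^bsub>T\<^esub>" and a: "a \<in> carrier T" and b: "b \<in> carrier T"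
    and ab: "a \<otimes>\<^bsub>T\<^esub> a = \<zero>\<^bsub>T\<^esub>" "a \<otimes>\<^bsub>T\<^esub> b = \<zero>\<^bsub>T\<^esub>" "b \<otimes>\<^bsub>T\<^esub> b = \<zero>\<^bsub>T\<^esub>"
    and gen: "ring_generated T {b, a}" and big: "8 \<le> card (carrier T)"
  interpret T: cring T by fact
  obtain h where "h \<in> ring_hom (UP ?R) T" "h (pvar ?R) = a"
    by (rule UP_eval[OF R T T.residue_ring_hom[OF char] a]) (rule that)
  then have h: "h \<in> ring_hom P T" "h (pvar ?R) = a"
    by (simp_all add: P_def)
  show "T \<simeq> Z2_xy_x2_xy_y2"
    unfolding Q_eq Q_def
  proof (rule ring_iso_poly_quotI[OF P S T h(1) b _ gen])
    fix e s assume e: "e \<in> ring_hom (UP P) T" and ec: "\<And>c. c \<in> carrier P \<Longrightarrow> e (pconst P c) = h c"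
      and ea: "e (pvar P) = b" and s: "s \<in> S"
    have "e x = a" "e y = b"
      using ec[OF xR] h(2) ea by (simp_all add: x_def y_def)
    then show "e s = \<zero>\<^bsub>T\<^esub>"
      using s ev[OF e] ab unfolding S_def by auto
  next
    show "{b, a} \<subseteq> insert b (h ` carrier P)"
      using h(2) xR by auto
  qed (use card big in \<open>auto simp: Q_def\<close>)
qed

section \<open>Local rings whose maximal ideal has at most five elements\<close>

context finite_local_ring
begin

lemma card_M_pos: "0 < card M"
  using finite_M M_zero card_gt_0_iff[of M] by blast

text \<open>
  If the residue field has \<open>|M|\<close> elements, then \<open>M = R s\<close> for an element \<open>s\<close> killed by \<open>M\<close>. So \<open>M\<close> has square
  zero, and any non-zero \<open>t = a s\<close> generates it, because \<open>a\<close> is a unit.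
\<close>

lemma square_case:
  assumes card: "card (carrier R) = card M * card M"
  shows "m \<in> M \<Longrightarrow> m' \<in> M \<Longrightarrow> m \<otimes> m' = \<zero>"
    and "t \<in> M \<Longrightarrow> t \<noteq> \<zero> \<Longrightarrow> m \<in> M \<Longrightarrow> \<exists>a\<in>carrier R. m = a \<otimes> t"
    and "\<iota> (int (card M)) \<in> M"
proof -
  obtain s q where s: "s \<in> M" "s \<noteq> \<zero>" "\<And>m. m \<in> M \<Longrightarrow> m \<otimes> s = \<zero>"
    and q: "card (carrier R) = q * card M" "\<iota> (int q) \<in> M"
    and gen: "\<And>m. q = card M \<Longrightarrow> m \<in> M \<Longrightarrow> \<exists>a\<in>carrier R. m = a \<otimes> s"
    by (rule socle_generator) (rule that)
  have qM: "q = card M"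
    using card q(1) card_M_pos by simp
  then show "\<iota> (int (card M)) \<in> M"
    using q(2) by simp
  have sc: "s \<in> carrier R" using s by simp
  show zero: "m \<otimes> m' = \<zero>" if m: "m \<in> M" "m' \<in> M" for m m'
  proof -
    obtain a where "a \<in> carrier R" "m' = a \<otimes> s"
      using gen[OF qM m(2)] by blast
    moreover have "m \<in> carrier R" using m by simp
    ultimately have "m \<otimes> m' = a \<otimes> (m \<otimes> s)"
      using sc by (simp add: m_lcomm)
    then show ?thesis
      using s(3)[OF m(1)] \<open>a \<in> carrier R\<close> by simp
  qed
  assume t: "t \<in> M" "t \<noteq> \<zero>" and m: "m \<in> M"
  obtain a where a: "a \<in> carrier R" "t = a \<otimes> s"
    using gen[OF qM t(1)] by blast
  obtain b where b: "b \<in> carrier R" "m = b \<otimes> s"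
    using gen[OF qM m] by blast
  have "a \<notin> M"
    using a t s(3) by auto
  then have u: "a \<in> Units R"
    using unit_iff a by simp
  have "(b \<otimes> inv a) \<otimes> t = b \<otimes> ((inv a \<otimes> a) \<otimes> s)"
    unfolding a(2) using a b sc u by (simp add: m_assoc del: Units_l_inv)
  also have "\<dots> = m"
    using u b sc by simp
  finally show "\<exists>a\<in>carrier R. m = a \<otimes> t"
    using b u by (intro bexI[of _ "b \<otimes> inv a"]) simp_all
qed

text \<open>
  If \<open>B\<close> represents all residue classes, then \<open>M = R t = B t\<close>, because \<open>M t = 0\<close>; hence \<open>R = B + B t\<close>.
\<close>

lemma square_case_generated:
  assumes card: "card (carrier R) = card M * card M" and t: "t \<in> M" "t \<noteq> \<zero>" "t \<in> B"
    and cl: "\<And>x y. x \<in> B \<Longrightarrow> y \<in> B \<Longrightarrow> x \<oplus> y \<in> B" "\<And>x y. x \<in> B \<Longrightarrow> y \<in> B \<Longrightarrow> x \<otimes> y \<in> B"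
    and cover: "\<And>a. a \<in> carrier R \<Longrightarrow> \<exists>c\<in>B \<inter> carrier R. \<exists>m\<in>M. a = c \<oplus> m"
  shows "carrier R \<subseteq> B"
proof
  fix a assume "a \<in> carrier R"
  then obtain c m where c: "c \<in> B" and m: "m \<in> M" "a = c \<oplus> m"
    using cover by blast
  obtain b where b: "b \<in> carrier R" "m = b \<otimes> t"
    using square_case(2)[OF card t(1,2) m(1)] by blast
  obtain d n where d: "d \<in> B" "d \<in> carrier R" and n: "n \<in> M" "b = d \<oplus> n"
    using cover[OF b(1)] by blast
  have "m = d \<otimes> t \<oplus> n \<otimes> t"
    using b n d t by (simp add: l_distr)
  then have "m = d \<otimes> t"
    using square_case(1)[OF card n(1) t(1)] d t by simp
  then show "a \<in> B"
    using c m d t cl by simp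
qed

lemma int_elem_mem:
  assumes "\<zero> \<in> B" "\<one> \<in> B" "\<And>x y. x \<in> B \<Longrightarrow> y \<in> B \<Longrightarrow> x \<oplus> y \<in> B" "0 \<le> k"
  shows "\<iota> k \<in> B"
  using assms(4)
proof (induction k rule: int_ge_induct)
  case (step k)
  then show ?case
    using assms(2,3) by (simp add: int_elem_add)
qed (use assms in simp)

lemma prime_square_case_generated:
  assumes card: "card (carrier R) = p * p" "card M = p" "Factorial_Ring.prime p"
    and t: "t \<in> M" "t \<noteq> \<zero>"
  shows "ring_generated R {t}"
  unfolding ring_generated_def
proof (intro allI impI)
  fix B assume B: "\<zero> \<in> B" "\<one> \<in> B" "{t} \<subseteq> B" and cl: "\<forall>x\<in>B. \<forall>y\<in>B. x \<oplus> y \<in> B \<and> x \<otimes> y \<in> B"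
  have sq: "card (carrier R) = card M * card M"
    using card by simp
  show "carrier R \<subseteq> B"
  proof (rule square_case_generated[OF sq t])
    fix a assume a: "a \<in> carrier R"
    obtain k m where "k \<in> {0..<int p}" "m \<in> M" "a = \<iota> k \<oplus> m"
      using prime_residue_class[OF card(3), of a] a card square_case(3)[OF sq] by auto
    moreover have "\<iota> k \<in> B" if "k \<in> {0..<int p}" for k
      using B cl that by (intro int_elem_mem) auto
    ultimately show "\<exists>c\<in>B \<inter> carrier R. \<exists>m\<in>M. a = c \<oplus> m"
      by (intro bexI[of _ "\<iota> k"] bexI[of _ m]) simp_all
  qed (use B cl in auto)
qed

text \<open>
  If \<open>p\<close> vanishes in \<open>R\<close>, then \<open>R\<close> is generated over \<open>\<int>/p\<close> by any non-zero \<open>t\<close> in \<open>M\<close>, and \<open>t\<^sup>2 = 0\<close>.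
  Otherwise \<open>t = p\<close> is a possible choice, so \<open>R\<close> is generated by 1 and has characteristic \<open>p\<^sup>2\<close>.
\<close>

lemma prime_square_case:
  assumes card: "card (carrier R) = p * p" "card M = p" "Factorial_Ring.prime p"
  shows "R \<simeq> poly_mod_power (residue_ring (int p)) 2 \<or> R \<simeq> residue_ring (int (p * p))"
proof -
  have sq: "card (carrier R) = card M * card M"
    using card by simp
  have p1: "int p > 1"
    using prime_gt_1_nat[OF card(3)] by simp
  have pM: "\<iota> (int p) \<in> M"
    using square_case(3)[OF sq] card by simp
  show ?thesis
  proof (cases "\<iota> (int p) = \<zero>")
    case True
    obtain t where t: "t \<in> M" "t \<noteq> \<zero>"
      using M_nontrivial M_zero by blast
    have "R \<simeq> poly_mod_power (residue_ring (int p)) 2"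
      using card t square_case(1)[OF sq t(1) t(1)]
      by (intro dual_numbers_isoI[OF residue_ring_cring[OF p1] residue_ring_card(1) is_cring residue_ring_hom[OF True]
          M_closed[OF t(1)] _ prime_square_case_generated[OF card t]]) (simp_all add: residue_ring_card)
    then show ?thesis ..
  next
    case False
    have "R \<simeq> residue_ring (int (p * p))"
    proof (rule residue_ring_isoI[OF is_cring])
      show "int (p * p) > 1"
        unfolding of_nat_mult by (rule less_1_mult[OF p1 p1])
      show "\<iota> (int (p * p)) = \<zero>"
        using square_case(1)[OF sq pM pM] by (simp add: int_elem_mult)
      show "nat (int (p * p)) \<le> card (carrier R)"
        unfolding nat_int using card by simp
      show "ring_generated R {}"
        unfolding ring_generated_def
      proof (intro allI impI)
        fix B assume B: "\<zero> \<in> B" "\<one> \<in> B" "{} \<subseteq> B" and cl: "\<forall>x\<in>B. \<forall>y\<in>B. x \<oplus> y \<in> B \<and> x \<otimes> y \<in> B"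
        have "\<iota> (int p) \<in> B"
          using B cl by (intro int_elem_mem) auto
        then show "carrier R \<subseteq> B"
          using B cl by (intro ring_generatedD[OF prime_square_case_generated[OF card pM False]]) auto
      qed
    qed
    then show ?thesis ..
  qed
qed

text \<open>
  The product of \<open>w\<close> and \<open>w + 1\<close> is \<open>-1\<close>.
\<close>

lemma omega_units:
  assumes w: "w \<in> carrier R" "w \<otimes> w \<oplus> w \<oplus> \<one> = \<zero>"
  shows "w \<notin> M" "w \<oplus> \<one> \<notin> M"
proof -
  have "w \<otimes> (w \<oplus> \<one>) = (w \<otimes> w \<oplus> w \<oplus> \<one>) \<ominus> \<one>"
    using w(1) by algebra
  then have eq: "w \<otimes> (w \<oplus> \<one>) = \<ominus> \<one>"
    unfolding w(2) by (simp add: a_minus_def)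
  have no: "\<ominus> \<one> \<notin> M"
    using M_uminus[of "\<ominus> \<one>"] one_notin_M by auto
  show "w \<notin> M"
    using I_r_closed[of w "w \<oplus> \<one>"] w(1) eq no by auto
  show "w \<oplus> \<one> \<notin> M"
    using I_l_closed[of "w \<oplus> \<one>" w] w(1) eq no by auto
qed

text \<open>
  Up to sign, the differences of these four elements are \<open>1\<close>, \<open>w\<close>, \<open>w + 1\<close> and \<open>w - 1 = (w + 1) - 2\<close>; none lies in \<open>M\<close>.
\<close>

lemma omega_transversal:
  assumes w: "w \<in> carrier R" "w \<otimes> w \<oplus> w \<oplus> \<one> = \<zero>" and two: "\<iota> 2 \<in> M"
    and card: "card (carrier R) = 4 * card M" and a: "a \<in> carrier R"
  shows "\<exists>c\<in>{\<zero>, \<one>, w, w \<oplus> \<one>}. \<exists>m\<in>M. a = c \<oplus> m"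
proof -
  note wM = omega_units[OF w]
  have two_eq: "\<iota> 2 = \<one> \<oplus> \<one>"
    using int_elem_add[of 1 1] by simp
  have w1: "w \<ominus> \<one> \<notin> M"
  proof
    assume "w \<ominus> \<one> \<in> M"
    then have "(w \<ominus> \<one>) \<oplus> (\<one> \<oplus> \<one>) \<in> M"
      using two unfolding two_eq by (rule M_add)
    moreover have "(w \<ominus> \<one>) \<oplus> (\<one> \<oplus> \<one>) = w \<oplus> \<one>"
      using w(1) by algebra
    ultimately show False using wM by simp
  qed
  have sym: "d \<ominus> c \<notin> M" if "c \<in> carrier R" "d \<in> carrier R" "c \<ominus> d \<notin> M" for c d
    using M_uminus[of "d \<ominus> c"] that minus_add[of d "\<ominus> c"] by (auto simp: a_minus_def a_comm minus_add)
  have diffs: "\<one> \<ominus> \<zero> \<notin> M" "w \<ominus> \<zero> \<notin> M" "(w \<oplus> \<one>) \<ominus> \<zero> \<notin> M" "w \<ominus> \<one> \<notin> M" "(w \<oplus> \<one>) \<ominus> \<one> \<notin> M" "(w \<oplus> \<one>) \<ominus> w \<notin> M"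
  proof -
    have "\<one> \<ominus> \<zero> = \<one>" "w \<ominus> \<zero> = w" "(w \<oplus> \<one>) \<ominus> \<zero> = w \<oplus> \<one>" "(w \<oplus> \<one>) \<ominus> \<one> = w" "(w \<oplus> \<one>) \<ominus> w = \<one>"
      using w(1) by algebra+
    then show "\<one> \<ominus> \<zero> \<notin> M" "w \<ominus> \<zero> \<notin> M" "(w \<oplus> \<one>) \<ominus> \<zero> \<notin> M" "w \<ominus> \<one> \<notin> M" "(w \<oplus> \<one>) \<ominus> \<one> \<notin> M" "(w \<oplus> \<one>) \<ominus> w \<notin> M"
      using wM w1 one_notin_M by simp_all
  qed
  have C: "{\<zero>, \<one>, w, w \<oplus> \<one>} \<subseteq> carrier R"
    using w(1) by simp
  have self: "c \<ominus> c \<in> M" if "c \<in> carrier R" for c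
    using that M_zero by (simp add: a_minus_def r_neg)
  have tr: "c = d" if "c \<in> {\<zero>, \<one>, w, w \<oplus> \<one>}" "d \<in> {\<zero>, \<one>, w, w \<oplus> \<one>}" "c \<ominus> d \<in> M" for c d
    using that diffs sym[OF _ _ diffs(1)] sym[OF _ _ diffs(2)] sym[OF _ _ diffs(3)] sym[OF _ _ diffs(4)]
      sym[OF _ _ diffs(5)] sym[OF _ _ diffs(6)] w(1)
    by (elim insertE emptyE) simp_all
  have "card {\<zero>, \<one>, w, w \<oplus> \<one>} = 4"
  proof -
    have ne: "c \<noteq> d" if "c \<in> carrier R" "c \<ominus> d \<notin> M" for c d
      using self[OF that(1)] that(2) by auto
    have "\<one> \<noteq> \<zero>" "w \<noteq> \<zero>" "w \<oplus> \<one> \<noteq> \<zero>" "w \<noteq> \<one>" "w \<oplus> \<one> \<noteq> \<one>" "w \<oplus> \<one> \<noteq> w"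
      by (rule ne[OF _ diffs(1)] ne[OF _ diffs(2)] ne[OF _ diffs(3)] ne[OF _ diffs(4)] ne[OF _ diffs(5)] ne[OF _ diffs(6)],
          simp add: w(1))+
    then show ?thesis
      by (auto simp: card_insert_if)
  qed
  then have "card (carrier R) \<le> card {\<zero>, \<one>, w, w \<oplus> \<one>} * card M"
    using card by simp
  from transversal_card_le(2)[OF C tr this a] show ?thesis .
qed

text \<open>
  The unit group has order 12, so \<open>w = u\<^sup>4\<close> satisfies \<open>w\<^sup>3 = 1\<close> for every unit \<open>u\<close>. As \<open>2\<close> lies in \<open>M\<close>,
  \<open>u\<^sup>4 - 1\<close> is congruent to \<open>(u - 1)\<^sup>4\<close> modulo \<open>M\<close>. So if \<open>u\<close> is neither 0 nor 1 in the residue field, then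
  \<open>w - 1\<close> is a unit and can be cancelled from \<open>w\<^sup>3 - 1 = (w - 1)(w\<^sup>2 + w + 1)\<close>.
\<close>

lemma omega_exists:
  assumes card: "card (carrier R) = 16" "card M = 4"
  obtains w where "w \<in> carrier R" "w \<otimes> w \<oplus> w \<oplus> \<one> = \<zero>"
proof -
  have sq: "card (carrier R) = card M * card M"
    using card by simp
  have "\<iota> (2 * 2) \<in> M"
    using square_case(3)[OF sq] card by simp
  then have two: "\<iota> 2 \<in> M"
    unfolding int_elem_mult using M_prime[of "\<iota> 2" "\<iota> 2"] by simp
  have two_eq: "\<iota> 2 = \<one> \<oplus> \<one>"
    using int_elem_add[of 1 1] by simp
  \<comment> \<open>the residue classes of 0 and 1 cover only half of the ring\<close>
  let ?N = "M \<union> (\<lambda>m. \<one> \<oplus> m) ` M"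
  have "card ?N \<le> 8"
    using card_Un_le[of M "(\<lambda>m. \<one> \<oplus> m) ` M"] card_image_le[OF finite_M, of "\<lambda>m. \<one> \<oplus> m"] card by simp
  moreover have "finite ?N"
    using finite_M by simp
  ultimately have "\<not> carrier R \<subseteq> ?N"
    using card_mono[of ?N "carrier R"] card by auto
  then obtain u where u: "u \<in> carrier R" "u \<notin> M" and "u \<notin> (\<lambda>m. \<one> \<oplus> m) ` M"
    by blast
  moreover have "u = \<one> \<oplus> (u \<ominus> \<one>)"
    using u(1) by algebra
  ultimately have u1: "u \<ominus> \<one> \<notin> M"
    by blast
  \<comment> \<open>modulo \<open>M\<close> signs do not matter\<close>
  have shift: "z \<oplus> \<one> \<notin> M" if "z \<in> carrier R" "z \<ominus> \<one> \<notin> M" for z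
  proof
    assume "z \<oplus> \<one> \<in> M"
    then have "(z \<oplus> \<one>) \<ominus> (\<one> \<oplus> \<one>) \<in> M"
      using two unfolding two_eq by (rule M_minus)
    moreover have "(z \<oplus> \<one>) \<ominus> (\<one> \<oplus> \<one>) = z \<ominus> \<one>"
      using that(1) by algebra
    ultimately show False using that(2) by simp
  qed
  have sq1: "z \<otimes> z \<ominus> \<one> \<notin> M" if z: "z \<in> carrier R" "z \<ominus> \<one> \<notin> M" for z
  proof
    assume "z \<otimes> z \<ominus> \<one> \<in> M"
    moreover have "z \<otimes> z \<ominus> \<one> = (z \<ominus> \<one>) \<otimes> (z \<oplus> \<one>)"
      using z(1) by algebra
    ultimately show False
      using M_prime[of "z \<ominus> \<one>" "z \<oplus> \<one>"] z shift[OF z] by auto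
  qed
  define w where "w = (u \<otimes> u) \<otimes> (u \<otimes> u)"
  have w: "w \<in> carrier R" and w1: "w \<ominus> \<one> \<notin> M"
    unfolding w_def using u sq1[OF _ sq1[OF u(1) u1]] by simp_all
  have "carrier R - M = Units R"
    using unit_iff Units_closed by blast
  then have "card (Units R) = 12"
    using card_Diff_subset[OF finite_M M_subset] card by simp
  then have "order (units_of R) = 12"
    by (simp add: order_def units_of_def)
  moreover have uU: "u \<in> Units R"
    using u unit_iff by simp
  ultimately have "u [^]\<^bsub>units_of R\<^esub> (12::nat) = \<one>"
    using group.pow_order_eq_1[OF units_group, of u] by (simp add: units_of_def)
  then have u12: "u [^] (12::nat) = \<one>"
    using units_of_pow[OF uU] by simp
  have "w \<otimes> w \<otimes> w = u [^] (12::nat)"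
  proof -
    have "w = u [^] (4::nat)"
      using u(1) by (simp add: w_def numeral_eq_Suc m_assoc)
    then have "w \<otimes> w \<otimes> w = u [^] (4 + 4 + 4 :: nat)"
      using u(1) by (simp only: nat_pow_mult)
    then show ?thesis by simp
  qed
  then have w3: "w \<otimes> w \<otimes> w = \<one>"
    using u12 by simp
  have "(w \<ominus> \<one>) \<otimes> (w \<otimes> w \<oplus> w \<oplus> \<one>) = w \<otimes> w \<otimes> w \<ominus> \<one>"
    using w by algebra
  then have "(w \<ominus> \<one>) \<otimes> (w \<otimes> w \<oplus> w \<oplus> \<one>) = \<zero>"
    unfolding w3 by (simp add: a_minus_def r_neg)
  then have "w \<otimes> w \<oplus> w \<oplus> \<one> = \<zero>"
    using unit_cancel_zero[OF _ w1] w by simp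
  with w show thesis by (rule that)
qed

text \<open>
  The elements \<open>0, 1, w, w + 1\<close> represent the residue classes, so \<open>w\<close> and any non-zero \<open>t\<close> in \<open>M\<close> generate
  \<open>R\<close>. If 2 does not vanish, then \<open>t = 2\<close> is a possible choice.
\<close>

lemma order_16_case:
  assumes card: "card (carrier R) = 16" "card M = 4"
  shows "R \<simeq> poly_mod_power F4 2 \<or> R \<simeq> Z4_x2_x_1"
proof -
  have sq: "card (carrier R) = card M * card M"
    using card by simp
  obtain w where w: "w \<in> carrier R" "w \<otimes> w \<oplus> w \<oplus> \<one> = \<zero>"
    using omega_exists[OF card] .
  have "\<iota> (2 * 2) \<in> M"
    using square_case(3)[OF sq] card by simp
  then have two: "\<iota> 2 \<in> M"
    unfolding int_elem_mult using M_prime[of "\<iota> 2" "\<iota> 2"] by simp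
  have gen: "carrier R \<subseteq> B" if t: "t \<in> M" "t \<noteq> \<zero>" "t \<in> B" and B: "\<zero> \<in> B" "\<one> \<in> B" "w \<in> B"
      and cl: "\<And>x y. x \<in> B \<Longrightarrow> y \<in> B \<Longrightarrow> x \<oplus> y \<in> B" "\<And>x y. x \<in> B \<Longrightarrow> y \<in> B \<Longrightarrow> x \<otimes> y \<in> B" for t B
  proof (rule square_case_generated[OF sq t cl])
    fix a assume a: "a \<in> carrier R"
    have card4: "card (carrier R) = 4 * card M"
      using card by simp
    have sub: "{\<zero>, \<one>, w, w \<oplus> \<one>} \<subseteq> B \<inter> carrier R"
      using B w cl(1) by simp
    have "\<exists>c\<in>{\<zero>, \<one>, w, w \<oplus> \<one>}. \<exists>m\<in>M. a = c \<oplus> m"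
      by (rule omega_transversal[OF w two card4 a])
    then show "\<exists>c\<in>B \<inter> carrier R. \<exists>m\<in>M. a = c \<oplus> m"
      by (rule bexE) (rule bexI[OF _ subsetD[OF sub]])
  qed
  show ?thesis
  proof (cases "\<iota> 2 = \<zero>")
    case True
    obtain t where t: "t \<in> M" "t \<noteq> \<zero>"
      using M_nontrivial M_zero by blast
    have "ring_generated R {t, w}"
      unfolding ring_generated_def using gen[OF t] by simp
    then have "R \<simeq> poly_mod_power F4 2"
      using square_case(1)[OF sq t(1) t(1)] t card by (intro F4_dual_isoI[OF is_cring True w, of t]) simp_all
    then show ?thesis ..
  next
    case False
    have "ring_generated R {w}"
      unfolding ring_generated_def
    proof (intro allI impI)
      fix B assume B: "\<zero> \<in> B" "\<one> \<in> B" "{w} \<subseteq> B" and cl: "\<forall>x\<in>B. \<forall>y\<in>B. x \<oplus> y \<in> B \<and> x \<otimes> y \<in> B"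
      have "\<iota> 2 \<in> B"
        using B cl by (intro int_elem_mem) auto
      then show "carrier R \<subseteq> B"
        using B cl by (intro gen[OF two False]) auto
    qed
    moreover have "\<iota> 4 = \<zero>"
      using square_case(1)[OF sq two two] int_elem_mult[of 2 2] by simp
    ultimately have "R \<simeq> Z4_x2_x_1"
      unfolding Z4_x2_x_1_eq using card w
      by (intro omega_isoI[OF residue_ring_cring residue_ring_card(1) is_cring residue_ring_hom]) (simp_all add: residue_ring_card)
    then show ?thesis ..
  qed
qed

lemma M_eq_four:
  assumes card: "card M = 4" and x: "x \<in> M" "x \<noteq> \<zero>" and y: "y \<in> M" "y \<noteq> \<zero>" "y \<noteq> x" and xy: "x \<oplus> y \<noteq> \<zero>"
  shows "M = {\<zero>, x, y, x \<oplus> y}"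
proof -
  have xc: "x \<in> carrier R" "y \<in> carrier R"
    using x y by simp_all
  have "x \<oplus> y \<noteq> x" "x \<oplus> y \<noteq> y"
    using xc x y by simp_all
  then have "card {\<zero>, x, y, x \<oplus> y} = 4"
    using x y xy by (auto simp: card_insert_if)
  moreover have "{\<zero>, x, y, x \<oplus> y} \<subseteq> M"
    using x y M_zero M_add by simp
  ultimately show ?thesis
    using card card_subset_eq[OF finite_M] by metis
qed

text \<open>
  Since \<open>M\<close> fixes only 0, the elements \<open>x\<close>, \<open>x m\<close> and \<open>x (1 + m)\<close> are non-zero and distinct.
\<close>

lemma M_eq_four_product:
  assumes card: "card M = 4" and x: "x \<in> M" and m: "m \<in> M" and ne: "x \<otimes> m \<noteq> \<zero>"
  shows "M = {\<zero>, x, x \<otimes> m, x \<oplus> x \<otimes> m}"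
proof (rule M_eq_four[OF card x])
  have c: "x \<in> carrier R" "m \<in> carrier R"
    using x m by simp_all
  show x0: "x \<noteq> \<zero>" using ne c by auto
  show "x \<otimes> m \<in> M" using x c by (simp add: I_r_closed)
  show "x \<otimes> m \<noteq> x"
    using M_fixes_only_zero[OF m c(1)] x0 c by (auto simp: m_comm)
  show "x \<oplus> x \<otimes> m \<noteq> \<zero>"
  proof
    assume eq: "x \<oplus> x \<otimes> m = \<zero>"
    have "\<ominus> m \<otimes> x = x \<ominus> (x \<oplus> x \<otimes> m)"
      using c by algebra
    also have "\<dots> = x"
      unfolding eq using c by (simp add: a_minus_def)
    finally show False
      using M_fixes_only_zero[OF M_uminus[OF m] c(1)] x0 by simp
  qed
qed (rule ne)

lemma order_8_cover:
  assumes card: "card (carrier R) = 8" "card M = 4" and two: "\<iota> 2 \<in> M"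
    and B: "\<zero> \<in> B" "\<one> \<in> B" "M \<subseteq> B" and cl: "\<forall>x\<in>B. \<forall>y\<in>B. x \<oplus> y \<in> B \<and> x \<otimes> y \<in> B"
  shows "carrier R \<subseteq> B"
proof
  fix a assume a: "a \<in> carrier R"
  obtain k m where "k \<in> {0..<int 2}" "m \<in> M" "a = \<iota> k \<oplus> m"
    using prime_residue_class[of 2, OF two_is_prime_nat _ _ a] card two by auto
  moreover from this(1) have "\<iota> k \<in> B"
    using B cl by (intro int_elem_mem) auto
  ultimately show "a \<in> B"
    using B cl by auto
qed

text \<open>
  If 4 does not vanish, 2 and \<open>2\<^sup>2\<close> generate \<open>M\<close> additively and \<open>R\<close> is \<open>\<int>/8\<close>. If 4 vanishes and \<open>x\<^sup>2 \<noteq> 0\<close>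
  for some \<open>x\<close> in \<open>M\<close>, then \<open>M = {0, x, x\<^sup>2, x + x\<^sup>2}\<close> and \<open>x\<^sup>3 = 0\<close>; squaring shows that 2 is neither \<open>x\<close>
  nor \<open>x + x\<^sup>2\<close>, which leaves \<open>2 = 0\<close> and \<open>2 = x\<^sup>2\<close>. If all squares in \<open>M\<close> vanish, so do all products: from
  \<open>x y \<noteq> 0\<close> it would follow that \<open>y\<close> is a multiple of \<open>x\<close>, and then \<open>x y\<close> is a multiple of \<open>x\<^sup>2\<close>. In that
  case \<open>M\<close> is spanned by two elements, one of which can be taken to be 2 if 2 does not vanish.
\<close>

lemma order_8_case:
  assumes card: "card (carrier R) = 8" "card M = 4" and two: "\<iota> 2 \<in> M"
  shows "R \<simeq> residue_ring 8 \<or> R \<simeq> poly_mod_power (residue_ring 2) 3 \<or> R \<simeq> Z4_x3_x2m2 \<or>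
    R \<simeq> Z4_2x_x2 \<or> R \<simeq> Z2_xy_x2_xy_y2"
proof -
  have four: "\<iota> 4 = \<iota> 2 \<otimes> \<iota> 2"
    using int_elem_mult[of 2 2] by simp
  have cube: "x \<otimes> x \<otimes> x = \<zero>" if x: "x \<in> M" and ne: "x \<otimes> x \<noteq> \<zero>" for x
  proof (rule ccontr)
    assume ne3: "x \<otimes> x \<otimes> x \<noteq> \<zero>"
    have c: "x \<in> carrier R" using x by simp
    have xx: "x \<otimes> x \<in> M" using x c by (simp add: I_l_closed)
    have "x \<otimes> (x \<otimes> x) \<noteq> \<zero>"
      using ne3 c by (simp add: m_assoc)
    then have "M = {\<zero>, x, x \<otimes> (x \<otimes> x), x \<oplus> x \<otimes> (x \<otimes> x)}"
      by (rule M_eq_four_product[OF card(2) x xx])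
    then consider "x \<otimes> x = x" | "x \<otimes> x = x \<otimes> (x \<otimes> x)" | "x \<otimes> x = x \<oplus> x \<otimes> (x \<otimes> x)"
      using xx ne by blast
    then show False
    proof cases
      case 1
      then show ?thesis using M_fixes_only_zero[OF x c] ne c by auto
    next
      case 2
      then show ?thesis using M_fixes_only_zero[OF x, of "x \<otimes> x"] ne c by simp
    next
      case 3
      have "(x \<ominus> x \<otimes> x) \<otimes> x = (x \<otimes> x) \<ominus> x \<otimes> (x \<otimes> x)"
        using c by algebra
      also have "\<dots> = (x \<oplus> x \<otimes> (x \<otimes> x)) \<ominus> x \<otimes> (x \<otimes> x)"
        by (rule arg_cong[OF 3, of "\<lambda>z. z \<ominus> x \<otimes> (x \<otimes> x)"])
      also have "\<dots> = x"
        using c by algebra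
      finally have "x = \<zero>"
        using M_fixes_only_zero[OF _ c] M_minus[OF x xx] by blast
      then show ?thesis using ne c by simp
    qed
  qed
  have cover: "carrier R \<subseteq> B"
    if "M = {\<zero>, x, y, x \<oplus> y}" "x \<in> B" "y \<in> B" "\<zero> \<in> B" "\<one> \<in> B" "\<forall>x\<in>B. \<forall>y\<in>B. x \<oplus> y \<in> B \<and> x \<otimes> y \<in> B" for x y B
    using that by (intro order_8_cover[OF card two]) simp_all
  have gen1: "ring_generated R {x}" if "M = {\<zero>, x, x \<otimes> x, x \<oplus> x \<otimes> x}" for x
    unfolding ring_generated_def using cover[OF that] by simp
  have Z2: "cring (residue_ring 2)"
    by (rule residue_ring_cring) simp
  show ?thesis
  proof (cases "\<iota> 4 = \<zero>")
    case False
    then have ne: "\<iota> 2 \<otimes> \<iota> 2 \<noteq> \<zero>"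
      using four by simp
    have "\<iota> 8 = \<iota> 2 \<otimes> \<iota> 2 \<otimes> \<iota> 2"
      using int_elem_mult[of 4 2] four by simp
    then have eight: "\<iota> 8 = \<zero>"
      using cube[OF two ne] by simp
    have "ring_generated R {}"
      unfolding ring_generated_def
    proof (intro allI impI)
      fix B assume B: "\<zero> \<in> B" "\<one> \<in> B" "{} \<subseteq> B" and cl: "\<forall>x\<in>B. \<forall>y\<in>B. x \<oplus> y \<in> B \<and> x \<otimes> y \<in> B"
      have "\<iota> 2 \<in> B"
        using B cl by (intro int_elem_mem) auto
      then show "carrier R \<subseteq> B"
        using B cl by (intro cover[OF M_eq_four_product[OF card(2) two two ne]]) auto
    qed
    then have "R \<simeq> residue_ring 8"
      using eight card by (intro residue_ring_isoI[OF is_cring]) simp_all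
    then show ?thesis by simp
  next
    case char4: True
    show ?thesis
    proof (cases "\<exists>x\<in>M. x \<otimes> x \<noteq> \<zero>")
      case True
      then obtain x where x: "x \<in> M" and ne: "x \<otimes> x \<noteq> \<zero>"
        by blast
      have c: "x \<in> carrier R" using x by simp
      note M = M_eq_four_product[OF card(2) x x ne]
      note gen = gen1[OF M]
      have "\<iota> 2 \<noteq> x"
        using char4 four ne by auto
      moreover have "\<iota> 2 \<noteq> x \<oplus> x \<otimes> x"
      proof
        assume "\<iota> 2 = x \<oplus> x \<otimes> x"
        then have "\<zero> = (x \<oplus> x \<otimes> x) \<otimes> (x \<oplus> x \<otimes> x)"
          using char4 four by simp
        also have "\<dots> = x \<otimes> x \<oplus> (x \<otimes> x \<otimes> x) \<otimes> (\<one> \<oplus> \<one> \<oplus> x)"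
          using c by algebra
        also have "\<dots> = x \<otimes> x"
          unfolding cube[OF x ne] using c by simp
        finally show False using ne by simp
      qed
      ultimately consider "\<iota> 2 = \<zero>" | "\<iota> 2 = x \<otimes> x"
        using two M by blast
      then show ?thesis
      proof cases
        case 1
        have "R \<simeq> poly_mod_power (residue_ring 2) 3"
          using card by (intro cubic_isoI[OF Z2 residue_ring_card(1) is_cring residue_ring_hom[OF 1] c cube[OF x ne] gen])
            (simp add: residue_ring_card)
        then show ?thesis by simp
      next
        case 2
        have "R \<simeq> Z4_x3_x2m2"
          using card by (intro Z4_x3_x2m2_isoI[OF is_cring char4 c 2[symmetric] cube[OF x ne] gen]) simp
        then show ?thesis by simp
      qed
    next
      case False
      then have sq: "x \<otimes> x = \<zero>" if "x \<in> M" for x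
        using that by blast
      have zero: "x \<otimes> y = \<zero>" if x: "x \<in> M" and y: "y \<in> M" for x y
      proof (rule ccontr)
        assume ne: "x \<otimes> y \<noteq> \<zero>"
        have c: "x \<in> carrier R" "y \<in> carrier R" using x y by simp_all
        have xxy: "x \<otimes> (x \<otimes> y) = \<zero>"
          using c sq[OF x] by (simp add: m_assoc[symmetric])
        have "y \<in> {\<zero>, x, x \<otimes> y, x \<oplus> x \<otimes> y}"
          using y M_eq_four_product[OF card(2) x y ne] by blast
        then obtain z where z: "z \<in> {\<zero>, x, x \<otimes> y, x \<oplus> x \<otimes> y}" "y = z"
          by blast
        have "x \<otimes> z = \<zero>"
          using z(1) c xxy sq[OF x] by (elim insertE emptyE) (simp_all add: r_distr)
        then show False
          using ne z(2) by simp
      qed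
      have double: "x \<oplus> x = \<zero>" if x: "x \<in> M" for x
      proof -
        have "x \<in> carrier R" using x by simp
        then have "\<iota> 2 \<otimes> x = x \<oplus> x"
          using int_elem_add[of 1 1] by (simp add: l_distr)
        then show ?thesis
          using zero[OF two x] by simp
      qed
      have sum: "x \<oplus> y \<noteq> \<zero>" if x: "x \<in> M" and y: "y \<in> M" and ne: "y \<noteq> x" for x y
      proof
        assume "x \<oplus> y = \<zero>"
        then have "x \<oplus> y = x \<oplus> x"
          using double[OF x] by simp
        then show False
          using x y ne by simp
      qed
      show ?thesis
      proof (cases "\<iota> 2 = \<zero>")
        case True
        obtain x where x: "x \<in> M" "x \<noteq> \<zero>"
          using M_nontrivial M_zero by blast
        have "card {\<zero>, x} < card M"
          using card by (simp add: card_insert_if)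
        then have "\<not> M \<subseteq> {\<zero>, x}"
          using card_mono[of "{\<zero>, x}" M] by auto
        then obtain y where y: "y \<in> M" "y \<noteq> \<zero>" "y \<noteq> x"
          by blast
        have "ring_generated R {y, x}"
          unfolding ring_generated_def
          using cover[OF M_eq_four[OF card(2) x y sum[OF x(1) y(1,3)]]] by simp
        then have "R \<simeq> Z2_xy_x2_xy_y2"
          using card x(1) y(1) zero by (intro Z2_xy_isoI[OF is_cring True, of x y]) simp_all
        then show ?thesis by simp
      next
        case False
        have "card {\<zero>, \<iota> 2} < card M"
          using card by (simp add: card_insert_if)
        then have "\<not> M \<subseteq> {\<zero>, \<iota> 2}"
          using card_mono[of "{\<zero>, \<iota> 2}" M] by auto
        then obtain x where x: "x \<in> M" "x \<noteq> \<zero>" "x \<noteq> \<iota> 2"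
          by blast
        have "ring_generated R {x}"
          unfolding ring_generated_def
        proof (intro allI impI)
          fix B assume B: "\<zero> \<in> B" "\<one> \<in> B" "{x} \<subseteq> B" and cl: "\<forall>x\<in>B. \<forall>y\<in>B. x \<oplus> y \<in> B \<and> x \<otimes> y \<in> B"
          have "\<iota> 2 \<in> B"
            using B cl by (intro int_elem_mem) auto
          then show "carrier R \<subseteq> B"
            using B cl by (intro cover[OF M_eq_four[OF card(2) two False x sum[OF two x(1,3)]]]) auto
        qed
        then have "R \<simeq> Z4_2x_x2"
          using card x(1) zero two by (intro Z4_2x_x2_isoI[OF is_cring char4, of x]) simp_all
        then show ?thesis by simp
      qed
    qed
  qed
qed

lemma classification:
  assumes "card M \<le> 5"
  shows "R \<simeq> residue_ring 4 \<or> R \<simeq> residue_ring 8 \<or> R \<simeq> residue_ring 9 \<or> R \<simeq> residue_ring 25 \<or>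
    R \<simeq> poly_mod_power (residue_ring 2) 2 \<or> R \<simeq> poly_mod_power (residue_ring 3) 2 \<or>
    R \<simeq> poly_mod_power (residue_ring 2) 3 \<or> R \<simeq> poly_mod_power (residue_ring 5) 2 \<or>
    R \<simeq> Z4_x3_x2m2 \<or> R \<simeq> poly_mod_power F4 2 \<or> R \<simeq> Z4_2x_x2 \<or> R \<simeq> Z2_xy_x2_xy_y2 \<or> R \<simeq> Z4_x2_x_1"
proof -
  obtain s q where "s \<in> M" "s \<noteq> \<zero>"
    and q: "card (carrier R) = q * card M" "q dvd card M" "2 \<le> q" "\<iota> (int q) \<in> M"
    by (rule socle_generator) (rule that)
  have "q \<le> card M"
    using dvd_imp_le[OF q(2)] card_M_pos by simp
  then consider "card M = 2" "q = 2" | "card M = 3" "q = 3" | "card M = 4" "q = 2" | "card M = 4" "q = 4"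
    | "card M = 5" "q = 5"
  proof -
    have "card M = 2 \<or> card M = 3 \<or> card M = 4 \<or> card M = 5"
      using \<open>q \<le> card M\<close> q(3) assms by linarith
    moreover have "q = 2 \<or> q = 3 \<or> q = 4 \<or> q = 5"
      using \<open>q \<le> card M\<close> q(3) assms by linarith
    ultimately show thesis
      using q(2) \<open>q \<le> card M\<close> that by (elim disjE) simp_all
  qed
  then show ?thesis
  proof cases
    case 1
    then show ?thesis using prime_square_case[of 2] q(1) by auto
  next
    case 2
    then show ?thesis using prime_square_case[of 3] q(1) by auto
  next
    case 3
    then show ?thesis using order_8_case q(1,4) by simp blast
  next
    case 4
    then show ?thesis using order_16_case q(1) by simp blast
  next
    case 5
    then show ?thesis using prime_square_case[of 5] q(1) by auto
  qed
qed

lemma card_M_le_half: "card M * 2 \<le> card (carrier R)"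
proof -
  obtain s q where "s \<in> M" "s \<noteq> \<zero>" and q: "card (carrier R) = q * card M" "2 \<le> q"
    by (rule socle_generator) (rule that)
  then show ?thesis
    using mult_le_mono1[OF q(2), of "card M"] by simp
qed

text \<open>
  The order \<open>q\<close> of the residue field and 25 both lie in \<open>M\<close>, so they are not coprime and \<open>q \<ge> 5\<close>.
\<close>

lemma card_M_le_char_25:
  assumes "card (carrier R) \<le> 25" "\<iota> 25 = \<zero>"
  shows "card M \<le> 5"
proof -
  obtain s q where "s \<in> M" "s \<noteq> \<zero>" and q: "card (carrier R) = q * card M" "2 \<le> q" "\<iota> (int q) \<in> M"
    by (rule socle_generator) (rule that)
  have "\<iota> 25 \<in> M"
    using assms(2) M_zero by simp
  then have "\<not> coprime (int q) 25"
    using int_elem_coprime[OF q(3)] by simp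
  have "5 \<le> q"
  proof (rule ccontr)
    assume "\<not> 5 \<le> q"
    then consider "q = 2" | "q = 3" | "q = 4"
      using q(2) by linarith
    then have "coprime (int q) 25"
    proof cases
      case 1 then show ?thesis by (simp add: coprime_iff_gcd_eq_1 gcd_non_0_int)
    next
      case 2 then show ?thesis by (simp add: coprime_iff_gcd_eq_1 gcd_non_0_int)
    next
      case 3 then show ?thesis by (simp add: coprime_iff_gcd_eq_1 gcd_non_0_int)
    qed
    then show False
      using \<open>\<not> coprime (int q) 25\<close> by simp
  qed
  then have "5 * card M \<le> q * card M"
    by (rule mult_le_mono1)
  then show ?thesis
    using q(1) assms(1) by linarith
qed

text \<open>
  The residue field has a third element besides 0 and 1: a root of \<open>t\<^sup>2 + t + 1\<close> is neither.
\<close>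

lemma card_M_le_omega:
  assumes "card (carrier R) \<le> 16" and w: "w \<in> carrier R" "w \<otimes> w \<oplus> w \<oplus> \<one> = \<zero>"
  shows "card M \<le> 5"
proof -
  obtain s q where "s \<in> M" "s \<noteq> \<zero>" and q: "card (carrier R) = q * card M" "2 \<le> q" "\<iota> (int q) \<in> M"
    by (rule socle_generator) (rule that)
  have "q \<noteq> 2"
  proof
    assume q2: "q = 2"
    have two: "\<iota> 2 \<in> M"
      using q(3) q2 by simp
    obtain k m where k: "k \<in> {0..<int 2}" and m: "m \<in> M" "w = \<iota> k \<oplus> m"
      using prime_residue_class[of 2, OF two_is_prime_nat _ _ w(1)] q(1) q2 two by auto
    have mc: "m \<in> carrier R" using m by simp
    consider "k = 0" | "k = 1"
      using k by fastforce
    then show False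
    proof cases
      case 1
      then show ?thesis using m omega_units(1)[OF w] mc by simp
    next
      case 2
      then have "w \<oplus> \<one> = \<iota> 2 \<oplus> m"
        unfolding m(2) using mc int_elem_add[of 1 1] by (simp add: a_ac)
      then show ?thesis
        using M_add[OF two m(1)] omega_units(2)[OF w] by simp
    qed
  qed
  then have "3 \<le> q"
    using q(2) by simp
  then have "3 * card M \<le> q * card M"
    by (rule mult_le_mono1)
  then show ?thesis
    using q(1) assms(1) by linarith
qed

end

section \<open>Planarity of the line graph of the essential graph\<close>

context finite_local_ring
begin

text \<open>
  The product of two vertices lies in \<open>M\<close>, so its annihilator is essential.
\<close>

lemma essential_graph_complete: "essential_graph R = complete_graph (M - {\<zero>})"
proof -
  have ess: "essential_ideal (ann R (u \<otimes> v)) R" if "u \<in> M - {\<zero>}" "v \<in> M - {\<zero>}" for u v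
    using that by (intro essential_ann I_r_closed) simp_all
  have "(u \<in> M - {\<zero>} \<and> v \<in> M - {\<zero>} \<and> u \<noteq> v \<and> essential_ideal (ann R (u \<otimes> v)) R) \<longleftrightarrow>
      (u \<in> M - {\<zero>} \<and> v \<in> M - {\<zero>} \<and> u \<noteq> v)" for u v
    using ess[of u v] by blast
  then show ?thesis
    unfolding essential_graph_def complete_graph_def nonzero_zero_divisors_eq by (simp only:)
qed

lemma planar_line_graph_essential_graph_iff:
  "planar (line_graph (essential_graph R)) \<longleftrightarrow> card M \<le> 5"
proof -
  have fin: "finite (M - {\<zero>})"
    using finite_M by simp
  have card: "card (M - {\<zero>}) = card M - 1"
    using M_zero finite_M by simp
  show ?thesis
    unfolding essential_graph_complete
    using planar_line_graph_complete[OF fin] nonplanar_line_graph_complete[OF fin] card by linarith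
qed

end

lemma ring_iso_inverse_hom:
  assumes "ring A" "A \<simeq> Q"
  obtains g where "g \<in> ring_hom Q A"
proof -
  obtain f where "f \<in> ring_iso A Q"
    using assms(2) unfolding is_ring_iso_def by auto
  then have "inv_into (carrier A) f \<in> ring_iso Q A"
    by (rule ring_iso_set_sym[OF assms(1)])
  then show thesis
    unfolding ring_iso_def by (intro that[of "inv_into (carrier A) f"]) simp
qed

theorem theorem3p2:
  fixes A :: "('a, 'm) ring_scheme"
  assumes "cring A"
    and "\<one>\<^bsub>A\<^esub> \<noteq> \<zero>\<^bsub>A\<^esub>"
    and "finite (carrier A)"
    and "local_ring A"
    and "\<not> field A"
  shows "planar (line_graph (essential_graph A)) \<longleftrightarrow>
    A \<simeq> residue_ring 4 \<or>
    A \<simeq> residue_ring 8 \<or>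
    A \<simeq> residue_ring 9 \<or>
    A \<simeq> residue_ring 25 \<or>
    A \<simeq> poly_mod_power (residue_ring 2) 2 \<or>
    A \<simeq> poly_mod_power (residue_ring 3) 2 \<or>
    A \<simeq> poly_mod_power (residue_ring 2) 3 \<or>
    A \<simeq> poly_mod_power (residue_ring 5) 2 \<or>
    A \<simeq> Z4_x3_x2m2 \<or>
    A \<simeq> poly_mod_power F4 2 \<or>
    A \<simeq> Z4_2x_x2 \<or>
    A \<simeq> Z2_xy_x2_xy_y2 \<or>
    A \<simeq> Z4_x2_x_1"
proof -
  obtain M where "finite_local_ring A M"
    by (rule finite_local_ringI[OF assms])
  then interpret finite_local_ring A M .
  have res: "cring (residue_ring n)" if "n > 1" for n
    using that by (rule residue_ring_cring)
  have small: "card M \<le> 5" if "A \<simeq> Q" "card (carrier Q) \<le> 9" for Q :: "('b, 'n) ring_scheme"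
    using card_M_le_half ring_iso_same_card[OF that(1)] that(2) by simp
  have char_25: "card M \<le> 5"
    if Q: "A \<simeq> Q" "card (carrier Q) \<le> 25" "f \<in> ring_hom (residue_ring n) Q" "n > 1" "n dvd 25"
    for Q :: "('b, 'n) ring_scheme" and f n
  proof (rule card_M_le_char_25)
    show "card (carrier A) \<le> 25"
      using ring_iso_same_card[OF Q(1)] Q(2) by simp
    obtain g where g: "g \<in> ring_hom Q A"
      by (rule ring_iso_inverse_hom[OF ring_axioms Q(1)])
    have "int_elem n = \<zero>\<^bsub>A\<^esub>"
      by (rule ring_hom_residue_ring_char[OF is_cring ring_hom_trans[OF Q(3) g] Q(4)])
    then show "int_elem 25 = \<zero>\<^bsub>A\<^esub>"
      using Q(5) by (rule int_elem_multiple)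
  qed
  have omega: "card M \<le> 5"
    if Q: "A \<simeq> Q" "card (carrier Q) \<le> 16" "cring Q" "v \<in> carrier Q" "v \<otimes>\<^bsub>Q\<^esub> v \<oplus>\<^bsub>Q\<^esub> v \<oplus>\<^bsub>Q\<^esub> \<one>\<^bsub>Q\<^esub> = \<zero>\<^bsub>Q\<^esub>"
    for Q :: "('b, 'n) ring_scheme" and v
  proof -
    interpret Q: cring Q by (rule Q(3))
    obtain g where g: "g \<in> ring_hom Q A"
      by (rule ring_iso_inverse_hom[OF ring_axioms Q(1)])
    have "g v \<otimes>\<^bsub>A\<^esub> g v \<oplus>\<^bsub>A\<^esub> g v \<oplus>\<^bsub>A\<^esub> \<one>\<^bsub>A\<^esub> = g (v \<otimes>\<^bsub>Q\<^esub> v \<oplus>\<^bsub>Q\<^esub> v \<oplus>\<^bsub>Q\<^esub> \<one>\<^bsub>Q\<^esub>)"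
      using Q(4) by (simp add: ring_hom_add[OF g] ring_hom_mult[OF g] ring_hom_one[OF g])
    also have "\<dots> = \<zero>\<^bsub>A\<^esub>"
      unfolding Q(5) by (rule ring_hom_zero[OF g Q.ring_axioms ring_axioms])
    finally show ?thesis
      using ring_iso_same_card[OF Q(1)] Q(2) ring_hom_closed[OF g Q(4)]
      by (intro card_M_le_omega[of "g v"]) simp_all
  qed
  have dual: "card (carrier (poly_mod_power (residue_ring n) 2)) \<le> nat n * nat n" if "n > 1" for n
    using dual_numbers_card(2)[OF res[OF that] residue_ring_card(1)] by (simp add: residue_ring_card)
  have "cring (residue_ring 2)"
    by (rule res) simp
  note F4_facts = omega_quot[OF this residue_ring_card(1), folded F4_eq]
  have F4_card: "card (carrier F4) \<le> 4"
    using F4_facts(5) by (simp add: residue_ring_card)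
  have F4_sub: "{pvar F4 [^]\<^bsub>UP F4\<^esub> (2::nat)} \<subseteq> carrier (UP F4)"
    using UP_pow_closed[OF F4_facts(1)] by simp
  have bound1: "card M \<le> 5" if "A \<simeq> poly_mod_power F4 2"
  proof -
    let ?Q = "poly_mod_power F4 2"
    let ?c = "quot_const F4 {pvar F4 [^]\<^bsub>UP F4\<^esub> (2::nat)}"
    let ?t = "quot_var (residue_ring 2) {omega_rel (residue_ring 2)}"
    have Q: "cring ?Q"
      unfolding poly_mod_power_def by (rule poly_quot_cring[OF F4_facts(1) F4_sub])
    interpret F: cring F4 by (rule F4_facts(1))
    interpret Q: cring ?Q by (rule Q)
    have c: "?c \<in> ring_hom F4 ?Q"
      unfolding poly_mod_power_def by (rule quot_const_hom[OF F.is_cring F4_sub])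
    have t: "?t \<in> carrier F4" "?t \<otimes>\<^bsub>F4\<^esub> ?t \<oplus>\<^bsub>F4\<^esub> ?t \<oplus>\<^bsub>F4\<^esub> \<one>\<^bsub>F4\<^esub> = \<zero>\<^bsub>F4\<^esub>"
      using F4_facts(2,3) .
    have "?c ?t \<otimes>\<^bsub>?Q\<^esub> ?c ?t \<oplus>\<^bsub>?Q\<^esub> ?c ?t \<oplus>\<^bsub>?Q\<^esub> \<one>\<^bsub>?Q\<^esub> = ?c (?t \<otimes>\<^bsub>F4\<^esub> ?t \<oplus>\<^bsub>F4\<^esub> ?t \<oplus>\<^bsub>F4\<^esub> \<one>\<^bsub>F4\<^esub>)"
      using t(1) by (simp add: ring_hom_add[OF c] ring_hom_mult[OF c] ring_hom_one[OF c])
    also have "\<dots> = \<zero>\<^bsub>?Q\<^esub>"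
      unfolding t(2) by (rule ring_hom_zero[OF c F.ring_axioms Q.ring_axioms])
    finally have rel: "?c ?t \<otimes>\<^bsub>?Q\<^esub> ?c ?t \<oplus>\<^bsub>?Q\<^esub> ?c ?t \<oplus>\<^bsub>?Q\<^esub> \<one>\<^bsub>?Q\<^esub> = \<zero>\<^bsub>?Q\<^esub>" .
    have "card (carrier ?Q) \<le> 16"
      using dual_numbers_card(2)[OF F4_facts(1,4)] mult_le_mono[OF F4_card F4_card] by simp
    then show ?thesis
      by (rule omega[OF that _ Q ring_hom_closed[OF c t(1)] rel])
  qed
  have bound2: "card M \<le> 5" if "A \<simeq> Z4_x2_x_1"
    using omega[OF that] omega_quot[OF res residue_ring_card(1), of 4, folded Z4_x2_x_1_eq]
    by (simp add: residue_ring_card)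
  have bound3: "card M \<le> 5" if "A \<simeq> residue_ring 25"
    using char_25[OF that _ id_ring_hom] by (simp add: residue_ring_card)
  have bound4: "card M \<le> 5" if iso: "A \<simeq> poly_mod_power (residue_ring 5) 2"
  proof -
    have R: "cring (residue_ring 5)"
      by (rule res) simp
    have S: "{pvar (residue_ring 5) [^]\<^bsub>UP (residue_ring 5)\<^esub> (2::nat)} \<subseteq> carrier (UP (residue_ring 5))"
      using UP_pow_closed[OF R] by simp
    show ?thesis
      using char_25[OF iso _ quot_const_hom[OF R S, folded poly_mod_power_def]] dual[of 5] by simp
  qed
  have bound5: "card M \<le> 5" if "A \<simeq> poly_mod_power (residue_ring 2) 3"
    using small[OF that] cubic_card(2)[OF res residue_ring_card(1), of 2] by (simp add: residue_ring_card)
  have bound6: "card M \<le> 5" if "A \<simeq> poly_mod_power (residue_ring 2) 2"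
    using small[OF that] dual[of 2] by simp
  have bound7: "card M \<le> 5" if "A \<simeq> poly_mod_power (residue_ring 3) 2"
    using small[OF that] dual[of 3] by simp
  have bound8: "card M \<le> 5" if "A \<simeq> residue_ring 4"
    using small[OF that] by (simp add: residue_ring_card)
  have bound9: "card M \<le> 5" if "A \<simeq> residue_ring 8"
    using small[OF that] by (simp add: residue_ring_card)
  have bound10: "card M \<le> 5" if "A \<simeq> residue_ring 9"
    using small[OF that] by (simp add: residue_ring_card)
  have bound11: "card M \<le> 5" if "A \<simeq> Z4_x3_x2m2"
    using small[OF that] Z4_x3_x2m2_card(2) by simp
  have bound12: "card M \<le> 5" if "A \<simeq> Z4_2x_x2"
    using small[OF that] Z4_2x_x2_card(2) by simp
  have bound13: "card M \<le> 5" if "A \<simeq> Z2_xy_x2_xy_y2"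
    using small[OF that] Z2_xy_card(2) by simp
  show ?thesis
    unfolding planar_line_graph_essential_graph_iff
  proof
    assume "card M \<le> 5"
    then show "A \<simeq> residue_ring 4 \<or> A \<simeq> residue_ring 8 \<or> A \<simeq> residue_ring 9 \<or> A \<simeq> residue_ring 25 \<or>
      A \<simeq> poly_mod_power (residue_ring 2) 2 \<or> A \<simeq> poly_mod_power (residue_ring 3) 2 \<or>
      A \<simeq> poly_mod_power (residue_ring 2) 3 \<or> A \<simeq> poly_mod_power (residue_ring 5) 2 \<or>
      A \<simeq> Z4_x3_x2m2 \<or> A \<simeq> poly_mod_power F4 2 \<or> A \<simeq> Z4_2x_x2 \<or> A \<simeq> Z2_xy_x2_xy_y2 \<or> A \<simeq> Z4_x2_x_1"
      by (rule classification)
  qed (elim disjE; erule bound1 bound2 bound3 bound4 bound5 bound6 bound7 bound8 bound9 bound10 bound11 bound12 bound13)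
qed

end
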